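(* Let $N$ be a positive integer, $\omega>0$, and consider the Newtonian $N$-body problem given in the context, in either of the two cases in which its (possibly complex) coupling constants satisfy $$A_3=D_2=F_4=G_3=0,$$ or $$A_0=A_1=B_0=D_0=F_0=F_1=F_2=G_0=G_1=0.$$ Then the following additional restrictions on the parameters are necessary, and also sufficient (up to some minor additional restrictions to exclude the coincidence of eigenvalues $\lambda_m^{(\pm)}$), to guarantee that this Newtonian $N$-body problem be isochronous with period $T$: $$E=-2ir_1\omega,\quad D_1=-2ir_2\omega,\quad G_2=-2ir_3\omega,\quad A_2=a_2\omega^2,\quad B_1=b_1\omega^2,\quad F_3=f_3\omega^2,$$ with $$f_3=2r_3(s_2r_4-R_2),\qquad a_2=2(s_1s_2-1)R_1r_3-R_2^2+r_4^2-3(N-1)f_3,$$ $$b_1=2R_1(s_1r_4-R_2)-(2N-1)a_2-(3N^2-6N+2)f_3,$$ $$R_1=r_1+N[r_2+(N-1)r_3],\qquad R_2=r_2+(2N-1)r_3,$$ where $r_1,r_2,r_3,r_4$ are 4 arbitrary rational numbers and $s_1,s_2$ are two arbitrary signs ($+$ or $-$). Indeed, with these assignments the $2N$ eigenvalues $\lambda_m^{(\pm)}$ (defined in the context) are $\lambda_m^{(\pm)}=i\,r_m^{(\pm)}\omega$, $m=1,\dots,N$, with the rational numbers $$r_m^{(\pm)}=(1\pm s_1)R_1-(R_2\pm r_4)m+(1\pm s_2)r_3m^2.$$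
   Context: Here $i^2=-1$ and dots denote $d/dt$. The Newtonian $N$-body problem, for complex coordinates $z_1(t),\dots,z_N(t)$, is, for $n=1,\dots,N$, $$\ddot z_n+E\dot z_n=B_0+B_1z_n-(N-1)[2A_3+3(N-2)F_4]z_n^2+(N-1)(N-2)G_3\dot z_nz_n$$ $$+\sum_{\ell=1;\,\ell\ne n}^N\frac{2\dot z_n\dot z_\ell+2(A_0+A_1z_n+A_2z_n^2+A_3z_n^3)-(\dot z_n+\dot z_\ell)(D_0+D_1z_n)-D_2z_n(\dot z_nz_\ell+\dot z_\ell z_n)}{z_n-z_\ell}$$ $$+\sum_{k,\ell=1;\,k\ne n,\,\ell\ne n,\,k\ne\ell}^N\bigg[\frac{3(F_0+F_1z_n+F_2z_n^2+F_3z_n^3+F_4z_n^4)}{(z_n-z_\ell)(z_n-z_k)}-\frac{G_0+G_1z_n+G_2z_n^2+G_3z_n^3}{z_n-z_\ell}\Big(\frac{\dot z_n+\dot z_k}{z_n-z_k}+\frac{\dot z_\ell+\dot z_k}{z_\ell-z_k}\Big)\bigg].$$ The coefficients $c_m(t)$ of the polynomial $\prod_{n=1}^N[z-z_n(t)]=z^N+\sum_{m=1}^Nc_m(t)z^{N-m}$ then evolve according to a linear second-order system with constant coefficients, and in the two cases considered its $2N$ characteristic exponents (eigenvalues) are $$\lambda_m^{(\pm)}=-\tfrac12\big\{E+(N-m)[D_1+(N-1-m)G_2]\pm\Delta_m\big\},\qquad m=1,\dots,N,$$ $$\Delta_m^2=\{E+(N-m)[D_1+(N-1-m)G_2]\}^2+4m\big\{(2N-1-m)A_2+B_1+[3N^2-6N+2-3(N-1)m+m^2]F_3\big\}$$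 (the choice of the sign of $\Delta_m$ only affects the labeling of $\lambda_m^{(+)}$ and $\lambda_m^{(-)}$). Isochronous means that all solutions are periodic with a fixed period independent of the initial data. The period is $T=2\pi q/\omega$, where $q$ is the minimum common multiple of the denominators of the $2N$ rational numbers $r_m^{(\pm)}$ (written in lowest terms) in $\lambda_m^{(\pm)}=i\,r_m^{(\pm)}\omega$; it is understood that in some open regions of phase space the coordinates $z_n(t)$ may only be periodic with a period which is a (generally small) integer multiple of $T$, because the zeros of the $T$-periodic polynomial may exchange their roles over the time evolution.
   Formalization: Literal necessity is false (N=1: D_1 is irrelevant). Proved: isochrony gives rational r_m for m≤N, and the restrictions if the formula is rational also for m>N. Sufficiency assumes distinct eigenvalues, also nonzero unless the second case holds. *)

theory Defs
  imports "HOL-Analysis.Analysis" "HOL-Computational_Algebra.Polynomial"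
begin

(* A_j, B_j, D_j, F_j, G_j are cA K j, ...; only j <= 3, 1, 2, 4, 3 respectively ever occur. *)
record couplings =
  cA :: "nat \<Rightarrow> complex"
  cB :: "nat \<Rightarrow> complex"
  cD :: "nat \<Rightarrow> complex"
  cE :: complex
  cF :: "nat \<Rightarrow> complex"
  cG :: "nat \<Rightarrow> complex"

(* z and v are the positions and velocities; the particles are labelled by {1..N}. *)
definition nbody_accel ::
  "nat \<Rightarrow> couplings \<Rightarrow> (nat \<Rightarrow> complex) \<Rightarrow> (nat \<Rightarrow> complex) \<Rightarrow> nat \<Rightarrow> complex" where
  "nbody_accel N K z v n =
     - cE K * v n + cB K 0 + cB K 1 * z n
     - (of_nat N - 1) * (2 * cA K 3 + 3 * (of_nat N - 2) * cF K 4) * z n ^ 2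
     + (of_nat N - 1) * (of_nat N - 2) * cG K 3 * v n * z n
     + (\<Sum>l\<in>{1..N} - {n}.
          (2 * v n * v l + 2 * (\<Sum>j\<le>3. cA K j * z n ^ j)
           - (v n + v l) * (cD K 0 + cD K 1 * z n)
           - cD K 2 * z n * (v n * z l + v l * z n)) / (z n - z l))
     + (\<Sum>k\<in>{1..N} - {n}. \<Sum>l\<in>{1..N} - {n, k}.
          3 * (\<Sum>j\<le>4. cF K j * z n ^ j) / ((z n - z l) * (z n - z k))
          - (\<Sum>j\<le>3. cG K j * z n ^ j) / (z n - z l)
            * ((v n + v k) / (z n - z k) + (v l + v k) / (z l - z k)))"

definition nbody_solution_on ::
  "nat \<Rightarrow> couplings \<Rightarrow> real set \<Rightarrow> (nat \<Rightarrow> real \<Rightarrow> complex) \<Rightarrow> bool" where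
  "nbody_solution_on N K S z \<longleftrightarrow>
     (\<exists>v. \<forall>t\<in>S. inj_on (\<lambda>n. z n t) {1..N} \<and>
        (\<forall>n\<in>{1..N}.
           (z n has_vector_derivative v n t) (at t) \<and>
           (v n has_vector_derivative nbody_accel N K (\<lambda>l. z l t) (\<lambda>l. v l t) n) (at t)))"

definition config_poly :: "nat \<Rightarrow> (nat \<Rightarrow> real \<Rightarrow> complex) \<Rightarrow> real \<Rightarrow> complex poly" where
  "config_poly N z t = (\<Prod>n\<in>{1..N}. [:- z n t, 1:])"

(* The configuration as an unordered set of zeros is T-periodic, while an individual coordinate,
   whose zero may be permuted with others during a period, is periodic with period p T.  Solutions
   on arbitrary open intervals are considered, so motions with a limited lifetime (ending in a
   collision) are covered too; for S = UNIV this is periodicity in the usual sense. *)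
definition isochronous :: "nat \<Rightarrow> couplings \<Rightarrow> real \<Rightarrow> bool" where
  "isochronous N K T \<longleftrightarrow> 0 < T \<and>
     (\<forall>S z. open S \<and> is_interval S \<and> nbody_solution_on N K S z \<longrightarrow>
        (\<forall>t\<in>S. t + T \<in> S \<longrightarrow> config_poly N z (t + T) = config_poly N z t) \<and>
        (\<exists>p::nat. p > 0 \<and>
           (\<forall>n\<in>{1..N}. \<forall>t\<in>S. t + real p * T \<in> S \<longrightarrow> z n (t + real p * T) = z n t)))"

definition case1 :: "couplings \<Rightarrow> bool" where
  "case1 K \<longleftrightarrow> cA K 3 = 0 \<and> cD K 2 = 0 \<and> cF K 4 = 0 \<and> cG K 3 = 0"

definition case2 :: "couplings \<Rightarrow> bool" where
  "case2 K \<longleftrightarrow> cA K 0 = 0 \<and> cA K 1 = 0 \<and> cB K 0 = 0 \<and> cD K 0 = 0 \<and>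
     cF K 0 = 0 \<and> cF K 1 = 0 \<and> cF K 2 = 0 \<and> cG K 0 = 0 \<and> cG K 1 = 0"

definition damping :: "nat \<Rightarrow> couplings \<Rightarrow> nat \<Rightarrow> complex" where
  "damping N K m =
     cE K + (of_nat N - of_nat m) * (cD K 1 + (of_nat N - 1 - of_nat m) * cG K 2)"

definition Delta_sq :: "nat \<Rightarrow> couplings \<Rightarrow> nat \<Rightarrow> complex" where
  "Delta_sq N K m = damping N K m ^ 2
     + 4 * of_nat m * ((2 * of_nat N - 1 - of_nat m) * cA K 2 + cB K 1
         + (3 * of_nat N ^ 2 - 6 * of_nat N + 2 - 3 * (of_nat N - 1) * of_nat m
            + of_nat m ^ 2) * cF K 3)"

(* The sign in the superscript is s = 1 or s = -1.  Taking Delta_m to be the principal square root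
   only fixes which of the two eigenvalues is called lambda_m^(+). *)
definition eigval :: "nat \<Rightarrow> couplings \<Rightarrow> int \<Rightarrow> nat \<Rightarrow> complex" where
  "eigval N K s m = - (damping N K m + of_int s * csqrt (Delta_sq N K m)) / 2"

definition rational_eigval :: "nat \<Rightarrow> couplings \<Rightarrow> real \<Rightarrow> nat \<Rightarrow> bool" where
  "rational_eigval N K \<omega> m \<longleftrightarrow>
     (\<forall>s\<in>{1, -1}. \<exists>r::rat. eigval N K s m = \<i> * of_rat r * of_real \<omega>)"

definition R1 :: "nat \<Rightarrow> rat \<Rightarrow> rat \<Rightarrow> rat \<Rightarrow> rat" where
  "R1 N r1 r2 r3 = r1 + of_nat N * (r2 + (of_nat N - 1) * r3)"

definition R2 :: "nat \<Rightarrow> rat \<Rightarrow> rat \<Rightarrow> rat" where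
  "R2 N r2 r3 = r2 + (2 * of_nat N - 1) * r3"

definition f3 :: "nat \<Rightarrow> rat \<Rightarrow> rat \<Rightarrow> rat \<Rightarrow> int \<Rightarrow> rat" where
  "f3 N r2 r3 r4 s2 = 2 * r3 * (of_int s2 * r4 - R2 N r2 r3)"

definition a2 :: "nat \<Rightarrow> rat \<Rightarrow> rat \<Rightarrow> rat \<Rightarrow> rat \<Rightarrow> int \<Rightarrow> int \<Rightarrow> rat" where
  "a2 N r1 r2 r3 r4 s1 s2 =
     2 * (of_int s1 * of_int s2 - 1) * R1 N r1 r2 r3 * r3 - R2 N r2 r3 ^ 2 + r4 ^ 2
     - 3 * (of_nat N - 1) * f3 N r2 r3 r4 s2"

definition b1 :: "nat \<Rightarrow> rat \<Rightarrow> rat \<Rightarrow> rat \<Rightarrow> rat \<Rightarrow> int \<Rightarrow> int \<Rightarrow> rat" where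
  "b1 N r1 r2 r3 r4 s1 s2 =
     2 * R1 N r1 r2 r3 * (of_int s1 * r4 - R2 N r2 r3)
     - (2 * of_nat N - 1) * a2 N r1 r2 r3 r4 s1 s2
     - (3 * of_nat N ^ 2 - 6 * of_nat N + 2) * f3 N r2 r3 r4 s2"

definition restrictions ::
  "nat \<Rightarrow> real \<Rightarrow> couplings \<Rightarrow> rat \<Rightarrow> rat \<Rightarrow> rat \<Rightarrow> rat \<Rightarrow> int \<Rightarrow> int \<Rightarrow> bool" where
  "restrictions N \<omega> K r1 r2 r3 r4 s1 s2 \<longleftrightarrow>
     cE K = - 2 * \<i> * of_rat r1 * of_real \<omega> \<and>
     cD K 1 = - 2 * \<i> * of_rat r2 * of_real \<omega> \<and>
     cG K 2 = - 2 * \<i> * of_rat r3 * of_real \<omega> \<and>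
     cA K 2 = of_rat (a2 N r1 r2 r3 r4 s1 s2) * of_real \<omega> ^ 2 \<and>
     cB K 1 = of_rat (b1 N r1 r2 r3 r4 s1 s2) * of_real \<omega> ^ 2 \<and>
     cF K 3 = of_rat (f3 N r2 r3 r4 s2) * of_real \<omega> ^ 2"

definition freq ::
  "nat \<Rightarrow> rat \<Rightarrow> rat \<Rightarrow> rat \<Rightarrow> rat \<Rightarrow> int \<Rightarrow> int \<Rightarrow> int \<Rightarrow> nat \<Rightarrow> rat" where
  "freq N r1 r2 r3 r4 s1 s2 s m =
     (1 + of_int s * of_int s1) * R1 N r1 r2 r3
     - (R2 N r2 r3 + of_int s * r4) * of_nat m
     + (1 + of_int s * of_int s2) * r3 * of_nat m ^ 2"

definition period ::
  "nat \<Rightarrow> real \<Rightarrow> rat \<Rightarrow> rat \<Rightarrow> rat \<Rightarrow> rat \<Rightarrow> int \<Rightarrow> int \<Rightarrow> real" where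
  "period N \<omega> r1 r2 r3 r4 s1 s2 =
     2 * pi * real_of_int
       (Lcm ((\<lambda>(s, m). snd (quotient_of (freq N r1 r2 r3 r4 s1 s2 s m))) ` ({1, -1} \<times> {1..N})))
     / \<omega>"

(* The 2N eigenvalues are pairwise distinct.  In the first case c_0 = 1 enters the linear system for
   c_1, ..., c_N as a constant forcing term, i.e. with exponent 0, so that the coincidence of an
   eigenvalue with 0 has to be excluded as well (N = 1, B_0 \<noteq> 0 = B_1 gives a drift);
   in the second case the system is homogeneous. *)
definition no_coincidence :: "nat \<Rightarrow> couplings \<Rightarrow> bool" where
  "no_coincidence N K \<longleftrightarrow>
     inj_on (\<lambda>(s, m). eigval N K s m) ({1, -1} \<times> {1..N}) \<and>
     (case2 K \<or> (\<forall>s\<in>{1, -1}. \<forall>m\<in>{1..N}. eigval N K s m \<noteq> 0))"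

end

(* With psi(z, t) = prod_n (z - z_n(t)), the equations of motion say that a linear third-order
   differential operator applied to psi vanishes at the zeros of psi.  As the result has degree at
   most N + 1 it equals (alpha z + beta) psi with constants alpha, beta, so the coefficients of psi
   solve a linear system with constant coefficients; in the two cases it is triangular, from the
   highest coefficient downwards or from the lowest upwards, and its exponents can be read off.

   Sufficiency: solving the triangular system successively, the coefficients are sums of exponentials
   (no resonance occurs as the exponents are distinct), hence T-periodic, and over one period the
   zeros undergo a fixed permutation, of finite order.

   Necessity: an entire solution of the linear system whose discriminant does not vanish identically
   becomes, after translation by a generic imaginary time, a collision-free motion on the whole real
   line.  By isochrony and the identity theorem it is T-periodic.  Comparing two solutions which
   differ in one initial velocity gives exp(lambda T) = 1 for every eigenvalue.

   If all eigenvalues are rational multiples of i omega, then Delta_m^2 is up to a constant factor a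
   quartic in m whose values are rational squares, and such a quartic is the square of a quadratic;
   comparing coefficients gives the parametrisation by r_1, ..., r_4, s_1, s_2. *)

theory Submission
  imports Defs "HOL-Complex_Analysis.Complex_Analysis" "HOL-Combinatorics.Cycles"
    "HOL-Real_Asymp.Real_Asymp" "HOL-Computational_Algebra.Fundamental_Theorem_Algebra"
begin

text \<open>Isochrony constrains only the modes m = 1, ..., N; for N = 1 the force does not even
  involve D_1. A quartic can take rational square values at finitely many points without being a
  square, so the parametrisation is derived under the further condition that the eigenvalue formula
  gives rational multiples for m > N too. The signs and r_4 are the only freedom left in the square
  root of that quartic: Delta_m^2 / (-4 omega^2) has leading coefficient r_3^2 and constant
  coefficient R_1^2, so its root is s_1 R_1 - r_4 m + s_2 r_3 m^2 up to an overall sign. Necessity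
  cannot start from a sum of distinct exponentials, as eigenvalues may coincide there, nor from an
  arbitrary real motion, which may collide before a full period has passed. Hence the detour through
  entire solutions starting at the polynomial z^N - 1, whose discriminant does not vanish. Raising
  one initial velocity leaves this polynomial unchanged, so both solutions compared are admissible,
  though each may need an imaginary translation of its own.\<close>

section \<open>The equations of motion as a linear evolution of polynomials\<close>

text \<open>\<open>node_poly1\<close> and \<open>node_poly2\<close> are the first two time derivatives of \<open>node_poly\<close> for zeros with
  velocities \<open>v\<close> and accelerations \<open>a\<close>.\<close>

definition node_poly :: "nat set \<Rightarrow> (nat \<Rightarrow> complex) \<Rightarrow> complex poly" where
  "node_poly A z = (\<Prod>n\<in>A. [:- z n, 1:])"

definition node_poly1 :: "nat set \<Rightarrow> (nat \<Rightarrow> complex) \<Rightarrow> (nat \<Rightarrow> complex) \<Rightarrow> complex poly" where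
  "node_poly1 A z v = - (\<Sum>n\<in>A. smult (v n) (node_poly (A - {n}) z))"

definition node_poly2 ::
  "nat set \<Rightarrow> (nat \<Rightarrow> complex) \<Rightarrow> (nat \<Rightarrow> complex) \<Rightarrow> (nat \<Rightarrow> complex) \<Rightarrow> complex poly" where
  "node_poly2 A z v a =
     - (\<Sum>n\<in>A. smult (a n) (node_poly (A - {n}) z) + smult (v n) (node_poly1 (A - {n}) z v))"

lemma smult_sum_right: "smult c (sum f A) = (\<Sum>x\<in>A. smult c (f x))"
  by (induction A rule: infinite_finite_induct) (auto simp: smult_add_right)

lemma insert_Diff_swap: "n \<notin> A \<Longrightarrow> k \<in> A \<Longrightarrow> insert n A - {k} = insert n (A - {k})"
  by auto

section \<open>Leibniz rules for adjoining one moving zero\<close>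

lemma node_poly_insert:
  "finite A \<Longrightarrow> n \<notin> A \<Longrightarrow> node_poly (insert n A) z = [:- z n, 1:] * node_poly A z"
  unfolding node_poly_def by (rule prod.insert)

lemma node_poly_insert_Diff:
  "finite A \<Longrightarrow> n \<notin> A \<Longrightarrow> k \<in> A \<Longrightarrow>
    node_poly (insert n A - {k}) z = [:- z n, 1:] * node_poly (A - {k}) z"
  using node_poly_insert[of "A - {k}" n z] by (simp add: insert_Diff_swap)

lemma node_poly1_insert:
  assumes "finite A" "n \<notin> A"
  shows "node_poly1 (insert n A) z v = [:- z n, 1:] * node_poly1 A z v - smult (v n) (node_poly A z)"
proof -
  have "(\<Sum>k\<in>A. smult (v k) (node_poly (insert n A - {k}) z))
      = (\<Sum>k\<in>A. smult (v k) ([:- z n, 1:] * node_poly (A - {k}) z))"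
    using assms by (intro sum.cong refl) (simp add: node_poly_insert_Diff)
  then show ?thesis
    using assms by (simp add: node_poly1_def sum_distrib_left del: mult_pCons_left)
qed

lemma node_poly1_insert_Diff:
  "finite A \<Longrightarrow> n \<notin> A \<Longrightarrow> k \<in> A \<Longrightarrow> node_poly1 (insert n A - {k}) z v =
    [:- z n, 1:] * node_poly1 (A - {k}) z v - smult (v n) (node_poly (A - {k}) z)"
  using node_poly1_insert[of "A - {k}" n z v] by (simp add: insert_Diff_swap)

text \<open>Of the two copies of the mixed term, one is the summand of \<open>n\<close> itself and
  the other comes from the velocity of \<open>n\<close> inside the summands of
  \<open>A\<close>.\<close>

lemma node_poly2_insert:
  assumes "finite A" "n \<notin> A"
  shows "node_poly2 (insert n A) z v a =
    [:- z n, 1:] * node_poly2 A z v a - smult (2 * v n) (node_poly1 A z v) - smult (a n) (node_poly A z)"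
proof -
  have "smult (a k) (node_poly (insert n A - {k}) z) + smult (v k) (node_poly1 (insert n A - {k}) z v)
      = [:- z n, 1:] * (smult (a k) (node_poly (A - {k}) z) + smult (v k) (node_poly1 (A - {k}) z v))
          - smult (v n) (smult (v k) (node_poly (A - {k}) z))" if "k \<in> A" for k
    using assms that
    by (simp add: node_poly_insert_Diff node_poly1_insert_Diff smult_diff_right distrib_left mult.commute[of "v k"]
        del: mult_pCons_left)
  then have "(\<Sum>k\<in>A. smult (a k) (node_poly (insert n A - {k}) z) + smult (v k) (node_poly1 (insert n A - {k}) z v))
      = [:- z n, 1:] * - node_poly2 A z v a + smult (v n) (node_poly1 A z v)"
    by (simp add: sum_subtractf node_poly2_def node_poly1_def sum_distrib_left[symmetric]
        smult_sum_right del: mult_pCons_left)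
  then have "node_poly2 (insert n A) z v a = - (smult (a n) (node_poly A z) + smult (v n) (node_poly1 A z v)
      + ([:- z n, 1:] * - node_poly2 A z v a + smult (v n) (node_poly1 A z v)))"
    using assms by (simp add: node_poly2_def[of "insert n A"] del: mult_pCons_left)
  also have "\<dots> = [:- z n, 1:] * node_poly2 A z v a - smult (2 * v n) (node_poly1 A z v) - smult (a n) (node_poly A z)"
    by (simp only: mult_2 smult_add_left) simp
  finally show ?thesis .
qed

lemma poly_node_poly: "finite A \<Longrightarrow> poly (node_poly A z) x = (\<Prod>l\<in>A. x - z l)"
  by (simp add: node_poly_def poly_prod)

lemma node_poly_roots:
  assumes "finite A"
  shows "poly (node_poly A z) x = 0 \<longleftrightarrow> x \<in> z ` A"
  using assms by (auto simp: poly_node_poly)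

text \<open>Induction step of \<open>node_poly_eval\<close> with the sums replaced by variables:
  \<open>y\<close> is the new factor, \<open>R\<close> the old product.\<close>

lemma node_poly_step:
  fixes y :: complex
  assumes "y \<noteq> 0"
  shows "R + y * (R * S) = y * R * (1 / y + S)"
    and "R * S + (R * S + y * (R * (S^2 - Q))) = y * R * ((1 / y + S)^2 - (1 / y^2 + Q))"
    and "y * (- R * V) - v * R = - (y * R) * (v / y + V)"
    and "- R * V + y * (- R * (V * S - W)) - v * (R * S)
      = - (y * R) * ((v / y + V) * (1 / y + S) - (v / y^2 + W))"
proof -
  \<comment> \<open>With \<open>k\<close> for the inverse of \<open>y\<close>, the goals are
    polynomial identities modulo \<open>y * k = 1\<close>, within reach of
    \<open>algebra\<close>.\<close>
  define k where "k = 1 / y"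
  have k: "y * k = 1" "1 / y = k" "1 / y^2 = k^2" "v / y = v * k" "v / y^2 = v * k^2"
    using assms by (simp_all add: k_def power_one_over divide_inverse power_inverse)
  show "R + y * (R * S) = y * R * (1 / y + S)"
    and "R * S + (R * S + y * (R * (S^2 - Q))) = y * R * ((1 / y + S)^2 - (1 / y^2 + Q))"
    and "y * (- R * V) - v * R = - (y * R) * (v / y + V)"
    and "- R * V + y * (- R * (V * S - W)) - v * (R * S)
      = - (y * R) * ((v / y + V) * (1 / y + S) - (v / y^2 + W))"
    unfolding k(2-) using k(1) by algebra+
qed

text \<open>Logarithmic derivatives away from the zeros: \<open>S\<close> is P'/P, and
  differentiating \<open>S\<close> and \<open>V\<close> in \<open>x\<close> gives \<open>- Q\<close>
  and \<open>- W\<close>.\<close>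

lemma node_poly_eval:
  fixes v :: "nat \<Rightarrow> complex"
  assumes "finite A" "\<And>l. l \<in> A \<Longrightarrow> x \<noteq> z l"
  defines "S \<equiv> (\<Sum>l\<in>A. 1 / (x - z l))" and "Q \<equiv> (\<Sum>l\<in>A. 1 / (x - z l)^2)"
    and "V \<equiv> (\<Sum>l\<in>A. v l / (x - z l))" and "W \<equiv> (\<Sum>l\<in>A. v l / (x - z l)^2)"
    and "R \<equiv> poly (node_poly A z) x"
  shows "R \<noteq> 0"
    and "poly (pderiv (node_poly A z)) x = R * S"
    and "poly (pderiv (pderiv (node_poly A z))) x = R * (S^2 - Q)"
    and "poly (node_poly1 A z v) x = - R * V"
    and "poly (pderiv (node_poly1 A z v)) x = - R * (V * S - W)"
proof -
  have "poly (node_poly A z) x \<noteq> 0"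
    using assms(1,2) by (simp add: poly_node_poly)
  moreover have "poly (pderiv (node_poly A z)) x = poly (node_poly A z) x * (\<Sum>l\<in>A. 1 / (x - z l)) \<and>
    poly (pderiv (pderiv (node_poly A z))) x
      = poly (node_poly A z) x * ((\<Sum>l\<in>A. 1 / (x - z l))^2 - (\<Sum>l\<in>A. 1 / (x - z l)^2)) \<and>
    poly (node_poly1 A z v) x = - poly (node_poly A z) x * (\<Sum>l\<in>A. v l / (x - z l)) \<and>
    poly (pderiv (node_poly1 A z v)) x
      = - poly (node_poly A z) x * ((\<Sum>l\<in>A. v l / (x - z l)) * (\<Sum>l\<in>A. 1 / (x - z l)) - (\<Sum>l\<in>A. v l / (x - z l)^2))"
    using assms(1,2)
  proof (induction A rule: finite_induct)
    case empty
    then show ?case by (simp add: node_poly_def node_poly1_def pderiv_1)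
  next
    case (insert n A)
    then have IH: "poly (pderiv (node_poly A z)) x = poly (node_poly A z) x * (\<Sum>l\<in>A. 1 / (x - z l))"
      "poly (pderiv (pderiv (node_poly A z))) x
      = poly (node_poly A z) x * ((\<Sum>l\<in>A. 1 / (x - z l))^2 - (\<Sum>l\<in>A. 1 / (x - z l)^2))"
      "poly (node_poly1 A z v) x = - poly (node_poly A z) x * (\<Sum>l\<in>A. v l / (x - z l))"
      "poly (pderiv (node_poly1 A z v)) x
      = - poly (node_poly A z) x * ((\<Sum>l\<in>A. v l / (x - z l)) * (\<Sum>l\<in>A. 1 / (x - z l)) - (\<Sum>l\<in>A. v l / (x - z l)^2))"
      by auto
    have nz: "x - z n \<noteq> 0" using insert.prems[of n] by simp
    define y where "y = x - z n"
    have y: "y \<noteq> 0" "x = y + z n" using nz by (auto simp: y_def)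
    have d: "pderiv ([:- z n, 1:] * q) = q + [:- z n, 1:] * pderiv q" for q
      by (simp only: pderiv_mult) (simp add: pderiv_pCons)
    have e: "poly ([:- z n, 1:] * q) x = y * poly q x" for q
      by (simp add: y_def algebra_simps)
    show ?case
      unfolding node_poly_insert[OF insert.hyps] node_poly1_insert[OF insert.hyps]
      unfolding d pderiv_add pderiv_diff pderiv_smult poly_add poly_diff poly_smult e IH
        sum.insert[OF insert.hyps] y_def[symmetric]
      by (intro conjI node_poly_step[OF y(1)])
  qed
  ultimately show "R \<noteq> 0"
    and "poly (pderiv (node_poly A z)) x = R * S"
    and "poly (pderiv (pderiv (node_poly A z))) x = R * (S^2 - Q)"
    and "poly (node_poly1 A z v) x = - R * V"
    and "poly (pderiv (node_poly1 A z v)) x = - R * (V * S - W)"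
    by (auto simp: assms(3-))
qed

section \<open>The forces in closed form and the differential operator behind them\<close>

lemma sum_offdiag_swap:
  assumes "finite A"
  shows "(\<Sum>k\<in>A. \<Sum>l\<in>A - {k}. f k l) = (\<Sum>k\<in>A. \<Sum>l\<in>A - {k}. f l k)"
  using sum.swap_restrict[OF assms assms, of f "\<lambda>k l. l \<noteq> k"]
  by (simp add: set_diff_eq Collect_conj_eq[symmetric] eq_commute)

lemma sum_offdiag_prod:
  fixes f g :: "'a \<Rightarrow> 'b :: comm_ring"
  shows "finite A \<Longrightarrow> (\<Sum>k\<in>A. \<Sum>l\<in>A - {k}. f k * g l) = (\<Sum>k\<in>A. f k) * (\<Sum>k\<in>A. g k) - (\<Sum>k\<in>A. f k * g k)"
  by (simp add: sum_distrib_left[symmetric] sum_diff1 algebra_simps sum_subtractf sum_distrib_right[symmetric])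

text \<open>\<open>P1\<close> and \<open>P2\<close> stand for the time derivatives of
  \<open>P\<close>. At a zero of \<open>P\<close>, with \<open>R\<close>, \<open>S\<close>,
  \<open>Q\<close> as in \<open>node_poly_eval\<close> for the other zeros, the x-derivatives of
  \<open>P\<close> of orders 1, 2, 3 are \<open>R\<close>, \<open>2 * R * S\<close> and
  \<open>3 * R * (S^2 - Q)\<close>. This explains the factors 2 and 3 in the forces and gives each
  force its own term here.\<close>

definition evol_op :: "nat \<Rightarrow> couplings \<Rightarrow> complex poly \<Rightarrow> complex poly \<Rightarrow> complex poly \<Rightarrow> complex poly" where
  "evol_op N K P P1 P2 = P2
     + [:cE K, - (of_nat N - 1) * (cD K 2 + (of_nat N - 2) * cG K 3):] * P1
     + [:cB K 0, cB K 1, - (of_nat N - 1) * (2 * cA K 3 + 3 * (of_nat N - 2) * cF K 4):] * pderiv P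
     + [:cA K 0, cA K 1, cA K 2, cA K 3:] * pderiv (pderiv P)
     + [:cD K 0, cD K 1, cD K 2:] * pderiv P1
     + [:cF K 0, cF K 1, cF K 2, cF K 3, cF K 4:] * pderiv (pderiv (pderiv P))
     + [:cG K 0, cG K 1, cG K 2, cG K 3:] * pderiv (pderiv P1)"

text \<open>Writing \<open>v * y + v' * x\<close> as \<open>(v + v') * x - v * (x - y)\<close>
  completes \<open>d0 + d1 * x\<close> to a quadratic polynomial; the leftover
  \<open>d2 * x * v\<close> is free of denominators.\<close>

lemma pair_term:
  fixes x :: complex
  assumes "x - y \<noteq> 0"
  shows "(2 * v * v' + 2 * AA - (v + v') * (d0 + d1 * x) - d2 * x * (v * y + v' * x)) / (x - y)
    = 2 * v * (v' * (1 / (x - y))) + 2 * AA * (1 / (x - y))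
      - (v * (1 / (x - y)) + v' * (1 / (x - y))) * (d0 + d1 * x + d2 * x ^ 2) + d2 * x * v"
proof -
  define w where "w = x - y"
  have "w \<noteq> 0" "y = x - w" using assms by (auto simp: w_def)
  then show ?thesis
    unfolding w_def[symmetric]
    by (simp add: divide_simps power2_eq_square) (simp add: algebra_simps)
qed

lemma triple_term:
  fixes p :: complex
  shows "3 * FF / (p * q) - GG / p * ((v + v') / q + w / r)
    = (3 * FF) * (1 / q * (1 / p)) - (GG * v) * (1 / q * (1 / p)) - GG * (v' * (1 / q) * (1 / p))
      - GG * (1 / p * (w / r))"
  by (simp add: divide_inverse algebra_simps)

text \<open>Exchanging the two summation indices and averaging removes the differences \<open>z l - z k\<close> from the
  three-body terms.\<close>

lemma symmetrized_term:
  fixes p :: complex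
  assumes "p \<noteq> 0" "q \<noteq> 0" "q - p \<noteq> 0"
  shows "1 / p * ((v + v') / (q - p)) + 1 / q * ((v' + v) / (p - q))
    = v' * (1 / q) * (1 / p) + v * (1 / p) * (1 / q)"
proof -
  define r where "r = q - p"
  have r: "q = p + r" "p - q = - r" by (auto simp: r_def)
  then have "p + r \<noteq> 0" "r \<noteq> 0" using assms by auto
  then show ?thesis
    unfolding r_def[symmetric] r(2) unfolding r(1)
    using assms(1) by (simp add: divide_simps) (simp add: algebra_simps)
qed

text \<open>The other particles enter only through the four sums in which
  \<open>node_poly_eval\<close> expresses the derivatives of the polynomial, which makes force and
  operator comparable.\<close>

lemma nbody_accel_closed_form:
  fixes v :: "nat \<Rightarrow> complex"
  assumes n: "n \<in> {1..N}" and inj: "inj_on z {1..N}"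
  defines "A \<equiv> {1..N} - {n}"
  defines "S \<equiv> (\<Sum>l\<in>A. 1 / (z n - z l))" and "Q \<equiv> (\<Sum>l\<in>A. 1 / (z n - z l)^2)"
    and "V \<equiv> (\<Sum>l\<in>A. v l / (z n - z l))" and "W \<equiv> (\<Sum>l\<in>A. v l / (z n - z l)^2)"
  shows "nbody_accel N K z v n =
     - cE K * v n + cB K 0 + cB K 1 * z n
     - (of_nat N - 1) * (2 * cA K 3 + 3 * (of_nat N - 2) * cF K 4) * z n ^ 2
     + (of_nat N - 1) * (of_nat N - 2) * cG K 3 * v n * z n
     + 2 * v n * V + 2 * (\<Sum>j\<le>3. cA K j * z n ^ j) * S
     - (v n * S + V) * (cD K 0 + cD K 1 * z n + cD K 2 * z n ^ 2)
     + (of_nat N - 1) * cD K 2 * z n * v n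
     + 3 * (\<Sum>j\<le>4. cF K j * z n ^ j) * (S^2 - Q)
     - (\<Sum>j\<le>3. cG K j * z n ^ j) * (v n * (S^2 - Q) + 2 * (V * S - W))"
proof -
  have fin: "finite A" by (simp add: A_def)
  have ne: "z n - z l \<noteq> 0" if "l \<in> A" for l
    using inj_onD[OF inj, of n l] n that unfolding A_def by auto
  have ne2: "z l - z k \<noteq> 0" if "l \<in> A" "k \<in> A" "k \<noteq> l" for l k
    using inj_onD[OF inj, of l k] that unfolding A_def by auto
  have cardA: "of_nat (card A) = (of_nat N - 1 :: complex)"
    using n by (simp add: A_def of_nat_diff)
  define a where "a l = 1 / (z n - z l)" for l
  define AA FF GG where "AA = (\<Sum>j\<le>3. cA K j * z n ^ j)" and "FF = (\<Sum>j\<le>4. cF K j * z n ^ j)"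
    and "GG = (\<Sum>j\<le>3. cG K j * z n ^ j)"
  have SQ: "S = (\<Sum>l\<in>A. a l)" "Q = (\<Sum>l\<in>A. a l * a l)" "V = (\<Sum>l\<in>A. v l * a l)" "W = (\<Sum>l\<in>A. v l * a l * a l)"
    by (auto simp: S_def Q_def V_def W_def a_def power2_eq_square)
  have "(\<Sum>l\<in>A. (2 * v n * v l + 2 * AA - (v n + v l) * (cD K 0 + cD K 1 * z n)
           - cD K 2 * z n * (v n * z l + v l * z n)) / (z n - z l))
     = (\<Sum>l\<in>A. 2 * v n * (v l * a l) + 2 * AA * a l
          - (v n * a l + v l * a l) * (cD K 0 + cD K 1 * z n + cD K 2 * z n ^ 2) + cD K 2 * z n * v n)"
    unfolding a_def by (intro sum.cong refl pair_term ne)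
  also have "\<dots> = 2 * v n * V + 2 * AA * S
     - (v n * S + V) * (cD K 0 + cD K 1 * z n + cD K 2 * z n ^ 2) + (of_nat N - 1) * cD K 2 * z n * v n"
    by (simp add: sum.distrib sum_subtractf SQ sum_distrib_left[symmetric] sum_distrib_right[symmetric] cardA)
  finally have one: "(\<Sum>l\<in>A. (2 * v n * v l + 2 * AA - (v n + v l) * (cD K 0 + cD K 1 * z n)
           - cD K 2 * z n * (v n * z l + v l * z n)) / (z n - z l))
      = 2 * v n * V + 2 * AA * S
     - (v n * S + V) * (cD K 0 + cD K 1 * z n + cD K 2 * z n ^ 2) + (of_nat N - 1) * cD K 2 * z n * v n" .
  have sym: "(\<Sum>k\<in>A. \<Sum>l\<in>A - {k}. a l * ((v l + v k) / (z l - z k)))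
      = (\<Sum>k\<in>A. \<Sum>l\<in>A - {k}. v k * a k * a l)"
  proof -
    have "2 * (\<Sum>k\<in>A. \<Sum>l\<in>A - {k}. a l * ((v l + v k) / (z l - z k)))
      = (\<Sum>k\<in>A. \<Sum>l\<in>A - {k}. a l * ((v l + v k) / (z l - z k)))
        + (\<Sum>k\<in>A. \<Sum>l\<in>A - {k}. a k * ((v k + v l) / (z k - z l)))"
      using sum_offdiag_swap[OF fin, of "\<lambda>k l. a l * ((v l + v k) / (z l - z k))"] by simp
    also have "\<dots> = (\<Sum>k\<in>A. \<Sum>l\<in>A - {k}. v k * a k * a l + v l * a l * a k)"
      unfolding sum.distrib[symmetric]
    proof (intro sum.cong refl)
      fix k l assume "k \<in> A" "l \<in> A - {k}"
      then show "a l * ((v l + v k) / (z l - z k)) + a k * ((v k + v l) / (z k - z l))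
          = v k * a k * a l + v l * a l * a k"
        using symmetrized_term[of "z n - z l" "z n - z k" "v l" "v k"] ne2[of k l] ne by (simp add: a_def)
    qed
    also have "\<dots> = 2 * (\<Sum>k\<in>A. \<Sum>l\<in>A - {k}. v k * a k * a l)"
      using sum_offdiag_swap[OF fin, of "\<lambda>k l. v k * a k * a l"] by (simp add: sum.distrib)
    finally show ?thesis by simp
  qed
  have "(\<Sum>k\<in>A. \<Sum>l\<in>A - {k}. 3 * FF / ((z n - z l) * (z n - z k))
          - GG / (z n - z l) * ((v n + v k) / (z n - z k) + (v l + v k) / (z l - z k)))
     = (\<Sum>k\<in>A. \<Sum>l\<in>A - {k}. (3 * FF) * (a k * a l) - (GG * v n) * (a k * a l) - GG * (v k * a k * a l)
          - GG * (a l * ((v l + v k) / (z l - z k))))"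
    unfolding a_def by (intro sum.cong refl triple_term)
  also have "\<dots> = (3 * FF) * (\<Sum>k\<in>A. \<Sum>l\<in>A - {k}. a k * a l) - (GG * v n) * (\<Sum>k\<in>A. \<Sum>l\<in>A - {k}. a k * a l)
      - GG * (\<Sum>k\<in>A. \<Sum>l\<in>A - {k}. v k * a k * a l) - GG * (\<Sum>k\<in>A. \<Sum>l\<in>A - {k}. v k * a k * a l)"
    by (simp only: sum_subtractf sum_distrib_left[symmetric] sym)
  also have "\<dots> = 3 * FF * (S^2 - Q) - GG * (v n * (S^2 - Q) + 2 * (V * S - W))"
    unfolding sum_offdiag_prod[OF fin, of a a] sum_offdiag_prod[OF fin, of "\<lambda>k. v k * a k" a] SQ
    by (simp add: power2_eq_square algebra_simps)
  finally have two: "(\<Sum>k\<in>A. \<Sum>l\<in>A - {k}. 3 * FF / ((z n - z l) * (z n - z k))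
          - GG / (z n - z l) * ((v n + v k) / (z n - z k) + (v l + v k) / (z l - z k)))
      = 3 * FF * (S^2 - Q) - GG * (v n * (S^2 - Q) + 2 * (V * S - W))" .
  have "{1..N} - {n, k} = A - {k}" for k by (auto simp: A_def)
  then show ?thesis
    unfolding nbody_accel_def AA_def[symmetric] FF_def[symmetric] GG_def[symmetric] A_def[symmetric]
    by (simp only: one two) (simp add: algebra_simps)
qed

lemma sum_le_3: "(\<Sum>j\<le>3. f j) = f 0 + f 1 + f 2 + f (3::nat)"
  and sum_le_4: "(\<Sum>j\<le>4. f j) = f 0 + f 1 + f 2 + f 3 + f (4::nat)"
  by (simp_all add: numeral_eq_Suc)

text \<open>Splitting off the factor that vanishes at \<open>z n\<close> reduces every term of the
  operator to the values in \<open>node_poly_eval\<close> for the remaining zeros.\<close>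

lemma poly_evol_op_node:
  assumes n: "n \<in> {1..N}" and inj: "inj_on z {1..N}"
  shows "poly (evol_op N K (node_poly {1..N} z) (node_poly1 {1..N} z v) (node_poly2 {1..N} z v a)) (z n)
    = (nbody_accel N K z v n - a n) * (\<Prod>l\<in>{1..N} - {n}. z n - z l)"
proof -
  define A where "A = {1..N} - {n}"
  have A: "finite A" "n \<notin> A" "{1..N} = insert n A" using n by (auto simp: A_def)
  have ne: "z n \<noteq> z l" if "l \<in> A" for l
    using inj_onD[OF inj, of n l] n that unfolding A_def by auto
  note ev = node_poly_eval(2,3)[where x = "z n" and z = z, OF A(1) ne]
    node_poly_eval(4,5)[where x = "z n" and z = z and v = v, OF A(1) ne]
  have d: "pderiv ([:- z n, 1:] * q) = q + [:- z n, 1:] * pderiv q" for q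
    by (simp only: pderiv_mult) (simp add: pderiv_pCons)
  have e: "poly ([:- z n, 1:] * q) (z n) = 0" for q
    by simp
  define S Q V W R where "S = (\<Sum>l\<in>A. 1 / (z n - z l))" and "Q = (\<Sum>l\<in>A. 1 / (z n - z l)^2)"
    and "V = (\<Sum>l\<in>A. v l / (z n - z l))" and "W = (\<Sum>l\<in>A. v l / (z n - z l)^2)"
    and "R = poly (node_poly A z) (z n)"
  note abbr = S_def[symmetric] Q_def[symmetric] V_def[symmetric] W_def[symmetric] R_def[symmetric]
  show ?thesis
    unfolding nbody_accel_closed_form[OF assms] A_def[symmetric] poly_node_poly[OF A(1), symmetric]
    unfolding evol_op_def unfolding A(3) node_poly_insert[OF A(1,2)] node_poly1_insert[OF A(1,2)] node_poly2_insert[OF A(1,2)]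
    unfolding d pderiv_add pderiv_diff pderiv_smult poly_add poly_diff poly_smult e poly_mult[of "pCons _ _"] ev sum_le_3 sum_le_4 abbr
    by (simp add: ev[unfolded abbr] power2_eq_square power3_eq_cube power4_eq_xxxx algebra_simps)
qed

text \<open>The multiple of \<open>P\<close> that cancels the two top coefficients, of degrees \<open>N\<close> and \<open>N + 1\<close>.  That it
  involves neither the subleading coefficient of \<open>P\<close> nor its velocity is what makes the evolution
  linear.\<close>

definition evol_factor :: "nat \<Rightarrow> couplings \<Rightarrow> complex poly" where
  "evol_factor N K =
     [:of_nat N * (cB K 1 + (of_nat N - 1) * (cA K 2 + (of_nat N - 2) * cF K 3)),
       - of_nat N * (of_nat N - 1) * (cA K 3 + 2 * (of_nat N - 2) * cF K 4):]"

text \<open>A term x^j times an i-th x-derivative shifts coefficients by j - i. The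
  \<open>up\<close> parts collect the shift 1, \<open>down_terms\<close> the shifts -1 to -3. The
  vanishing constants of the first case are those behind the shift 1, those of the second case the
  ones behind negative shifts.\<close>

definition up_P :: "nat \<Rightarrow> couplings \<Rightarrow> nat \<Rightarrow> complex" where
  "up_P N K k = (of_nat k - 1) * (- (of_nat N - 1) * (2 * cA K 3 + 3 * (of_nat N - 2) * cF K 4)
      + (of_nat k - 2) * (cA K 3 + (of_nat k - 3) * cF K 4))
    + of_nat N * (of_nat N - 1) * (cA K 3 + 2 * (of_nat N - 2) * cF K 4)"

definition up_P1 :: "nat \<Rightarrow> couplings \<Rightarrow> nat \<Rightarrow> complex" where
  "up_P1 N K k = - (of_nat N - 1) * (cD K 2 + (of_nat N - 2) * cG K 3)
      + (of_nat k - 1) * (cD K 2 + (of_nat k - 2) * cG K 3)"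

definition diag_P :: "nat \<Rightarrow> couplings \<Rightarrow> nat \<Rightarrow> complex" where
  "diag_P N K k = of_nat k * (cB K 1 + (of_nat k - 1) * (cA K 2 + (of_nat k - 2) * cF K 3))
     - of_nat N * (cB K 1 + (of_nat N - 1) * (cA K 2 + (of_nat N - 2) * cF K 3))"

definition diag_P1 :: "nat \<Rightarrow> couplings \<Rightarrow> nat \<Rightarrow> complex" where
  "diag_P1 N K k = cE K + of_nat k * (cD K 1 + (of_nat k - 1) * cG K 2)"

definition down_terms :: "couplings \<Rightarrow> nat \<Rightarrow> (nat \<Rightarrow> complex) \<Rightarrow> (nat \<Rightarrow> complex) \<Rightarrow> complex" where
  "down_terms K k p p1 =
       (of_nat k + 1) * (cB K 0 + of_nat k * (cA K 1 + (of_nat k - 1) * cF K 2)) * p (k + 1)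
     + (of_nat k + 2) * (of_nat k + 1) * (cA K 0 + of_nat k * cF K 1) * p (k + 2)
     + (of_nat k + 3) * (of_nat k + 2) * (of_nat k + 1) * cF K 0 * p (k + 3)
     + (of_nat k + 1) * (cD K 0 + of_nat k * cG K 1) * p1 (k + 1)
     + (of_nat k + 2) * (of_nat k + 1) * cG K 0 * p1 (k + 2)"

lemma coeff_evol_op:
  "coeff (evol_op N K P P1 P2 - evol_factor N K * P) k =
     coeff P2 k + diag_P1 N K k * coeff P1 k + diag_P N K k * coeff P k
     + down_terms K k (coeff P) (coeff P1)
     + (if k = 0 then 0 else up_P N K k * coeff P (k - 1) + up_P1 N K k * coeff P1 (k - 1))"
proof -
  \<comment> \<open>The multiplying polynomials have degree at most 4, so from \<open>k = 4\<close>
    on no shifted index is cut off at 0.\<close>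
  consider "k = 0" | "k = 1" | "k = 2" | "k = 3" | j where "k = Suc (Suc (Suc (Suc j)))"
    by (metis One_nat_def Suc_1 numeral_3_eq_3 not0_implies_Suc)
  then show ?thesis
    by cases (simp_all add: evol_op_def evol_factor_def up_P_def up_P1_def diag_P_def diag_P1_def
      down_terms_def coeff_pderiv coeff_pCons algebra_simps eval_nat_numeral)
qed

text \<open>Here the N-dependent forces of the equations of motion pay off: together with
  \<open>evol_factor\<close> they make \<open>up_P\<close> vanish at N and at N + 1 and
  \<open>up_P1\<close> at N, while \<open>diag_P\<close> vanishes at N by its subtracted
  term.\<close>

lemma coeff_evol_op_high:
  assumes P: "degree P = N" "coeff P N = 1" and P1: "\<And>k. k \<ge> N \<Longrightarrow> coeff P1 k = 0"
    and P2: "\<And>k. k \<ge> N \<Longrightarrow> coeff P2 k = 0" and k: "k \<ge> N" and N: "N \<ge> 1"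
  shows "coeff (evol_op N K P P1 P2 - evol_factor N K * P) k = 0"
proof -
  have P0: "coeff P j = 0" if "j > N" for j
    using P(1) that by (intro coeff_eq_0) auto
  consider "k = N" | "k = N + 1" | "k > N + 1" using k by linarith
  then show ?thesis
  proof cases
    case 1
    obtain M where M: "N = Suc M" using N by (cases N) auto
    show ?thesis
      using 1 N P(2) by (subst coeff_evol_op) (simp add: P0 P1 P2 down_terms_def diag_P_def up_P_def up_P1_def M algebra_simps)
  next
    case 2
    show ?thesis
      using 2 N P(2) by (subst coeff_evol_op) (simp add: P0 P1 P2 down_terms_def diag_P_def up_P_def up_P1_def algebra_simps)
  next
    case 3
    then have "k - 1 > N" "k > N" "k - 1 \<ge> N" using N by auto
    then show ?thesis
      using 3 N by (subst coeff_evol_op) (simp add: P0 P1 P2 down_terms_def)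
  qed
qed

section \<open>Time evolution of the coefficients of a polynomial with moving zeros\<close>

lemma config_poly_node_poly: "config_poly N z t = node_poly {1..N} (\<lambda>n. z n t)"
  by (simp add: config_poly_def node_poly_def)

lemma node_poly_deriv:
  assumes "finite A" "\<And>n. n \<in> A \<Longrightarrow> (z n has_vector_derivative v n t) (at t)"
  shows "((\<lambda>s. coeff (node_poly A (\<lambda>n. z n s)) k) has_vector_derivative
    coeff (node_poly1 A (\<lambda>n. z n t) (\<lambda>n. v n t)) k) (at t)"
  using assms
proof (induction A arbitrary: k rule: finite_induct)
  case empty
  then show ?case by (simp add: node_poly_def node_poly1_def)
next
  case (insert n A)
  have [derivative_intros]: "((\<lambda>s. z n s) has_vector_derivative v n t) (at t)"
    using insert.prems by simp
  have IH [derivative_intros]: "((\<lambda>s. coeff (node_poly A (\<lambda>n. z n s)) k) has_vector_derivative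
      coeff (node_poly1 A (\<lambda>n. z n t) (\<lambda>n. v n t)) k) (at t)" for k
    using insert.IH insert.prems by simp
  show ?case
  proof (cases k)
    case 0
    show ?thesis
      unfolding node_poly_insert[OF insert.hyps] node_poly1_insert[OF insert.hyps] 0
      by (auto intro!: derivative_eq_intros simp: mult_pCons_left)
  next
    case (Suc j)
    show ?thesis
      unfolding node_poly_insert[OF insert.hyps] node_poly1_insert[OF insert.hyps] Suc
      by (auto intro!: derivative_eq_intros simp: mult_pCons_left)
  qed
qed

lemma node_poly1_deriv:
  assumes "finite A" "\<And>n. n \<in> A \<Longrightarrow> (z n has_vector_derivative v n t) (at t)"
    and "\<And>n. n \<in> A \<Longrightarrow> (v n has_vector_derivative a n) (at t)"
  shows "((\<lambda>s. coeff (node_poly1 A (\<lambda>n. z n s) (\<lambda>n. v n s)) k) has_vector_derivative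
    coeff (node_poly2 A (\<lambda>n. z n t) (\<lambda>n. v n t) a) k) (at t)"
proof -
  have [derivative_intros]: "((\<lambda>s. coeff (node_poly (A - {n}) (\<lambda>n. z n s)) k) has_vector_derivative
    coeff (node_poly1 (A - {n}) (\<lambda>n. z n t) (\<lambda>n. v n t)) k) (at t)" for n k
    using assms by (intro node_poly_deriv) auto
  show ?thesis
    unfolding node_poly1_def[of A] node_poly2_def coeff_minus coeff_sum coeff_smult coeff_add
    by (rule has_vector_derivative_minus, rule has_vector_derivative_sum, drule assms(3))
      (auto intro!: derivative_eq_intros)
qed

lemma degree_node_poly: "finite A \<Longrightarrow> degree (node_poly A z) = card A"
  and lead_coeff_node_poly: "lead_coeff (node_poly A z) = 1"
  unfolding node_poly_def by (subst degree_prod_sum_eq) (auto simp: lead_coeff_prod)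

lemma coeff_node_poly1_high:
  assumes "finite A" "k \<ge> card A"
  shows "coeff (node_poly1 A z v) k = 0"
proof -
  have "coeff (node_poly (A - {n}) z) k = 0" if "n \<in> A" for n
    using assms that card_Diff1_less[OF assms(1) that] by (intro coeff_eq_0) (simp add: degree_node_poly)
  then show ?thesis by (simp add: node_poly1_def coeff_sum)
qed

lemma coeff_node_poly2_high:
  assumes "finite A" "k \<ge> card A"
  shows "coeff (node_poly2 A z v a) k = 0"
proof -
  have "coeff (node_poly (A - {n}) z) k = 0" "coeff (node_poly1 (A - {n}) z v) k = 0" if "n \<in> A" for n
    using assms that card_Diff1_less[OF assms(1) that]
    by (auto intro!: coeff_eq_0[of "node_poly _ _"] coeff_node_poly1_high simp: degree_node_poly)
  then show ?thesis by (simp add: node_poly2_def coeff_sum)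
qed

text \<open>Stated for arbitrary sequences, so that it also makes sense for solutions of the linear
  system whose zeros have not been labelled yet.\<close>

definition lin_eq :: "nat \<Rightarrow> couplings \<Rightarrow> (nat \<Rightarrow> complex) \<Rightarrow> (nat \<Rightarrow> complex) \<Rightarrow> (nat \<Rightarrow> complex) \<Rightarrow> nat \<Rightarrow> bool" where
  "lin_eq N K p p1 p2 k \<longleftrightarrow>
     p2 k + diag_P1 N K k * p1 k + diag_P N K k * p k + down_terms K k p p1
     + (if k = 0 then 0 else up_P N K k * p (k - 1) + up_P1 N K k * p1 (k - 1)) = 0"

text \<open>The remainder \<open>Q\<close> has degree below N, and its value at \<open>z n\<close>
  is a nonzero multiple of the defect of the n-th equation of motion; N distinct zeros force
  \<open>Q = 0\<close>. Sufficiency reads the equivalence forwards, necessity backwards.\<close>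

lemma nbody_iff_lin_eq:
  assumes N: "N \<ge> 1" and inj: "inj_on z {1..N}"
  shows "(\<forall>n\<in>{1..N}. a n = nbody_accel N K z v n) \<longleftrightarrow>
    (\<forall>k<N. lin_eq N K (coeff (node_poly {1..N} z)) (coeff (node_poly1 {1..N} z v)) (coeff (node_poly2 {1..N} z v a)) k)"
proof -
  define P P1 P2 where "P = node_poly {1..N} z" and "P1 = node_poly1 {1..N} z v" and "P2 = node_poly2 {1..N} z v a"
  define Q where "Q = evol_op N K P P1 P2 - evol_factor N K * P"
  have lin: "lin_eq N K (coeff P) (coeff P1) (coeff P2) k \<longleftrightarrow> coeff Q k = 0" for k
    unfolding lin_eq_def Q_def coeff_evol_op ..
  have high: "coeff Q k = 0" if "k \<ge> N" for k
    unfolding Q_def using N that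
    by (intro coeff_evol_op_high)
      (use lead_coeff_node_poly[of "{1..N}" z] in
        \<open>auto simp: P_def P1_def P2_def degree_node_poly coeff_node_poly1_high coeff_node_poly2_high\<close>)
  have Q0: "(\<forall>k<N. coeff Q k = 0) \<longleftrightarrow> Q = 0"
    by (metis high poly_eq_iff coeff_0 not_le)
  have ev: "poly Q (z n) = (nbody_accel N K z v n - a n) * (\<Prod>l\<in>{1..N} - {n}. z n - z l)" if "n \<in> {1..N}" for n
  proof -
    have "poly P (z n) = 0" using that by (auto simp: P_def poly_node_poly)
    then show ?thesis
      unfolding Q_def poly_diff poly_mult P1_def P2_def unfolding P_def poly_evol_op_node[OF that inj] by simp
  qed
  have nz: "(\<Prod>l\<in>{1..N} - {n}. z n - z l) \<noteq> 0" if "n \<in> {1..N}" for n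
    using inj_onD[OF inj, of n] that by force
  have "(\<forall>n\<in>{1..N}. a n = nbody_accel N K z v n) \<longleftrightarrow> (\<forall>n\<in>{1..N}. poly Q (z n) = 0)"
  proof (intro ball_cong refl)
    fix n assume n: "n \<in> {1..N}"
    show "a n = nbody_accel N K z v n \<longleftrightarrow> poly Q (z n) = 0"
      unfolding ev[OF n] using nz[OF n] by auto
  qed
  also have "\<dots> \<longleftrightarrow> Q = 0"
  proof
    assume *: "\<forall>n\<in>{1..N}. poly Q (z n) = 0"
    show "Q = 0"
    proof (rule ccontr)
      assume "Q \<noteq> 0"
      then have "degree Q < N" using high by (metis leading_coeff_0_iff not_le)
      moreover have "card (z ` {1..N}) \<le> card {x. poly Q x = 0}"
        using * \<open>Q \<noteq> 0\<close> by (intro card_mono poly_roots_finite) auto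
      ultimately show False
        using card_poly_roots_bound[OF \<open>Q \<noteq> 0\<close>] card_image[OF inj] by simp
    qed
  qed auto
  finally show ?thesis
    unfolding P_def[symmetric] P1_def[symmetric] P2_def[symmetric] lin Q0 .
qed

section \<open>The triangular form of the coefficient system\<close>

text \<open>The unknowns \<open>1, \<dots>, N\<close> are numbered in the order in which they can be solved for: downwards from
  the coefficient of \<open>z ^ (N - 1)\<close> in the first case, upwards from the constant coefficient in the
  second.  Slot \<open>0\<close> holds the constant leading coefficient in the first case, where it acts as a forcing
  term, and is \<open>0\<close> in the second.  If both cases apply, the second is used, since it requires nothing
  about the eigenvalue \<open>0\<close>.\<close>

definition tri_u :: "nat \<Rightarrow> couplings \<Rightarrow> (nat \<Rightarrow> complex) \<Rightarrow> nat \<Rightarrow> complex" where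
  "tri_u N K p i = (if case2 K then (if i = 0 then 0 else p (i - 1)) else p (N - i))"

text \<open>Eigenvalue m belongs to the coefficient of z^(N - m). In the second case unknown
  \<open>i\<close> is the coefficient of z^(i - 1), hence the reversal.\<close>

definition tri_mode :: "nat \<Rightarrow> couplings \<Rightarrow> nat \<Rightarrow> nat" where
  "tri_mode N K i = (if case2 K then N + 1 - i else i)"

definition tri_A :: "nat \<Rightarrow> couplings \<Rightarrow> nat \<Rightarrow> nat \<Rightarrow> complex" where
  "tri_A N K i j =
     (if case2 K then if j + 1 = i then - up_P N K (i - 1) else 0
      else let k = N - i in
       if j + 1 = i then - (of_nat k + 1) * (cB K 0 + of_nat k * (cA K 1 + (of_nat k - 1) * cF K 2))
       else if j + 2 = i then - (of_nat k + 2) * (of_nat k + 1) * (cA K 0 + of_nat k * cF K 1)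
       else if j + 3 = i then - (of_nat k + 3) * (of_nat k + 2) * (of_nat k + 1) * cF K 0 else 0)"

definition tri_B :: "nat \<Rightarrow> couplings \<Rightarrow> nat \<Rightarrow> nat \<Rightarrow> complex" where
  "tri_B N K i j =
     (if case2 K then if j + 1 = i then - up_P1 N K (i - 1) else 0
      else let k = N - i in
       if j + 1 = i then - (of_nat k + 1) * (cD K 0 + of_nat k * cG K 1)
       else if j + 2 = i then - (of_nat k + 2) * (of_nat k + 1) * cG K 0 else 0)"

text \<open>The left side is (d/dt - l1 i)(d/dt - l2 i) applied to unknown \<open>i\<close>, so each
  unknown can be found from two scalar first-order equations.\<close>

definition tri_eq ::
  "(nat \<Rightarrow> complex) \<Rightarrow> (nat \<Rightarrow> complex) \<Rightarrow> (nat \<Rightarrow> nat \<Rightarrow> complex) \<Rightarrow> (nat \<Rightarrow> nat \<Rightarrow> complex)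
    \<Rightarrow> (nat \<Rightarrow> complex) \<Rightarrow> (nat \<Rightarrow> complex) \<Rightarrow> (nat \<Rightarrow> complex) \<Rightarrow> nat \<Rightarrow> bool" where
  "tri_eq l1 l2 A B u u1 u2 i \<longleftrightarrow>
     u2 i - (l1 i + l2 i) * u1 i + l1 i * l2 i * u i = (\<Sum>j<i. A i j * u j + B i j * u1 j)"

lemma eigval_sum: "eigval N K 1 m + eigval N K (-1) m = - damping N K m"
  by (simp add: eigval_def field_simps)

lemma eigval_prod: "eigval N K 1 m * eigval N K (-1) m = (damping N K m ^ 2 - Delta_sq N K m) / 4"
proof -
  have "csqrt (Delta_sq N K m) * csqrt (Delta_sq N K m) = Delta_sq N K m"
    by (metis power2_csqrt power2_eq_square)
  then show ?thesis by (simp add: eigval_def field_simps power2_eq_square)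
qed

lemma diag_P1_eq_damping: "m \<le> N \<Longrightarrow> diag_P1 N K (N - m) = damping N K m"
  by (simp add: diag_P1_def damping_def of_nat_diff algebra_simps)

lemma diag_P_eq: "m \<le> N \<Longrightarrow> diag_P N K (N - m) = (damping N K m ^ 2 - Delta_sq N K m) / 4"
  by (simp add: diag_P_def Delta_sq_def of_nat_diff power2_eq_square algebra_simps)

text \<open>Vieta's formulas for the characteristic equation of the coefficient of degree N -
  m.\<close>

lemma diag_eigval:
  assumes "m \<le> N"
  shows "diag_P1 N K (N - m) = - (eigval N K 1 m + eigval N K (-1) m)"
    and "diag_P N K (N - m) = eigval N K 1 m * eigval N K (-1) m"
  using assms by (simp_all add: eigval_sum eigval_prod diag_P1_eq_damping diag_P_eq)

text \<open>An operator of third order in x reaches at most three coefficients higher, hence three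
  unknowns back.\<close>

lemma sum_lessThan_band:
  fixes f :: "nat \<Rightarrow> complex"
  assumes "\<And>j. j < i \<Longrightarrow> j + 3 < i \<Longrightarrow> f j = 0" "i \<ge> 1"
  shows "(\<Sum>j<i. f j) = f (i - 1) + (if i \<ge> 2 then f (i - 2) else 0) + (if i \<ge> 3 then f (i - 3) else 0)"
proof -
  consider "i = 1" | "i = 2" | j where "i = Suc (Suc (Suc j))"
    using assms(2) by (metis One_nat_def Suc_1 not0_implies_Suc not_less_eq_eq zero_le)
  then show ?thesis
  proof cases
    case 3
    then have "(\<Sum>k<j. f k) = 0" using assms(1) by (intro sum.neutral) auto
    then show ?thesis using 3 by (simp add: eval_nat_numeral)
  qed (simp_all add: eval_nat_numeral)
qed

lemma tri_form_iff:
  fixes p :: complex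
  shows "p2 + - (a + b) * p1 + a * b * p + d + r = 0 \<longleftrightarrow> p2 - (a + b) * p1 + a * b * p = - (d + r)"
  by (subst (2) eq_iff_diff_eq_0) (simp add: algebra_simps)

lemma lin_eq_iff_tri_eq:
  assumes K: "case1 K \<or> case2 K" and i: "i \<in> {1..N}"
    and p: "\<And>j. j > N \<Longrightarrow> p j = 0" "\<And>j. j \<ge> N \<Longrightarrow> p1 j = 0"
  defines "l \<equiv> \<lambda>s i. eigval N K s (tri_mode N K i)"
  shows "lin_eq N K p p1 p2 (N - tri_mode N K i) \<longleftrightarrow>
    tri_eq (l 1) (l (-1)) (tri_A N K) (tri_B N K) (tri_u N K p) (tri_u N K p1) (tri_u N K p2) i"
proof -
  define m where "m = tri_mode N K i"
  have m: "m \<le> N" using i by (auto simp: m_def tri_mode_def)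
  show ?thesis
  proof (cases "case2 K")
    case True
    have km: "N - m = i - 1" using True i by (auto simp: m_def tri_mode_def)
    have "(\<Sum>j<i. tri_A N K i j * tri_u N K p j + tri_B N K i j * tri_u N K p1 j)
      = (\<Sum>j<i. if j = i - 1 then - up_P N K (i - 1) * tri_u N K p j - up_P1 N K (i - 1) * tri_u N K p1 j else 0)"
      using True i by (intro sum.cong) (auto simp: tri_A_def tri_B_def)
    \<comment> \<open>For \<open>i = 1\<close> the neighbour is slot 0, which is 0 by convention and
      so stands for the missing coefficient below degree 0.\<close>
    also have "\<dots> = - (if i = 1 then 0 else up_P N K (i - 1) * p (i - 1 - 1) + up_P1 N K (i - 1) * p1 (i - 1 - 1))"
      using True i by (auto simp: tri_u_def)
    finally have rhs: "(\<Sum>j<i. tri_A N K i j * tri_u N K p j + tri_B N K i j * tri_u N K p1 j) = \<dots>" .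
    have first: "i - 1 = 0 \<longleftrightarrow> i = 1" using i by auto
    have dn: "down_terms K (i - 1) p p1 = 0"
      using True by (simp add: down_terms_def case2_def)
    have u: "tri_u N K q i = q (i - 1)" for q using True i by (simp add: tri_u_def)
    show ?thesis
      unfolding tri_eq_def rhs l_def m_def[symmetric] lin_eq_def km diag_eigval[OF m, of K, unfolded km] dn u 
        tri_form_iff[where d = 0, unfolded add_0] first ..
  next
    case False
    with K have c1: "case1 K" by simp
    have mi: "m = i" using False by (simp add: m_def tri_mode_def)
    have up: "up_P N K k = 0" "up_P1 N K k = 0" for k
      using c1 by (auto simp: up_P_def up_P1_def case1_def)
    have u: "tri_u N K q j = q (N - j)" for q j using False by (simp add: tri_u_def)
    \<comment> \<open>For \<open>i < 3\<close> the unknowns that would precede slot 0 are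
      coefficients above degree N, which vanish by assumption.\<close>
    have rhs: "(\<Sum>j<i. tri_A N K i j * tri_u N K p j + tri_B N K i j * tri_u N K p1 j) = - down_terms K (N - i) p p1"
    proof (subst sum_lessThan_band)
      obtain k where k: "N = k + i" using i by (metis add.commute atLeastAtMost_iff le_Suc_ex)
      consider "i = 1" | "i = 2" | j where "i = Suc (Suc (Suc j))"
        using i by (metis One_nat_def Suc_1 atLeastAtMost_iff not0_implies_Suc not_one_le_zero)
      then show "tri_A N K i (i - 1) * tri_u N K p (i - 1) + tri_B N K i (i - 1) * tri_u N K p1 (i - 1) +
        (if 2 \<le> i then tri_A N K i (i - 2) * tri_u N K p (i - 2) + tri_B N K i (i - 2) * tri_u N K p1 (i - 2) else 0) +
        (if 3 \<le> i then tri_A N K i (i - 3) * tri_u N K p (i - 3) + tri_B N K i (i - 3) * tri_u N K p1 (i - 3) else 0)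
         = - down_terms K (N - i) p p1"
        unfolding tri_A_def tri_B_def Let_def u down_terms_def using False
        by cases (simp_all add: k p algebra_simps eval_nat_numeral)
    qed (use i False in \<open>auto simp: tri_A_def tri_B_def Let_def\<close>)
    show ?thesis
      unfolding tri_eq_def rhs unfolding l_def m_def[symmetric] lin_eq_def up u diag_eigval[OF m, of K]
      unfolding mi using tri_form_iff[where r = 0] by simp
  qed
qed

lemma lin_eq_all_iff_tri_eq_all:
  assumes K: "case1 K \<or> case2 K"
    and p: "\<And>j. j > N \<Longrightarrow> p j = 0" "\<And>j. j \<ge> N \<Longrightarrow> p1 j = 0"
  defines "l \<equiv> \<lambda>s i. eigval N K s (tri_mode N K i)"
  shows "(\<forall>k<N. lin_eq N K p p1 p2 k) \<longleftrightarrow>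
    (\<forall>i\<in>{1..N}. tri_eq (l 1) (l (-1)) (tri_A N K) (tri_B N K) (tri_u N K p) (tri_u N K p1) (tri_u N K p2) i)"
proof -
  have "{..<N} = (\<lambda>i. N - tri_mode N K i) ` {1..N}"
  proof (intro equalityI subsetI)
    fix k assume "k \<in> {..<N}"
    then show "k \<in> (\<lambda>i. N - tri_mode N K i) ` {1..N}"
      by (intro image_eqI[of _ _ "if case2 K then k + 1 else N - k"]) (auto simp: tri_mode_def)
  qed (auto simp: tri_mode_def)
  then have "(\<forall>k<N. lin_eq N K p p1 p2 k) \<longleftrightarrow> (\<forall>i\<in>{1..N}. lin_eq N K p p1 p2 (N - tri_mode N K i))"
    by (metis (no_types, lifting) image_iff lessThan_iff)
  then show ?thesis
    using lin_eq_iff_tri_eq[OF K _ p] unfolding l_def by simp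
qed

section \<open>Sufficiency: solutions as sums of exponentials\<close>

definition exp_sums :: "complex set \<Rightarrow> real set \<Rightarrow> (real \<Rightarrow> complex) set" where
  "exp_sums M S = {f. \<exists>c. \<forall>t\<in>S. f t = (\<Sum>\<mu>\<in>M. c \<mu> * exp (\<mu> * of_real t))}"

lemma exp_sums_cong: "(\<And>t. t \<in> S \<Longrightarrow> f t = g t) \<Longrightarrow> f \<in> exp_sums M S \<longleftrightarrow> g \<in> exp_sums M S"
  by (simp add: exp_sums_def)

lemma exp_sums_mono:
  assumes "M \<subseteq> M'" "finite M'"
  shows "exp_sums M S \<subseteq> exp_sums M' S"
proof
  fix f assume "f \<in> exp_sums M S"
  then obtain c where c: "\<And>t. t \<in> S \<Longrightarrow> f t = (\<Sum>\<mu>\<in>M. c \<mu> * exp (\<mu> * of_real t))"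
    by (auto simp: exp_sums_def)
  have "f t = (\<Sum>\<mu>\<in>M'. (if \<mu> \<in> M then c \<mu> else 0) * exp (\<mu> * of_real t))" if "t \<in> S" for t
    unfolding c[OF that] using assms by (intro sum.mono_neutral_cong_left) auto
  then show "f \<in> exp_sums M' S"
    unfolding exp_sums_def by (intro CollectI exI[of _ "\<lambda>\<mu>. if \<mu> \<in> M then c \<mu> else 0"]) auto
qed

lemma exp_sums_0: "(\<lambda>t. 0) \<in> exp_sums M S"
  unfolding exp_sums_def by (intro CollectI exI[of _ "\<lambda>_. 0"]) auto

lemma exp_sums_add:
  assumes "f \<in> exp_sums M S" "g \<in> exp_sums M S"
  shows "(\<lambda>t. f t + g t) \<in> exp_sums M S"
proof -
  obtain c d where "\<And>t. t \<in> S \<Longrightarrow> f t = (\<Sum>\<mu>\<in>M. c \<mu> * exp (\<mu> * of_real t))"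
    "\<And>t. t \<in> S \<Longrightarrow> g t = (\<Sum>\<mu>\<in>M. d \<mu> * exp (\<mu> * of_real t))"
    using assms by (auto simp: exp_sums_def)
  then show ?thesis
    unfolding exp_sums_def
    by (intro CollectI exI[of _ "\<lambda>\<mu>. c \<mu> + d \<mu>"]) (auto simp: sum.distrib ring_distribs)
qed

lemma exp_sums_cmult:
  assumes "f \<in> exp_sums M S"
  shows "(\<lambda>t. a * f t) \<in> exp_sums M S"
proof -
  obtain c where "\<And>t. t \<in> S \<Longrightarrow> f t = (\<Sum>\<mu>\<in>M. c \<mu> * exp (\<mu> * of_real t))"
    using assms by (auto simp: exp_sums_def)
  then show ?thesis
    unfolding exp_sums_def
    by (intro CollectI exI[of _ "\<lambda>\<mu>. a * c \<mu>"]) (auto simp: sum_distrib_left mult.assoc)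
qed

lemma exp_sums_sum:
  assumes "\<And>j. j \<in> J \<Longrightarrow> f j \<in> exp_sums M S"
  shows "(\<lambda>t. \<Sum>j\<in>J. f j t) \<in> exp_sums M S"
  using assms by (induction J rule: infinite_finite_induct) (auto simp: exp_sums_0 exp_sums_add)

lemma exp_sums_periodic:
  assumes "f \<in> exp_sums M S" "\<And>\<mu>. \<mu> \<in> M \<Longrightarrow> exp (\<mu> * of_real T) = 1" "t \<in> S" "t + T \<in> S"
  shows "f (t + T) = f t"
proof -
  obtain c where c: "\<And>t. t \<in> S \<Longrightarrow> f t = (\<Sum>\<mu>\<in>M. c \<mu> * exp (\<mu> * of_real t))"
    using assms(1) by (auto simp: exp_sums_def)
  show ?thesis
    unfolding c[OF assms(3)] c[OF assms(4)]
    by (intro sum.cong refl) (simp add: ring_distribs exp_add assms(2))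
qed

lemma has_vector_derivative_cexp [derivative_intros]:
  "((\<lambda>t. exp (\<mu> * complex_of_real t)) has_vector_derivative \<mu> * exp (\<mu> * of_real t)) (at t)"
proof -
  have "((\<lambda>z. exp (\<mu> * z)) has_field_derivative \<mu> * exp (\<mu> * of_real t)) (at (of_real t))"
    by (auto intro!: derivative_eq_intros)
  then show ?thesis by (rule has_vector_derivative_real_field)
qed

text \<open>Variation of constants. As \<nu> is not among the exponents of the right side, no term t
  * exp appears and division by \<mu> - \<nu> is possible; \<nu> enters through the constant of
  integration.\<close>

lemma exp_sums_first_order:
  assumes S: "open S" "convex S" and M: "finite M" "\<nu> \<notin> M"
    and f: "\<And>t. t \<in> S \<Longrightarrow> (f has_vector_derivative f' t) (at t)"
    and g: "(\<lambda>t. f' t - \<nu> * f t) \<in> exp_sums M S"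
  shows "f \<in> exp_sums (insert \<nu> M) S"
proof -
  obtain c where c: "\<And>t. t \<in> S \<Longrightarrow> f' t - \<nu> * f t = (\<Sum>\<mu>\<in>M. c \<mu> * exp (\<mu> * of_real t))"
    using g by (auto simp: exp_sums_def)
  \<comment> \<open>The integrating factor times \<open>f\<close>, minus a primitive of the
    transformed right side; this is constant on \<open>S\<close>.\<close>
  define h where "h t = f t * exp (- \<nu> * of_real t) - (\<Sum>\<mu>\<in>M. c \<mu> / (\<mu> - \<nu>) * exp ((\<mu> - \<nu>) * of_real t))" for t
  have "(h has_vector_derivative 0) (at t within S)" if t: "t \<in> S" for t
  proof -
    have "(\<Sum>\<mu>\<in>M. c \<mu> / (\<mu> - \<nu>) * ((\<mu> - \<nu>) * exp ((\<mu> - \<nu>) * of_real t)))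
      = (\<Sum>\<mu>\<in>M. c \<mu> * exp (\<mu> * of_real t)) * exp (- \<nu> * of_real t)"
      unfolding sum_distrib_right
    proof (intro sum.cong refl)
      fix \<mu> assume "\<mu> \<in> M"
      then have "\<mu> - \<nu> \<noteq> 0" using M(2) by auto
      moreover have "exp ((\<mu> - \<nu>) * of_real t) = exp (\<mu> * of_real t) * exp (- \<nu> * of_real t)"
        by (simp add: exp_add[symmetric] algebra_simps)
      ultimately show "c \<mu> / (\<mu> - \<nu>) * ((\<mu> - \<nu>) * exp ((\<mu> - \<nu>) * of_real t))
          = c \<mu> * exp (\<mu> * of_real t) * exp (- \<nu> * of_real t)"
        by simp
    qed
    also have "\<dots> = (f' t - \<nu> * f t) * exp (- \<nu> * of_real t)"
      using c[OF t] by simp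
    finally have e: "(\<Sum>\<mu>\<in>M. c \<mu> / (\<mu> - \<nu>) * ((\<mu> - \<nu>) * exp ((\<mu> - \<nu>) * of_real t)))
       = (f' t - \<nu> * f t) * exp (- \<nu> * of_real t)" .
    have "(h has_vector_derivative (f t * (- \<nu> * exp (- \<nu> * of_real t)) + f' t * exp (- \<nu> * of_real t))
        - (\<Sum>\<mu>\<in>M. c \<mu> / (\<mu> - \<nu>) * ((\<mu> - \<nu>) * exp ((\<mu> - \<nu>) * of_real t)))) (at t)"
      unfolding h_def
      by (intro has_vector_derivative_diff has_vector_derivative_mult has_vector_derivative_sum
          has_vector_derivative_mult_right has_vector_derivative_cexp f[OF t])
    also have "(f t * (- \<nu> * exp (- \<nu> * of_real t)) + f' t * exp (- \<nu> * of_real t))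
        - (\<Sum>\<mu>\<in>M. c \<mu> / (\<mu> - \<nu>) * ((\<mu> - \<nu>) * exp ((\<mu> - \<nu>) * of_real t))) = 0"
      unfolding e by (simp add: algebra_simps)
    finally show ?thesis by (rule has_vector_derivative_at_within)
  qed
  from has_vector_derivative_zero_constant[OF S(2) this]
  obtain d where d: "\<And>t. t \<in> S \<Longrightarrow> h t = d" by blast
  define b where "b \<mu> = (if \<mu> = \<nu> then d else c \<mu> / (\<mu> - \<nu>))" for \<mu>
  have "f t = (\<Sum>\<mu>\<in>insert \<nu> M. b \<mu> * exp (\<mu> * of_real t))" if t: "t \<in> S" for t
  proof -
    have "f t = (d + (\<Sum>\<mu>\<in>M. c \<mu> / (\<mu> - \<nu>) * exp ((\<mu> - \<nu>) * of_real t))) * exp (\<nu> * of_real t)"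
      using d[OF t] by (simp add: h_def exp_minus field_simps)
    also have "\<dots> = d * exp (\<nu> * of_real t) + (\<Sum>\<mu>\<in>M. c \<mu> / (\<mu> - \<nu>) * exp (\<mu> * of_real t))"
      unfolding ring_distribs(2) sum_distrib_right by (simp add: mult.assoc exp_add[symmetric] ring_distribs)
    also have "\<dots> = (\<Sum>\<mu>\<in>insert \<nu> M. b \<mu> * exp (\<mu> * of_real t))"
      using M by (auto simp: b_def intro!: sum.cong)
    finally show ?thesis .
  qed
  then show ?thesis by (auto simp: exp_sums_def)
qed

text \<open>\<kappa> is the constant value of slot 0; if nonzero, it forces the other unknowns with
  exponent 0.\<close>

definition exponents :: "(nat \<Rightarrow> complex) \<Rightarrow> (nat \<Rightarrow> complex) \<Rightarrow> complex \<Rightarrow> nat \<Rightarrow> complex set" where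
  "exponents l1 l2 \<kappa> n = (if \<kappa> = 0 then {} else {0}) \<union> l1 ` {1..n} \<union> l2 ` {1..n}"

text \<open>Inverting the two factors of the left side of \<open>tri_eq\<close> one after the other
  appends first \<open>l1 i\<close>, then \<open>l2 i\<close> to the exponents of the earlier
  unknowns; the distinctness assumptions make each exponent new when it is appended.\<close>

lemma tri_eq_exp_sums:
  assumes S: "open S" "convex S"
    and inj: "inj_on l1 {1..N}" "inj_on l2 {1..N}" "l1 ` {1..N} \<inter> l2 ` {1..N} = {}"
    and nz: "\<kappa> \<noteq> 0 \<Longrightarrow> 0 \<notin> l1 ` {1..N} \<union> l2 ` {1..N}"
    and u0: "\<And>t. t \<in> S \<Longrightarrow> u 0 t = \<kappa>" "\<And>t. t \<in> S \<Longrightarrow> u1 0 t = 0"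
    and u: "\<And>i t. i \<in> {1..N} \<Longrightarrow> t \<in> S \<Longrightarrow> (u i has_vector_derivative u1 i t) (at t)"
    and u1: "\<And>i t. i \<in> {1..N} \<Longrightarrow> t \<in> S \<Longrightarrow> (u1 i has_vector_derivative u2 i t) (at t)"
    and eq: "\<And>i t. i \<in> {1..N} \<Longrightarrow> t \<in> S \<Longrightarrow> tri_eq l1 l2 A B (\<lambda>i. u i t) (\<lambda>i. u1 i t) (\<lambda>i. u2 i t) i"
    and i: "i \<le> N"
  shows "u i \<in> exp_sums (exponents l1 l2 \<kappa> i) S \<and> u1 i \<in> exp_sums (exponents l1 l2 \<kappa> i) S"
  using i
proof (induction i rule: less_induct)
  case (less i)
  have fin: "finite (exponents l1 l2 \<kappa> n)" for n by (simp add: exponents_def)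
  show ?case
  proof (cases "i = 0")
    case True
    have "u1 0 \<in> exp_sums M S" for M
      using exp_sums_0 exp_sums_cong[of S "u1 0" "\<lambda>t. 0"] u0(2) by simp
    moreover have "u 0 \<in> exp_sums (exponents l1 l2 \<kappa> 0) S"
      using u0(1) by (auto simp: exp_sums_def exponents_def)
    ultimately show ?thesis using True by simp
  next
    case False
    then have i: "i \<in> {1..N}" using less.prems by auto
    define M where "M = exponents l1 l2 \<kappa> (i - 1)"
    have IH: "u j \<in> exp_sums M S" "u1 j \<in> exp_sums M S" if "j < i" for j
    proof -
      have "exponents l1 l2 \<kappa> j \<subseteq> M"
        using that unfolding M_def exponents_def by (intro Un_mono image_mono order_refl) auto
      then have "exp_sums (exponents l1 l2 \<kappa> j) S \<subseteq> exp_sums M S"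
        unfolding M_def by (intro exp_sums_mono fin)
      then show "u j \<in> exp_sums M S" "u1 j \<in> exp_sums M S"
        using less.IH[OF that] that less.prems by auto
    qed
    have M': "exponents l1 l2 \<kappa> i = insert (l2 i) (insert (l1 i) M)"
    proof -
      have "{1..i} = insert i {1..i - 1}" using False by auto
      then show ?thesis unfolding exponents_def M_def by auto
    qed
    have l1: "l1 i \<notin> M" and l2: "l2 i \<notin> insert (l1 i) M"
    proof -
      have sub: "{1..i - 1} \<subseteq> {1..N}" using i by auto
      have "l1 i \<notin> l1 ` {1..i - 1}" "l2 i \<notin> l2 ` {1..i - 1}"
        using inj_on_image_mem_iff[OF inj(1) i sub] inj_on_image_mem_iff[OF inj(2) i sub] False by auto
      moreover have "l1 i \<notin> l2 ` {1..i - 1}" "l2 i \<notin> l1 ` {1..i - 1}" "l1 i \<noteq> l2 i"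
        using inj(3) imageI[OF i, of l1] imageI[OF i, of l2] image_mono[OF sub, of l1] image_mono[OF sub, of l2]
        by (blast, blast, metis disjoint_iff)
      moreover have "l1 i \<notin> (if \<kappa> = 0 then {} else {0})" "l2 i \<notin> (if \<kappa> = 0 then {} else {0})"
        using nz imageI[OF i, of l1] imageI[OF i, of l2] by auto
      ultimately show "l1 i \<notin> M" "l2 i \<notin> insert (l1 i) M"
        unfolding M_def exponents_def by auto
    qed
    define v where "v t = u1 i t - l2 i * u i t" for t
    have rhs: "(\<lambda>t. \<Sum>j<i. A i j * u j t + B i j * u1 j t) \<in> exp_sums M S"
      by (intro exp_sums_sum exp_sums_add exp_sums_cmult IH) auto
    have v: "v \<in> exp_sums (insert (l1 i) M) S"
    proof (rule exp_sums_first_order[OF S _ l1])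
      show "finite M" by (simp add: M_def fin)
      show "(v has_vector_derivative (u2 i t - l2 i * u1 i t)) (at t)" if "t \<in> S" for t
        unfolding v_def using u[OF i that] u1[OF i that]
        by (intro has_vector_derivative_diff has_vector_derivative_mult_right)
      show "(\<lambda>t. u2 i t - l2 i * u1 i t - l1 i * v t) \<in> exp_sums M S"
        using rhs by (rule exp_sums_cong[THEN iffD2, rotated])
          (use eq[OF i] in \<open>auto simp: tri_eq_def v_def algebra_simps\<close>)
    qed
    have ui: "u i \<in> exp_sums (exponents l1 l2 \<kappa> i) S"
      unfolding M'
    proof (rule exp_sums_first_order[OF S _ l2])
      show "finite (insert (l1 i) M)" by (simp add: M_def fin)
      show "(u i has_vector_derivative u1 i t) (at t)" if "t \<in> S" for t
        using u[OF i that] .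
      show "(\<lambda>t. u1 i t - l2 i * u i t) \<in> exp_sums (insert (l1 i) M) S"
        using v by (simp add: v_def[abs_def])
    qed
    have "v \<in> exp_sums (exponents l1 l2 \<kappa> i) S"
      using v exp_sums_mono[of "insert (l1 i) M" "exponents l1 l2 \<kappa> i" S] fin[of i] unfolding M' by blast
    then have "(\<lambda>t. v t + l2 i * u i t) \<in> exp_sums (exponents l1 l2 \<kappa> i) S"
      using ui by (intro exp_sums_add exp_sums_cmult)
    then show ?thesis using ui by (simp add: v_def)
  qed
qed

lemma config_poly_periodic:
  assumes N: "N \<ge> 1" and K: "case1 K \<or> case2 K" and nc: "no_coincidence N K"
    and T: "\<And>s m. s \<in> {1, -1} \<Longrightarrow> m \<in> {1..N} \<Longrightarrow> exp (eigval N K s m * of_real T) = 1"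
    and S: "open S" "is_interval S" and z: "nbody_solution_on N K S z" and t: "t \<in> S" "t + T \<in> S"
  shows "config_poly N z (t + T) = config_poly N z t"
proof -
  obtain v where inj: "\<And>t. t \<in> S \<Longrightarrow> inj_on (\<lambda>n. z n t) {1..N}"
    and z': "\<And>n t. n \<in> {1..N} \<Longrightarrow> t \<in> S \<Longrightarrow> (z n has_vector_derivative v n t) (at t)"
    and v': "\<And>n t. n \<in> {1..N} \<Longrightarrow> t \<in> S \<Longrightarrow>
      (v n has_vector_derivative nbody_accel N K (\<lambda>l. z l t) (\<lambda>l. v l t) n) (at t)"
    using z unfolding nbody_solution_on_def by metis
  define a where "a n t = nbody_accel N K (\<lambda>l. z l t) (\<lambda>l. v l t) n" for n t
  define P where "P t = node_poly {1..N} (\<lambda>n. z n t)" for t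
  define P1 where "P1 t = node_poly1 {1..N} (\<lambda>n. z n t) (\<lambda>n. v n t)" for t
  define P2 where "P2 t = node_poly2 {1..N} (\<lambda>n. z n t) (\<lambda>n. v n t) (\<lambda>n. a n t)" for t
  define l where "l s i = eigval N K s (tri_mode N K i)" for s i
  define u where "u i t = tri_u N K (coeff (P t)) i" for i t
  define u1 where "u1 i t = tri_u N K (coeff (P1 t)) i" for i t
  define u2 where "u2 i t = tri_u N K (coeff (P2 t)) i" for i t
  define \<kappa> :: complex where "\<kappa> = (if case2 K then 0 else 1)"
  have PN: "coeff (P t) N = 1" "j > N \<Longrightarrow> coeff (P t) j = 0" "j \<ge> N \<Longrightarrow> coeff (P1 t) j = 0" for t j
    using lead_coeff_node_poly[of "{1..N}" "\<lambda>n. z n t"]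
    by (auto simp: P_def P1_def degree_node_poly coeff_node_poly1_high intro!: coeff_eq_0)
  have mode: "i \<in> {1..N} \<Longrightarrow> tri_mode N K i \<in> {1..N}" "inj_on (tri_mode N K) {1..N}"
    for i by (auto simp: tri_mode_def inj_on_def)
  have evinj: "inj_on (\<lambda>(s, m). eigval N K s m) ({1, -1} \<times> {1..N})"
    using nc by (simp add: no_coincidence_def)
  have linj: "s = s' \<and> i = i'" if "l s i = l s' i'" "s \<in> {1, -1}" "s' \<in> {1, -1}" "i \<in> {1..N}" "i' \<in> {1..N}" for s s' i i'
  proof -
    have "(s, tri_mode N K i) = (s', tri_mode N K i')"
      using that mode(1)[OF that(4)] mode(1)[OF that(5)]
      by (intro inj_onD[OF evinj] SigmaI) (simp_all add: l_def)
    then show ?thesis using inj_onD[OF mode(2)] that by auto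
  qed
  have "u i \<in> exp_sums (exponents (l 1) (l (-1)) \<kappa> i) S \<and> u1 i \<in> exp_sums (exponents (l 1) (l (-1)) \<kappa> i) S"
    if "i \<le> N" for i
  proof (rule tri_eq_exp_sums[where N = N and ?u2.0 = u2 and A = "tri_A N K" and B = "tri_B N K"])
    show "open S" "convex S" using S by (auto simp: is_interval_convex)
    show "inj_on (l 1) {1..N}" "inj_on (l (-1)) {1..N}"
      using linj by (auto intro!: inj_onI)
    show "l 1 ` {1..N} \<inter> l (-1) ` {1..N} = {}"
    proof (rule equals0I)
      fix x assume "x \<in> l 1 ` {1..N} \<inter> l (-1) ` {1..N}"
      then obtain i j where "l 1 i = l (-1) j" "i \<in> {1..N}" "j \<in> {1..N}"
        by (elim IntE imageE) auto
      from linj[OF this(1) _ _ this(2,3)] show False by simp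
    qed
    show "0 \<notin> l 1 ` {1..N} \<union> l (- 1) ` {1..N}" if "\<kappa> \<noteq> 0"
    proof -
      have "l s i \<noteq> 0" if "s \<in> {1, -1}" "i \<in> {1..N}" for s i
        using nc that(1) mode(1)[OF that(2)] \<open>\<kappa> \<noteq> 0\<close>
        unfolding no_coincidence_def \<kappa>_def l_def by metis
      from this[of 1] this[of "-1"] have "0 \<noteq> l 1 i" "0 \<noteq> l (-1) i" if "i \<in> {1..N}" for i
        using that by force+
      then show ?thesis by (intro notI) (elim UnE imageE; blast)
    qed
    show "u 0 t = \<kappa>" "u1 0 t = 0" for t
      using PN by (auto simp: u_def u1_def tri_u_def \<kappa>_def)
    have P': "((\<lambda>s. coeff (P s) k) has_vector_derivative coeff (P1 t) k) (at t)"
      "((\<lambda>s. coeff (P1 s) k) has_vector_derivative coeff (P2 t) k) (at t)" if "t \<in> S" for k t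
      unfolding P_def P1_def P2_def
      using z'[OF _ that] v'[OF _ that] by (auto intro!: node_poly_deriv node_poly1_deriv simp: a_def)
    show "(u i has_vector_derivative u1 i t) (at t)" "(u1 i has_vector_derivative u2 i t) (at t)"
      if "i \<in> {1..N}" "t \<in> S" for i t
      using P'[OF that(2)] that unfolding u_def[abs_def] u1_def[abs_def] u2_def tri_u_def by auto
    show "tri_eq (l 1) (l (- 1)) (tri_A N K) (tri_B N K) (\<lambda>i. u i t) (\<lambda>i. u1 i t) (\<lambda>i. u2 i t) i"
      if "i \<in> {1..N}" "t \<in> S" for i t
    proof -
      have "\<forall>k<N. lin_eq N K (coeff (P t)) (coeff (P1 t)) (coeff (P2 t)) k"
        unfolding P_def P1_def P2_def
        by (subst nbody_iff_lin_eq[OF N inj[OF that(2)], symmetric]) (simp add: a_def)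
      then show ?thesis
        using lin_eq_all_iff_tri_eq_all[OF K, of N "coeff (P t)" "coeff (P1 t)" "coeff (P2 t)"] PN that
        unfolding l_def[abs_def] u_def u1_def u2_def by auto
    qed
  qed (fact that)
  then have per: "u i (t + T) = u i t" if "i \<le> N" for i
    using that t
  proof (intro exp_sums_periodic[of _ "exponents (l 1) (l (-1)) \<kappa> i" S])
    show "exp (\<mu> * of_real T) = 1" if "\<mu> \<in> exponents (l 1) (l (-1)) \<kappa> i" for \<mu>
    proof -
      have "exp (l s j * of_real T) = 1" if "s \<in> {1, -1}" "j \<in> {1..i}" for s j
        using T[OF that(1) mode(1)[of j]] that(2) \<open>i \<le> N\<close> by (simp add: l_def)
      then show ?thesis
        using that by (auto simp: exponents_def split: if_splits)
    qed
  qed auto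
  have "coeff (P (t + T)) k = coeff (P t) k" for k
  proof (cases "k < N")
    case True
    then show ?thesis
      using per[of "k + 1"] per[of "N - k"] by (cases "case2 K") (auto simp: u_def tri_u_def)
  next
    case False
    then show ?thesis using PN by (metis linorder_neqE_nat)
  qed
  then show ?thesis
    unfolding config_poly_node_poly P_def[symmetric] by (rule poly_eqI)
qed

text \<open>The sets on which \<open>w n\<close> agrees with a given \<open>z l\<close> are closed,
  finite in number, pairwise disjoint by injectivity, and cover \<open>S\<close>; a connected set
  lies in a single one of them.\<close>

lemma permuted_labels:
  fixes z :: "nat \<Rightarrow> real \<Rightarrow> complex"
  assumes S: "connected S" and I: "finite I"
    and cont: "\<And>n. n \<in> I \<Longrightarrow> continuous_on S (z n)" "\<And>n. n \<in> I \<Longrightarrow> continuous_on S (w n)"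
    and inj: "\<And>t. t \<in> S \<Longrightarrow> inj_on (\<lambda>n. z n t) I"
    and eq: "\<And>t n. t \<in> S \<Longrightarrow> n \<in> I \<Longrightarrow> w n t \<in> (\<lambda>n. z n t) ` I"
    and n: "n \<in> I"
  shows "\<exists>l\<in>I. \<forall>t\<in>S. w n t = z l t"
proof (cases "S = {}")
  case False
  then obtain s where s: "s \<in> S" by auto
  then obtain l where l: "l \<in> I" "w n s = z l s" using eq n by blast
  define E where "E j = {t \<in> S. w n t - z j t = 0}" for j
  have cl: "closedin (top_of_set S) (E j)" if "j \<in> I" for j
    unfolding E_def using cont that n
    by (intro continuous_closedin_preimage_constant continuous_intros) auto
  define E' where "E' = (\<Union>j\<in>I - {l}. E j)"
  have "closedin (top_of_set S) E'"
    unfolding E'_def using I cl by (intro closedin_Union) auto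
  moreover have "E l \<union> E' = S"
    using eq n l by (fastforce simp: E_def E'_def)
  moreover have "E l \<inter> E' = {}"
    using inj l by (fastforce simp: E_def E'_def inj_on_def)
  moreover have "s \<in> E l" using s l by (simp add: E_def)
  ultimately have "E' = {}"
    using S cl[OF l(1)] unfolding connected_closedin_eq by blast
  then have "E l = S" using \<open>E l \<union> E' = S\<close> by simp
  then show ?thesis using l by (auto simp: E_def)
qed (use n in auto)

lemma coordinates_periodic:
  assumes S: "is_interval S" and T: "T > 0"
    and cont: "\<And>n. n \<in> {1..N} \<Longrightarrow> continuous_on S (z n)"
    and inj: "\<And>t. t \<in> S \<Longrightarrow> inj_on (\<lambda>n. z n t) {1..N}"
    and per: "\<And>t. t \<in> S \<Longrightarrow> t + T \<in> S \<Longrightarrow> config_poly N z (t + T) = config_poly N z t"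
  shows "\<exists>p::nat. p > 0 \<and> (\<forall>n\<in>{1..N}. \<forall>t\<in>S. t + real p * T \<in> S \<longrightarrow> z n (t + real p * T) = z n t)"
proof -
  have between: "t + real j * T \<in> S" if "t \<in> S" "t + real k * T \<in> S" "j \<le> k" for t j k
  proof -
    have "t \<le> t + real j * T" "t + real j * T \<le> t + real k * T" using that(3) T by auto
    then show ?thesis using S that(1,2) unfolding is_interval_1 by blast
  qed
  \<comment> \<open>The times whose shift by T stays in \<open>S\<close>. They form an interval, so
    one permutation of the labels is valid at all of them.\<close>
  define S' where "S' = {t \<in> S. t + T \<in> S}"
  show ?thesis
  proof (cases "S' = {}")
    case True
    then show ?thesis by (intro exI[of _ 1]) (auto simp: S'_def)
  next
    case False
    then obtain t0 where t0: "t0 \<in> S'" by auto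
    have "is_interval S'"
      unfolding is_interval_1
    proof (intro ballI allI impI)
      fix a b x assume *: "a \<in> S'" "b \<in> S'" "a \<le> x \<and> x \<le> b"
      then have "x \<in> S" using S unfolding is_interval_1 S'_def by blast
      moreover have "x + T \<in> S"
        using S * unfolding is_interval_1 S'_def by (metis (mono_tags, lifting) add_right_mono mem_Collect_eq)
      ultimately show "x \<in> S'" by (simp add: S'_def)
    qed
    then have conn: "connected S'" by (rule is_interval_connected)
    have "\<exists>l\<in>{1..N}. \<forall>t\<in>S'. z n (t + T) = z l t" if n: "n \<in> {1..N}" for n
    proof (rule permuted_labels[where w = "\<lambda>n t. z n (t + T)", OF conn _ _ _ _ _ n])
      show "continuous_on S' (z n)" if "n \<in> {1..N}" for n
        using cont[OF that] by (rule continuous_on_subset) (auto simp: S'_def)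
      show "continuous_on S' (\<lambda>t. z n (t + T))" if "n \<in> {1..N}" for n
        by (rule continuous_on_compose2[OF cont[OF that]]) (auto simp: S'_def intro!: continuous_intros)
      show "inj_on (\<lambda>n. z n t) {1..N}" if "t \<in> S'" for t
        using inj that by (auto simp: S'_def)
      fix t n assume t: "t \<in> S'" "n \<in> {1..N}"
      then have "config_poly N z (t + T) = config_poly N z t" by (auto simp: S'_def intro: per)
      then show "z n (t + T) \<in> (\<lambda>n. z n t) ` {1..N}"
        using t(2) node_poly_roots[of "{1..N}" "\<lambda>n. z n t" "z n (t + T)"]
          node_poly_roots[of "{1..N}" "\<lambda>n. z n (t + T)" "z n (t + T)"]
        unfolding config_poly_node_poly by simp
    qed simp
    then obtain \<sigma> where \<sigma>: "\<And>n. n \<in> {1..N} \<Longrightarrow> \<sigma> n \<in> {1..N}"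
      and z\<sigma>: "\<And>n t. n \<in> {1..N} \<Longrightarrow> t \<in> S' \<Longrightarrow> z n (t + T) = z (\<sigma> n) t" by metis
    \<comment> \<open>Extension by the identity turns \<sigma> into a permutation of all naturals
      with finite support, which has finite order.\<close>
    define \<pi> where "\<pi> n = (if n \<in> {1..N} then \<sigma> n else n)" for n
    have "inj_on \<sigma> {1..N}"
    proof (rule inj_onI)
      fix n m assume nm: "n \<in> {1..N}" "m \<in> {1..N}" "\<sigma> n = \<sigma> m"
      then have "z n (t0 + T) = z m (t0 + T)" using z\<sigma> t0 by simp
      moreover have "inj_on (\<lambda>n. z n (t0 + T)) {1..N}" using t0 by (intro inj) (simp add: S'_def)
      ultimately show "n = m" using nm(1,2) by (metis inj_onD)
    qed
    then have "bij_betw \<sigma> {1..N} {1..N}"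
      using \<sigma> by (simp add: bij_betw_def endo_inj_surj image_subset_iff)
    then have "bij_betw \<pi> {1..N} {1..N}"
      by (rule bij_betw_cong[THEN iffD1, rotated]) (simp add: \<pi>_def)
    then have "\<pi> permutes {1..N}"
      by (rule bij_imp_permutes) (auto simp: \<pi>_def)
    then have "permutation \<pi>" unfolding permutation_permutes by blast
    then obtain p where p: "\<pi> ^^ p = id" "p > 0" by (rule permutation_is_nilpotent)
    have iter: "z n (t + real j * T) = z ((\<pi> ^^ j) n) t \<and> (\<pi> ^^ j) n \<in> {1..N}"
      if "n \<in> {1..N}" "t \<in> S" "t + real j * T \<in> S" for n t j
      using that(1,3)
    proof (induction j arbitrary: n)
      case 0
      then show ?case by simp
    next
      case (Suc j)
      have "t + real j * T \<in> S"
        using between[OF that(2) Suc.prems(2), of j] by auto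
      moreover have "t + real j * T + T \<in> S"
        using Suc.prems(2) by (simp add: algebra_simps)
      ultimately have "z n (t + real j * T + T) = z (\<pi> n) (t + real j * T)" "t + real j * T \<in> S"
        using z\<sigma>[OF Suc.prems(1), of "t + real j * T"] Suc.prems(1) by (auto simp: \<pi>_def S'_def)
      moreover have "\<pi> n \<in> {1..N}" using \<sigma> Suc.prems(1) by (auto simp: \<pi>_def)
      ultimately show ?case
        using Suc.IH[of "\<pi> n"] by (simp add: algebra_simps funpow_swap1)
    qed
    show ?thesis
      using iter[where j = p] p by (intro exI[of _ p]) auto
  qed
qed

section \<open>The period as a common multiple of the denominators\<close>

lemma exp_eigval_period:
  assumes "\<omega> > 0" and "s1 \<in> {1, -1}" "s2 \<in> {1, -1}"
    and ev: "{eigval N K 1 m, eigval N K (-1) m} =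
             {\<i> * of_rat (freq N r1 r2 r3 r4 s1 s2 1 m) * of_real \<omega>,
              \<i> * of_rat (freq N r1 r2 r3 r4 s1 s2 (-1) m) * of_real \<omega>}"
    and m: "m \<in> {1..N}" and s: "s \<in> {1, -1}"
  shows "exp (eigval N K s m * of_real (period N \<omega> r1 r2 r3 r4 s1 s2)) = 1"
proof -
  define L where "L = Lcm ((\<lambda>(s, m). snd (quotient_of (freq N r1 r2 r3 r4 s1 s2 s m))) ` ({1, -1} \<times> {1..N}))"
  have "eigval N K s m \<in> {eigval N K 1 m, eigval N K (-1) m}" using s by auto
  \<comment> \<open>Only the set of the two eigenvalues is known, since the principal root may
    exchange them; thus \<open>s'\<close> may differ from \<open>s\<close>.\<close>
  then obtain s' where s': "s' \<in> {1, -1}"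
    and e: "eigval N K s m = \<i> * of_rat (freq N r1 r2 r3 r4 s1 s2 s' m) * of_real \<omega>"
    unfolding ev by auto
  define r where "r = freq N r1 r2 r3 r4 s1 s2 s' m"
  obtain a b where ab: "quotient_of r = (a, b)" by force
  have b: "b > 0" using quotient_of_denom_pos[OF ab] .
  have "b dvd L"
  proof -
    have "b = (\<lambda>(s, m). snd (quotient_of (freq N r1 r2 r3 r4 s1 s2 s m))) (s', m)"
      using ab by (simp add: r_def)
    then show ?thesis unfolding L_def using s' m by (intro dvd_Lcm image_eqI[of _ _ "(s', m)"]) auto
  qed
  then obtain c where c: "L = b * c" by blast
  have "(of_rat r :: complex) = of_int a / of_int b"
    by (simp add: quotient_of_div[OF ab] of_rat_divide)
  then have "(of_rat r :: complex) * of_int L = of_int (a * c)"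
    using b by (simp add: c)
  moreover have "eigval N K s m * of_real (period N \<omega> r1 r2 r3 r4 s1 s2)
      = 2 * of_real pi * \<i> * (of_rat r * of_int L)"
    unfolding period_def L_def[symmetric] e r_def[symmetric] using assms(1) by simp
  ultimately have "eigval N K s m * of_real (period N \<omega> r1 r2 r3 r4 s1 s2) = 2 * of_int (a * c) * of_real pi * \<i>"
    by simp
  then show ?thesis using exp_integer_2pi[OF Ints_of_int, of "a * c"] by simp
qed

lemma period_pos:
  assumes "\<omega> > 0"
  shows "period N \<omega> r1 r2 r3 r4 s1 s2 > 0"
proof -
  define D where "D = (\<lambda>(s, m). snd (quotient_of (freq N r1 r2 r3 r4 s1 s2 s m))) ` ({1, -1} \<times> {1..N})"
  have "0 \<notin> D" "finite D"
    using quotient_of_denom_pos' by (auto simp: D_def) (metis less_irrefl)+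
  then have "Lcm D \<noteq> 0" by (simp add: Lcm_0_iff)
  then have "Lcm D > 0" by (metis Lcm_int_greater_eq_0 order_le_less)
  then show ?thesis unfolding period_def D_def[symmetric] using assms by simp
qed

lemma isochronous_sufficient:
  assumes N: "N \<ge> 1" and K: "case1 K \<or> case2 K" and nc: "no_coincidence N K" and "T > 0"
    and T: "\<And>s m. s \<in> {1, -1} \<Longrightarrow> m \<in> {1..N} \<Longrightarrow> exp (eigval N K s m * of_real T) = 1"
  shows "isochronous N K T"
  unfolding isochronous_def
proof (intro conjI allI impI)
  fix S z assume *: "open S \<and> is_interval S \<and> nbody_solution_on N K S z"
  show per: "\<forall>t\<in>S. t + T \<in> S \<longrightarrow> config_poly N z (t + T) = config_poly N z t"
    using config_poly_periodic[OF N K nc T] * by blast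
  show "\<exists>p::nat. p > 0 \<and> (\<forall>n\<in>{1..N}. \<forall>t\<in>S. t + real p * T \<in> S \<longrightarrow> z n (t + real p * T) = z n t)"
  proof (rule coordinates_periodic)
    show "continuous_on S (z n)" if "n \<in> {1..N}" for n
      using * that unfolding nbody_solution_on_def
      by (meson continuous_at_imp_continuous_on has_vector_derivative_continuous)
    show "inj_on (\<lambda>n. z n t) {1..N}" if "t \<in> S" for t
      using * that unfolding nbody_solution_on_def by blast
  qed (use * per assms in auto)
qed fact

section \<open>Necessity: entire solutions of the triangular system\<close>

lemma entire_first_order:
  assumes g: "g holomorphic_on UNIV"
  obtains f where "f 0 = c" "\<And>s. (f has_field_derivative l * f s + g s) (at s)"
proof -
  have "(\<lambda>s. exp (- l * s) * g s) holomorphic_on UNIV"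
    by (intro holomorphic_intros g)
  then obtain G where G: "\<And>s. (G has_field_derivative exp (- l * s) * g s) (at s)"
    using holomorphic_convex_primitive'[of UNIV "\<lambda>s. exp (- l * s) * g s"] by auto
  define f where "f s = exp (l * s) * (c + G s - G 0)" for s
  have "(f has_field_derivative l * f s + g s) (at s)" for s
  proof -
    have "(f has_field_derivative exp (l * s) * (exp (- l * s) * g s) + l * exp (l * s) * (c + G s - G 0)) (at s)"
      unfolding f_def by (auto intro!: derivative_eq_intros G)
    also have "exp (l * s) * (exp (- l * s) * g s) + l * exp (l * s) * (c + G s - G 0) = l * f s + g s"
      by (simp add: f_def exp_minus algebra_simps)
    finally show ?thesis .
  qed
  then show ?thesis using that[of f] by (simp add: f_def)
qed

lemma entire_second_order:
  assumes g: "g holomorphic_on UNIV"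
  obtains u u1 u2 where "u 0 = c" "u1 0 = d"
    "\<And>s. (u has_field_derivative u1 s) (at s)" "\<And>s. (u1 has_field_derivative u2 s) (at s)"
    "\<And>s. u2 s - (l1 + l2) * u1 s + l1 * l2 * u s = g s"
proof -
  \<comment> \<open>\<open>v\<close> is to become \<open>u1 - l2 * u\<close>, which dictates its
    initial value.\<close>
  obtain v where v: "v 0 = d - l2 * c" "\<And>s. (v has_field_derivative l1 * v s + g s) (at s)"
    using entire_first_order[OF g, of "d - l2 * c" l1] by blast
  then have "v holomorphic_on UNIV"
    by (auto intro!: derivative_intros simp: holomorphic_on_def field_differentiable_def)
  then obtain u where u: "u 0 = c" "\<And>s. (u has_field_derivative l2 * u s + v s) (at s)"
    using entire_first_order[of v c l2] by blast
  have "((\<lambda>s. l2 * u s + v s) has_field_derivative l2 * (l2 * u s + v s) + (l1 * v s + g s)) (at s)" for s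
    by (auto intro!: derivative_eq_intros u v)
  then show ?thesis
    using u v by (intro that[of u "\<lambda>s. l2 * u s + v s"]) (auto simp: algebra_simps)
qed

definition tri_sol ::
  "(nat \<Rightarrow> complex) \<Rightarrow> (nat \<Rightarrow> complex) \<Rightarrow> (nat \<Rightarrow> nat \<Rightarrow> complex) \<Rightarrow> (nat \<Rightarrow> nat \<Rightarrow> complex)
    \<Rightarrow> (nat \<Rightarrow> complex \<Rightarrow> complex) \<Rightarrow> (nat \<Rightarrow> complex \<Rightarrow> complex) \<Rightarrow> (nat \<Rightarrow> complex \<Rightarrow> complex) \<Rightarrow> nat \<Rightarrow> bool" where
  "tri_sol l1 l2 A B u u1 u2 i \<longleftrightarrow> (\<forall>s. (u i has_field_derivative u1 i s) (at s) \<and>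
     (u1 i has_field_derivative u2 i s) (at s) \<and>
     tri_eq l1 l2 A B (\<lambda>j. u j s) (\<lambda>j. u1 j s) (\<lambda>j. u2 j s) i)"

lemma tri_sol_holomorphic:
  assumes "tri_sol l1 l2 A B u u1 u2 i"
  shows "u i holomorphic_on UNIV" "u1 i holomorphic_on UNIV"
  using assms by (auto simp: tri_sol_def holomorphic_on_def field_differentiable_def)

lemma tri_sol_cong:
  assumes "\<And>j. j \<le> i \<Longrightarrow> u j = w j" "\<And>j. j \<le> i \<Longrightarrow> u1 j = w1 j" "u2 i = w2 i"
  shows "tri_sol l1 l2 A B u u1 u2 i \<longleftrightarrow> tri_sol l1 l2 A B w w1 w2 i"
proof -
  have "(\<Sum>j<i. A i j * u j s + B i j * u1 j s) = (\<Sum>j<i. A i j * w j s + B i j * w1 j s)" for s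
    using assms by (intro sum.cong) auto
  then show ?thesis using assms(1,2)[of i] assms(3) by (simp add: tri_sol_def tri_eq_def)
qed

text \<open>Below \<open>m\<close> the unknowns are prescribed entire functions, from
  \<open>m\<close> on only initial data are prescribed. With \<open>m = 1\<close> this builds a
  solution from slot 0; with a larger \<open>m\<close> it changes initial data from unknown
  \<open>m\<close> on while keeping all earlier unknowns.\<close>

lemma tri_sol_extend:
  assumes u: "\<And>j. j < m \<Longrightarrow> u j holomorphic_on UNIV" "\<And>j. j < m \<Longrightarrow> u1 j holomorphic_on UNIV"
  shows "\<exists>w w1 w2. (\<forall>j<m. w j = u j \<and> w1 j = u1 j \<and> w2 j = u2 j) \<and>
    (\<forall>j\<in>{m..<m+n}. w j 0 = c j \<and> w1 j 0 = d j \<and> tri_sol l1 l2 A B w w1 w2 j)"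
proof (induction n)
  case 0
  show ?case by (intro exI[of _ u] exI[of _ u1] exI[of _ u2]) auto
next
  case (Suc n)
  then obtain w w1 w2 where w: "\<And>j. j < m \<Longrightarrow> w j = u j \<and> w1 j = u1 j \<and> w2 j = u2 j"
    "\<And>j. j \<in> {m..<m+n} \<Longrightarrow> w j 0 = c j \<and> w1 j 0 = d j \<and> tri_sol l1 l2 A B w w1 w2 j" by blast
  have hol: "w j holomorphic_on UNIV" "w1 j holomorphic_on UNIV" if "j < m + n" for j
    using u w(1)[of j] w(2)[of j] that tri_sol_holomorphic[of l1 l2 A B w w1 w2 j]
    by (cases "j < m"; auto)+
  let ?i = "m + n"
  have "(\<lambda>s. \<Sum>j<?i. A ?i j * w j s + B ?i j * w1 j s) holomorphic_on UNIV"
    by (intro holomorphic_intros hol) auto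
  from entire_second_order[OF this, of "c ?i" "d ?i" "l1 ?i" "l2 ?i"]
  obtain y y1 y2 where y: "y 0 = c ?i" "y1 0 = d ?i"
    "\<And>s. (y has_field_derivative y1 s) (at s)" "\<And>s. (y1 has_field_derivative y2 s) (at s)"
    "\<And>s. y2 s - (l1 ?i + l2 ?i) * y1 s + l1 ?i * l2 ?i * y s = (\<Sum>j<?i. A ?i j * w j s + B ?i j * w1 j s)"
    by blast
  define x x1 x2 where "x = w(?i := y)" and "x1 = w1(?i := y1)" and "x2 = w2(?i := y2)"
  have low: "x j = w j" "x1 j = w1 j" "x2 j = w2 j" if "j < ?i" for j
    using that by (auto simp: x_def x1_def x2_def)
  have top: "x ?i = y" "x1 ?i = y1" "x2 ?i = y2" by (auto simp: x_def x1_def x2_def)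
  have "x j 0 = c j \<and> x1 j 0 = d j \<and> tri_sol l1 l2 A B x x1 x2 j" if "j \<in> {m..<m + Suc n}" for j
  proof (cases "j = ?i")
    case True
    have "(\<Sum>j<?i. A ?i j * x j s + B ?i j * x1 j s) = (\<Sum>j<?i. A ?i j * w j s + B ?i j * w1 j s)" for s
      by (intro sum.cong) (auto simp: low)
    then show ?thesis unfolding True tri_sol_def tri_eq_def top using y by auto
  next
    case False
    then have j: "j \<in> {m..<m + n}" using that by auto
    then have "tri_sol l1 l2 A B x x1 x2 j \<longleftrightarrow> tri_sol l1 l2 A B w w1 w2 j"
      by (intro tri_sol_cong) (auto simp: low)
    then show ?thesis using w(2)[OF j] j by (auto simp: low)
  qed
  moreover have "x j = u j \<and> x1 j = u1 j \<and> x2 j = u2 j" if "j < m" for j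
    using w(1)[OF that] low[of j] that by auto
  ultimately show ?case by blast
qed

text \<open>Perturbing only the velocity of the \<open>m\<close>-th unknown changes it by a solution \<open>h\<close> of the
  homogeneous scalar equation; if both solutions are periodic, then so is \<open>h' - \<lambda> h\<close>, which is a
  multiple of the exponential of the other eigenvalue.\<close>

lemma exp_eq_1_if_tri_sols_periodic:
  assumes m: "1 \<le> m"
    and w: "tri_sol l1 l2 A B w w1 w2 m" and x: "tri_sol l1 l2 A B x x1 x2 m"
    and low: "\<And>j. j < m \<Longrightarrow> w j = x j" "\<And>j. j < m \<Longrightarrow> w1 j = x1 j"
    and init: "x m 0 = w m 0" "x1 m 0 = w1 m 0 + 1"
    and per: "\<And>s. w m (s + T) = w m s" "\<And>s. x m (s + T) = x m s"
  shows "exp (l1 m * T) = 1" "exp (l2 m * T) = 1"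
proof -
  have wd: "(w m has_field_derivative w1 m s) (at s)" "(w1 m has_field_derivative w2 m s) (at s)"
    "(x m has_field_derivative x1 m s) (at s)" "(x1 m has_field_derivative x2 m s) (at s)" for s
    using w x by (auto simp: tri_sol_def)
  define h h1 h2 where "h s = x m s - w m s" and "h1 s = x1 m s - w1 m s" and "h2 s = x2 m s - w2 m s" for s
  have h: "(h has_field_derivative h1 s) (at s)" "(h1 has_field_derivative h2 s) (at s)" for s
    unfolding h_def h1_def h2_def by (intro DERIV_diff wd)+
  have eq: "h2 s - (l1 m + l2 m) * h1 s + l1 m * l2 m * h s = 0" for s
  proof -
    have "(\<Sum>j<m. A m j * w j s + B m j * w1 j s) = (\<Sum>j<m. A m j * x j s + B m j * x1 j s)"
      by (intro sum.cong) (auto simp: low)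
    then have "x2 m s - (l1 m + l2 m) * x1 m s + l1 m * l2 m * x m s
      = w2 m s - (l1 m + l2 m) * w1 m s + l1 m * l2 m * w m s"
      using w x by (simp add: tri_sol_def tri_eq_def)
    then show ?thesis by (simp add: h_def h1_def h2_def algebra_simps)
  qed
  have hT: "h T = 0" using per[of 0] init by (simp add: h_def)
  have h1T: "h1 T = 1"
  proof -
    have "((\<lambda>s. h (s + T)) has_field_derivative h1 (0 + T)) (at 0)"
      by (subst DERIV_shift[symmetric]) (simp add: h)
    moreover have "(\<lambda>s. h (s + T)) = h" using per by (auto simp: h_def)
    ultimately have "h1 T = h1 0" using h(1)[of 0] DERIV_unique by fastforce
    then show ?thesis using init by (simp add: h1_def)
  qed
  \<comment> \<open>Only the sum and the product of the eigenvalues enter, so one argument, applied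
    in both orders, covers both of them.\<close>
  have "exp (a * T) = 1" if ab: "a + b = l1 m + l2 m" "a * b = l1 m * l2 m" for a b
  proof -
    define e where "e s = (h1 s - b * h s) * exp (- a * s)" for s
    have "(e has_field_derivative 0) (at s)" for s
    proof -
      have "(e has_field_derivative (h1 s - b * h s) * (- a * exp (- a * s)) + (h2 s - b * h1 s) * exp (- a * s)) (at s)"
        unfolding e_def by (auto intro!: derivative_eq_intros h)
      also have "(h1 s - b * h s) * (- a * exp (- a * s)) + (h2 s - b * h1 s) * exp (- a * s)
        = (h2 s - (a + b) * h1 s + (a * b) * h s) * exp (- a * s)" by (simp add: algebra_simps)
      also have "\<dots> = 0" unfolding ab eq by simp
      finally show ?thesis .
    qed
    then have "e T = e 0"
      using has_field_derivative_zero_constant[of UNIV e] by (metis UNIV_I convex_UNIV)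
    then have "exp (- a * T) = 1"
      using hT h1T init by (simp add: e_def h_def h1_def)
    then show ?thesis by (simp add: exp_minus)
  qed
  from this[of "l1 m" "l2 m"] this[of "l2 m" "l1 m"]
  show "exp (l1 m * T) = 1" "exp (l2 m * T) = 1" by (auto simp: algebra_simps)
qed

section \<open>The discriminant\<close>

definition simple_roots :: "nat \<Rightarrow> complex poly \<Rightarrow> bool" where
  "simple_roots N p \<longleftrightarrow> (\<exists>y. inj_on y {1..N} \<and> p = node_poly {1..N} y)"

lemma monic_rsquarefree_imp_simple_roots:
  assumes "rsquarefree p" "degree p = N" "lead_coeff p = 1"
  shows "simple_roots N p"
proof -
  have p: "(\<Prod>z|poly p z = 0. [:- z, 1:]) = p"
    using complex_poly_decompose_rsquarefree[OF assms(1)] assms(3) by simp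
  have fin: "finite {z. poly p z = 0}"
    using assms(1) by (intro poly_roots_finite) (auto simp: rsquarefree_def)
  have "card {z. poly p z = 0} = degree (\<Prod>z|poly p z = 0. [:- z, 1:])"
    by (subst degree_prod_sum_eq) auto
  then have "card {z. poly p z = 0} = N" using p assms(2) by simp
  then obtain y where y: "bij_betw y {1..N} {z. poly p z = 0}"
    using ex_bij_betw_nat_finite_1[OF fin] by auto
  have "node_poly {1..N} y = (\<Prod>z|poly p z = 0. [:- z, 1:])"
    unfolding node_poly_def by (rule prod.reindex_bij_betw[OF y])
  then show ?thesis
    unfolding simple_roots_def using p y by (metis bij_betw_imp_inj_on)
qed

lemma poly_pderiv_node_poly:
  assumes "finite I" "n \<in> I"
  shows "poly (pderiv (node_poly I y)) (y n) = (\<Prod>l\<in>I - {n}. y n - y l)"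
proof -
  have A: "finite (I - {n})" "n \<notin> I - {n}" "I = insert n (I - {n})" using assms by auto
  show ?thesis
    by (subst A(3), subst node_poly_insert[OF A(1,2)])
      (simp add: pderiv_mult pderiv_pCons poly_node_poly[OF A(1)] del: mult_pCons_left)
qed

lemma simple_roots_no_common_root:
  assumes "simple_roots N p" "poly p x = 0"
  shows "poly (pderiv p) x \<noteq> 0"
proof -
  obtain y where y: "inj_on y {1..N}" "p = node_poly {1..N} y"
    using assms by (auto simp: simple_roots_def)
  then obtain n where n: "n \<in> {1..N}" "x = y n"
    using assms(2) by (auto simp: poly_node_poly)
  have "(\<Prod>l\<in>{1..N} - {n}. y n - y l) \<noteq> 0"
    using n(1) inj_onD[OF y(1), of n] by force
  then show ?thesis
    using poly_pderiv_node_poly[of "{1..N}" n y] n y(2) by simp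
qed

lemma monic_imp_simple_roots:
  assumes "degree p = N" "lead_coeff p = 1" "\<And>a. \<not> (poly p a = 0 \<and> poly (pderiv p) a = 0)"
  shows "simple_roots N p"
  using assms by (intro monic_rsquarefree_imp_simple_roots) (simp_all add: rsquarefree_roots)

text \<open>The polynomials \<open>x ^ j * pderiv P\<close>, reduced modulo the monic polynomial \<open>P\<close>.  The determinant of
  their coefficients is, up to a sign, the discriminant of \<open>P\<close>: it is the norm of the derivative.\<close>

primrec pderiv_shift :: "nat \<Rightarrow> complex poly \<Rightarrow> nat \<Rightarrow> complex poly" where
  "pderiv_shift N P 0 = pderiv P"
| "pderiv_shift N P (Suc j) =
     pCons 0 (pderiv_shift N P j) - Polynomial.smult (coeff (pderiv_shift N P j) (N - 1)) P"

definition discr :: "nat \<Rightarrow> complex poly \<Rightarrow> complex" where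
  "discr N P = (\<Sum>p | p permutes {..<N}. of_int (sign p) * (\<Prod>i<N. coeff (pderiv_shift N P (p i)) i))"

lemma coeff_pderiv_shift_Suc:
  "coeff (pderiv_shift N P (Suc j)) i = (if i = 0 then 0 else coeff (pderiv_shift N P j) (i - 1))
     - coeff (pderiv_shift N P j) (N - 1) * coeff P i"
  by (cases i) (simp_all add: coeff_pCons)

lemma degree_pderiv_shift:
  assumes "degree P = N" "lead_coeff P = 1" "N \<ge> 1"
  shows "degree (pderiv_shift N P j) < N"
proof -
  have "coeff (pderiv_shift N P j) i = 0" if "i \<ge> N" for i
    using that
  proof (induction j arbitrary: i)
    case 0
    then show ?case using assms by (simp add: coeff_pderiv coeff_eq_0)
  next
    case (Suc j)
    then show ?case
      using assms by (cases "i = N") (auto simp del: pderiv_shift.simps simp: coeff_pderiv_shift_Suc coeff_eq_0)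
  qed
  then have "degree (pderiv_shift N P j) \<le> N - 1"
    using assms(3) by (intro degree_le) auto
  then show ?thesis using assms(3) by simp
qed

lemma poly_pderiv_shift_common_root:
  "poly P a = 0 \<Longrightarrow> poly (pderiv P) a = 0 \<Longrightarrow> poly (pderiv_shift N P j) a = 0"
  by (induction j) simp_all

lemma discr_holomorphic:
  fixes P :: "complex \<Rightarrow> complex poly"
  assumes "\<And>k. (\<lambda>s. coeff (P s) k) holomorphic_on S"
  shows "(\<lambda>s. discr N (P s)) holomorphic_on S"
proof -
  have "(\<lambda>s. coeff (pderiv_shift N (P s) j) i) holomorphic_on S" for i j
  proof (induction j arbitrary: i)
    case 0
    show ?case unfolding pderiv_shift.simps coeff_pderiv by (intro holomorphic_intros assms)
  next
    case (Suc j)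
    show ?case
      unfolding coeff_pderiv_shift_Suc
      by (cases "i = 0") (auto intro!: holomorphic_intros assms Suc)
  qed
  then show ?thesis unfolding discr_def by (intro holomorphic_intros)
qed

text \<open>A common root \<open>a\<close> makes the first row of the matrix a combination of the others, with
  coefficients \<open>- a ^ k\<close>.\<close>

lemma discr_eq_0_if_common_root:
  assumes P: "degree P = N" "lead_coeff P = 1" "N \<ge> 1" and a: "poly P a = 0" "poly (pderiv P) a = 0"
  shows "discr N P = 0"
proof -
  define X where "X i j = coeff (pderiv_shift N P j) i" for i j
  \<comment> \<open>The determinant with row 0 replaced by row k. For k >= 1 two rows agree, and
    composing with the transposition of 0 and k yields \<open>T k = - T k\<close>.\<close>
  define T where "T k = (\<Sum>p | p permutes {..<N}. of_int (sign p) * (X k (p 0) * (\<Prod>i\<in>{1..<N}. X i (p i))))" for k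
  have split: "{..<N} = insert 0 {1..<N}" using P(3) by auto
  have rel: "X 0 j = (\<Sum>k\<in>{1..<N}. - (a ^ k) * X k j)" for j
  proof -
    have "0 = poly (pderiv_shift N P j) a"
      using poly_pderiv_shift_common_root[OF a] by simp
    also have "\<dots> = (\<Sum>k<N. X k j * a ^ k)"
      unfolding poly_altdef X_def using degree_pderiv_shift[OF P, of j]
      by (intro sum.mono_neutral_left) (auto intro: coeff_eq_0)
    also have "\<dots> = X 0 j + (\<Sum>k\<in>{1..<N}. X k j * a ^ k)"
      unfolding split by (subst sum.insert) auto
    finally show ?thesis by (simp add: sum_negf mult.commute eq_neg_iff_add_eq_0)
  qed
  have T0: "T k = 0" if k: "k \<in> {1..<N}" for k
  proof -
    define \<tau> where "\<tau> = Transposition.transpose 0 k"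
    have \<tau>: "\<tau> permutes {..<N}" unfolding \<tau>_def using k by (intro permutes_swap_id) auto
    have \<tau>\<tau>: "\<tau> \<circ> \<tau> = id" by (simp add: \<tau>_def)
    have "T k = (\<Sum>p | p permutes {..<N}. - (of_int (sign p) * (X k (p 0) * (\<Prod>i\<in>{1..<N}. X i (p i)))))"
      unfolding T_def
    proof (rule sum.reindex_bij_witness[of _ "\<lambda>p. p \<circ> \<tau>" "\<lambda>p. p \<circ> \<tau>"])
      fix p assume "p \<in> {p. p permutes {..<N}}"
      then have p: "p permutes {..<N}" by simp
      show "p \<circ> \<tau> \<circ> \<tau> = p" "p \<circ> \<tau> \<circ> \<tau> = p" by (simp_all add: comp_assoc \<tau>\<tau>)
      show "p \<circ> \<tau> \<in> {p. p permutes {..<N}}" "p \<circ> \<tau> \<in> {p. p permutes {..<N}}"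
        using permutes_compose[OF \<tau> p] by auto
      have "permutation p" "permutation \<tau>" using p \<tau> unfolding permutation_permutes by blast+
      then have sg: "sign (p \<circ> \<tau>) = - sign p"
        using k by (simp add: sign_compose \<tau>_def sign_swap_id)
      have A: "{1..<N} = insert k ({1..<N} - {k})" using k by auto
      have rest: "(\<Prod>i\<in>{1..<N} - {k}. X i ((p \<circ> \<tau>) i)) = (\<Prod>i\<in>{1..<N} - {k}. X i (p i))"
        by (intro prod.cong) (auto simp: \<tau>_def Transposition.transpose_def)
      have pr: "(\<Prod>i\<in>{1..<N}. X i (q i)) = X k (q k) * (\<Prod>i\<in>{1..<N} - {k}. X i (q i))" for q :: "nat \<Rightarrow> nat"
        by (subst A, subst prod.insert) auto
      show "- (of_int (sign (p \<circ> \<tau>)) * (X k ((p \<circ> \<tau>) 0) * (\<Prod>i\<in>{1..<N}. X i ((p \<circ> \<tau>) i))))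
          = of_int (sign p) * (X k (p 0) * (\<Prod>i\<in>{1..<N}. X i (p i)))"
        unfolding sg pr rest by (simp add: \<tau>_def)
    qed
    also have "\<dots> = - T k" unfolding T_def by (rule sum_negf)
    finally show ?thesis by simp
  qed
  have "discr N P = (\<Sum>p | p permutes {..<N}. of_int (sign p) * (X 0 (p 0) * (\<Prod>i\<in>{1..<N}. X i (p i))))"
    unfolding discr_def X_def[symmetric] split by (subst prod.insert) auto
  also have "\<dots> = (\<Sum>p | p permutes {..<N}. \<Sum>k\<in>{1..<N}.
      - (a ^ k) * (of_int (sign p) * (X k (p 0) * (\<Prod>i\<in>{1..<N}. X i (p i)))))"
    unfolding rel sum_distrib_left sum_distrib_right by (intro sum.cong refl) (simp only: mult_ac)
  also have "\<dots> = (\<Sum>k\<in>{1..<N}. - (a ^ k) * T k)"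
    unfolding T_def sum_distrib_left by (rule sum.swap)
  also have "\<dots> = 0" using T0 by simp
  finally show ?thesis .
qed

lemma simple_roots_if_discr:
  assumes "degree P = N" "lead_coeff P = 1" "N \<ge> 1" "discr N P \<noteq> 0"
  shows "simple_roots N P"
  using assms discr_eq_0_if_common_root[OF assms(1-3)] by (intro monic_imp_simple_roots) auto

text \<open>Modulo z^N - 1 the shifted derivatives are N z^(N-1), N, N z, N z^2, ...: the matrix is
  N times a cyclic permutation matrix, so only the cycle \<sigma> contributes to the
  determinant.\<close>

lemma discr_unity:
  assumes N: "N \<ge> 1"
  shows "discr N (monom 1 N - 1) \<noteq> 0"
proof -
  define P :: "complex poly" where "P = monom 1 N - 1"
  have cP: "coeff P i = (if i = N then 1 else 0) - (if i = 0 then 1 else 0)" for i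
    by (auto simp: P_def)
  have r: "coeff (pderiv_shift N P j) i = (if i = (if j = 0 then N - 1 else j - 1) then of_nat N else 0)" if "j < N" for i j
    using that
  proof (induction j arbitrary: i)
    case 0
    then show ?case using N by (auto simp: coeff_pderiv cP)
  next
    case (Suc j)
    have IH: "coeff (pderiv_shift N P j) i = (if i = (if j = 0 then N - 1 else j - 1) then of_nat N else 0)" for i
      using Suc.IH[of i] Suc.prems by simp
    show ?case
      unfolding coeff_pderiv_shift_Suc IH cP using Suc.prems by auto
  qed
  define \<sigma> where "\<sigma> i = (if i < N then if i = N - 1 then 0 else i + 1 else i)" for i
  have "bij_betw \<sigma> {..<N} {..<N}"
    by (rule bij_betw_byWitness[where f' = "\<lambda>j. if j = 0 then N - 1 else j - 1"])
      (use N in \<open>auto simp: \<sigma>_def\<close>)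
  then have \<sigma>: "\<sigma> permutes {..<N}" by (rule bij_imp_permutes) (auto simp: \<sigma>_def)
  have X: "coeff (pderiv_shift N P (p i)) i = (if p i = \<sigma> i then of_nat N else 0)"
    if "p permutes {..<N}" "i < N" for p i
  proof -
    have "p i < N" using permutes_in_image[OF that(1), of i] that(2) by simp
    then show ?thesis using that(2) by (auto simp: r \<sigma>_def)
  qed
  have "discr N P = (\<Sum>p | p permutes {..<N}. if p = \<sigma> then of_int (sign p) * of_nat N ^ N else 0)"
    unfolding discr_def
  proof (intro sum.cong refl)
    fix p assume "p \<in> {p. p permutes {..<N}}"
    then have p: "p permutes {..<N}" by simp
    have e: "(\<Prod>i<N. coeff (pderiv_shift N P (p i)) i) = (\<Prod>i<N. if p i = \<sigma> i then of_nat N else 0)"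
      by (intro prod.cong) (use X[OF p] in auto)
    show "of_int (sign p) * (\<Prod>i<N. coeff (pderiv_shift N P (p i)) i)
        = (if p = \<sigma> then of_int (sign p) * of_nat N ^ N else 0)"
    proof (cases "p = \<sigma>")
      case False
      then obtain i where i: "p i \<noteq> \<sigma> i" by blast
      have "i < N"
      proof (rule ccontr)
        assume "\<not> i < N"
        then have "p i = i" "\<sigma> i = i" using permutes_not_in[OF p] permutes_not_in[OF \<sigma>] by auto
        then show False using i by simp
      qed
      then have "(\<Prod>i<N. if p i = \<sigma> i then of_nat N else (0::complex)) = 0"
        using i by (intro prod_zero) auto
      then show ?thesis using False e by simp
    next
      case True
      then show ?thesis unfolding e by simp
    qed
  qed
  also have "\<dots> = of_int (sign \<sigma>) * of_nat N ^ N"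
    using \<sigma> by (simp add: sum.delta finite_permutations)
  also have "\<dots> \<noteq> 0" using N by simp
  finally show ?thesis by (simp add: P_def)
qed

text \<open>A zero-free horizontal line exists since the zeros of the discriminant are countable.\<close>

lemma exists_line_simple_roots:
  fixes P :: "complex \<Rightarrow> complex poly"
  assumes P: "\<And>s. degree (P s) = N" "\<And>s. lead_coeff (P s) = 1" "N \<ge> 1"
    and hol: "\<And>k. (\<lambda>s. coeff (P s) k) holomorphic_on UNIV" and D0: "discr N (P 0) \<noteq> 0"
  obtains \<tau> :: real where "\<And>x::real. simple_roots N (P (of_real x + \<i> * of_real \<tau>))"
proof -
  define D where "D s = discr N (P s)" for s
  have D: "D holomorphic_on UNIV"
    unfolding D_def[abs_def] by (rule discr_holomorphic[OF hol])
  have "countable {s. D s = 0}"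
  proof (cases "D constant_on UNIV")
    case True
    then have "{s. D s = 0} = {}" using D0 by (auto simp: constant_on_def D_def)
    then show ?thesis by simp
  next
    case False
    then show ?thesis
      using holomorphic_countable_zeros[OF D open_UNIV connected_UNIV fsigma_UNIV] by simp
  qed
  then have "countable (Im ` {s. D s = 0})" by simp
  then have "Im ` {s. D s = 0} \<noteq> UNIV" using uncountable_UNIV_real by metis
  then obtain \<tau> where \<tau>: "\<tau> \<notin> Im ` {s. D s = 0}" by blast
  show ?thesis
  proof (rule that)
    fix x :: real
    have "Im (of_real x + \<i> * of_real \<tau>) = \<tau>" by simp
    then have "D (of_real x + \<i> * of_real \<tau>) \<noteq> 0"
      using \<tau> by (metis (mono_tags, lifting) image_eqI mem_Collect_eq)
    then show "simple_roots N (P (of_real x + \<i> * of_real \<tau>))"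
      unfolding D_def by (rule simple_roots_if_discr[OF P])
  qed
qed

section \<open>Continuous labelling of simple zeros\<close>

text \<open>If all N zeros had distance at least \<eta> from \<open>w\<close>, the product of the
  distances would be at least \<open>\<eta> ^ N\<close>. This bound is the source of the continuity
  of the zeros.\<close>

lemma node_poly_near_root:
  assumes "cmod (poly (node_poly {1..N} y) w) < \<eta> ^ N" "\<eta> > 0"
  shows "\<exists>n\<in>{1..N}. cmod (w - y n) < \<eta>"
proof (rule ccontr)
  assume "\<not> ?thesis"
  then have "(\<Prod>n\<in>{1..N}. \<eta>) \<le> (\<Prod>n\<in>{1..N}. cmod (w - y n))"
    using assms(2) by (intro prod_mono) (auto simp: not_less)
  then show False using assms(1) by (simp add: poly_node_poly prod_norm)
qed

lemma near_root:
  assumes "degree p = N" "lead_coeff p = 1" "cmod (poly p w) < \<eta> ^ N" "\<eta> > 0"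
  shows "\<exists>x. poly p x = 0 \<and> cmod (w - x) < \<eta>"
proof -
  obtain r where r: "smult (lead_coeff p) (\<Prod>i<degree p. [:- r i, 1:]) = p"
    by (rule complex_poly_decompose')
  have "p = (\<Prod>i<N. [:- r i, 1:])" using r assms(1,2) by simp
  also have "\<dots> = node_poly {1..N} (\<lambda>n. r (n - 1))"
    unfolding node_poly_def
    by (rule prod.reindex_bij_witness[of _ "\<lambda>n. n - 1" Suc]) auto
  finally have p: "p = node_poly {1..N} (\<lambda>n. r (n - 1))" .
  show ?thesis
    using node_poly_near_root[of N "\<lambda>n. r (n - 1)" w \<eta>] assms(3,4) node_poly_roots[of "{1..N}"]
    unfolding p by blast
qed

lemma poly_eq_node_poly:
  assumes "degree p = N" "lead_coeff p = 1" "inj_on y {1..N}" "\<And>n. n \<in> {1..N} \<Longrightarrow> poly p (y n) = 0"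
  shows "p = node_poly {1..N} y"
proof (rule ccontr)
  let ?q = "p - node_poly {1..N} y"
  assume "p \<noteq> node_poly {1..N} y"
  then have q: "?q \<noteq> 0" by simp
  have "coeff ?q N = 0"
    using assms(1,2) lead_coeff_node_poly[of "{1..N}" y] by (simp add: degree_node_poly)
  moreover have "degree ?q \<le> N"
    using assms(1) by (intro degree_diff_le) (auto simp: degree_node_poly)
  ultimately have "degree ?q < N"
    using q by (metis leading_coeff_0_iff le_neq_implies_less)
  moreover have "card (y ` {1..N}) \<le> card {x. poly ?q x = 0}"
    using assms(4) q by (intro card_mono poly_roots_finite image_subsetI) (simp_all add: node_poly_roots)
  ultimately show False
    using card_poly_roots_bound[OF q] card_image[OF assms(3)] by simp
qed

locale monic_family =
  fixes N :: nat and P :: "real \<Rightarrow> complex poly"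
  assumes deg: "\<And>t. degree (P t) = N" and monic: "\<And>t. lead_coeff (P t) = 1"
    and cont: "\<And>k. continuous_on UNIV (\<lambda>t. coeff (P t) k)"
begin

text \<open>Closed intervals are used so that adjacent labellings can be compared at their common
  endpoint.\<close>

definition labelled :: "real \<Rightarrow> real \<Rightarrow> bool" where
  "labelled a b \<longleftrightarrow> (\<exists>z. (\<forall>n\<in>{1..N}. continuous_on {a..b} (z n)) \<and>
     (\<forall>t\<in>{a..b}. inj_on (\<lambda>n. z n t) {1..N} \<and> P t = node_poly {1..N} (\<lambda>n. z n t)))"

lemma eventually_near_root:
  assumes "poly (P t) w = 0 \<or> N = 0" "\<eta> > 0"
  shows "\<exists>d>0. \<forall>s. \<bar>s - t\<bar> < d \<longrightarrow> N = 0 \<or> (\<exists>x. poly (P s) x = 0 \<and> cmod (w - x) < \<eta>)"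
proof (cases "N = 0")
  case False
  have "continuous_on UNIV (\<lambda>t. poly (P t) w)"
    unfolding poly_altdef deg by (intro continuous_intros cont)
  then have "isCont (\<lambda>t. poly (P t) w) t" by (simp add: continuous_on_eq_continuous_at)
  moreover have "\<eta> ^ N > 0" using assms(2) by simp
  ultimately obtain d where d: "d > 0" "\<And>s. dist s t < d \<Longrightarrow> dist (poly (P s) w) (poly (P t) w) < \<eta> ^ N"
    unfolding continuous_at_eps_delta by blast
  have "\<exists>x. poly (P s) x = 0 \<and> cmod (w - x) < \<eta>" if "\<bar>s - t\<bar> < d" for s
    using d(2)[of s] that assms False deg monic by (intro near_root[of _ N]) (auto simp: dist_norm)
  then show ?thesis using d(1) by blast
qed (auto intro: exI[of _ 1])

text \<open>The discs of radius \<epsilon> around the zeros at \<open>t0\<close> are disjoint and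
  each keeps a zero for nearby times; N zeros in N discs leave exactly one per disc, which receives
  the label of the disc. Continuity at other times follows from the same estimate and this
  uniqueness.\<close>

lemma labelled_local:
  assumes y: "inj_on y {1..N}" "P t0 = node_poly {1..N} y"
  shows "\<exists>d>0. \<forall>a b. a \<le> t0 \<and> t0 \<le> b \<and> b - a < d \<longrightarrow> labelled a b"
proof -
  obtain \<epsilon> where \<epsilon>: "\<epsilon> > 0" "\<And>i j. i \<in> {1..N} \<Longrightarrow> j \<in> {1..N} \<Longrightarrow> i \<noteq> j \<Longrightarrow> 2 * \<epsilon> \<le> cmod (y i - y j)"
  proof -
    \<comment> \<open>The element 1 keeps the set nonempty when N < 2 and there are no pairs of
      zeros.\<close>
    define D where "D = insert 1 ((\<lambda>p. cmod (y (fst p) - y (snd p))) ` {p \<in> {1..N} \<times> {1..N}. fst p \<noteq> snd p})"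
    have D: "finite D" "D \<noteq> {}" by (auto simp: D_def)
    have "0 < x" if "x \<in> D" for x
      using that by (auto simp: D_def inj_on_eq_iff[OF y(1)])
    then have "Min D > 0"
      using D by (subst Min_gr_iff) auto
    moreover have "Min D \<le> cmod (y i - y j)" if "i \<in> {1..N}" "j \<in> {1..N}" "i \<noteq> j" for i j
      using that D(1) by (intro Min_le) (auto simp: D_def intro!: image_eqI[of _ _ "(i, j)"])
    ultimately show ?thesis using that[of "Min D / 2"] by auto
  qed
  have "\<exists>d>0. \<forall>s. \<bar>s - t0\<bar> < d \<longrightarrow> (\<exists>x. poly (P s) x = 0 \<and> cmod (y n - x) < \<epsilon>)" if "n \<in> {1..N}" for n
    using eventually_near_root[of t0 "y n" \<epsilon>] \<epsilon>(1) that y(2) node_poly_roots[of "{1..N}" y "y n"] by auto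
  then obtain d where d: "\<And>n. n \<in> {1..N} \<Longrightarrow> d n > 0"
    "\<And>n s. n \<in> {1..N} \<Longrightarrow> \<bar>s - t0\<bar> < d n \<Longrightarrow> \<exists>x. poly (P s) x = 0 \<and> cmod (y n - x) < \<epsilon>"
    by metis
  define \<delta> where "\<delta> = Min (insert 1 (d ` {1..N}))"
  have \<delta>: "\<delta> > 0" "\<And>n. n \<in> {1..N} \<Longrightarrow> \<delta> \<le> d n"
  proof -
    show "\<delta> > 0" using d(1) by (auto simp: \<delta>_def)
    show "\<delta> \<le> d n" if "n \<in> {1..N}" for n
      unfolding \<delta>_def by (rule Min_le) (use that in auto)
  qed
  have "\<forall>n s. n \<in> {1..N} \<and> \<bar>s - t0\<bar> < \<delta> \<longrightarrow> (\<exists>x. poly (P s) x = 0 \<and> cmod (y n - x) < \<epsilon>)"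
    using d(2) \<delta>(2) by (meson order_less_le_trans)
  then obtain z where z: "\<And>n s. n \<in> {1..N} \<Longrightarrow> \<bar>s - t0\<bar> < \<delta> \<Longrightarrow> poly (P s) (z n s) = 0"
    "\<And>n s. n \<in> {1..N} \<Longrightarrow> \<bar>s - t0\<bar> < \<delta> \<Longrightarrow> cmod (y n - z n s) < \<epsilon>"
    by metis
  have sep: "i = j" if "i \<in> {1..N}" "j \<in> {1..N}" "cmod (y i - x) < \<epsilon>" "cmod (y j - x) < \<epsilon>" for i j x
  proof (rule ccontr)
    assume "i \<noteq> j"
    then have "2 * \<epsilon> \<le> cmod ((y i - x) - (y j - x))" using \<epsilon>(2)[OF that(1,2)] by simp
    also have "\<dots> \<le> cmod (y i - x) + cmod (y j - x)" by (rule norm_triangle_ineq4)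
    finally show False using that(3,4) by simp
  qed
  have inj: "inj_on (\<lambda>n. z n s) {1..N}" if "\<bar>s - t0\<bar> < \<delta>" for s
  proof (rule inj_onI)
    fix n m assume nm: "n \<in> {1..N}" "m \<in> {1..N}" "z n s = z m s"
    then show "n = m" using sep[of n m "z n s"] z(2)[OF nm(1) that] z(2)[OF nm(2) that] by simp
  qed
  have Pz: "P s = node_poly {1..N} (\<lambda>n. z n s)" if "\<bar>s - t0\<bar> < \<delta>" for s
    by (rule poly_eq_node_poly[OF deg monic inj[OF that]]) (rule z(1)[OF _ that])
  have uniq: "x = z n s"
    if n: "n \<in> {1..N}" and s: "\<bar>s - t0\<bar> < \<delta>" and x: "poly (P s) x = 0" "cmod (y n - x) < \<epsilon>" for n s x
  proof -
    obtain j where j: "j \<in> {1..N}" "x = z j s"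
      using x(1) node_poly_roots[of "{1..N}" "\<lambda>n. z n s" x] unfolding Pz[OF s] by auto
    then show ?thesis using sep[OF n j(1) x(2)] z(2)[OF j(1) s] by simp
  qed
  have cz: "isCont (z n) s" if n: "n \<in> {1..N}" and s: "\<bar>s - t0\<bar> < \<delta>" for n s
    unfolding continuous_at_eps_delta
  proof (intro allI impI)
    fix e :: real assume "e > 0"
    \<comment> \<open>Small enough for the required accuracy and for the zero found near
      \<open>z n s\<close> to stay in the disc of \<open>y n\<close>, where it must be the one with
      label \<open>n\<close>.\<close>
    define \<eta> where "\<eta> = min e (\<epsilon> - cmod (y n - z n s))"
    have \<eta>: "\<eta> > 0" using \<open>e > 0\<close> z(2)[OF n s] by (simp add: \<eta>_def)
    obtain d' where d': "d' > 0" "\<And>r. \<bar>r - s\<bar> < d' \<Longrightarrow> \<exists>x. poly (P r) x = 0 \<and> cmod (z n s - x) < \<eta>"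
      using eventually_near_root[of s "z n s" \<eta>] z(1)[OF n s] \<eta> n by auto
    define r0 where "r0 = min d' (\<delta> - \<bar>s - t0\<bar>)"
    show "\<exists>d>0. \<forall>r. dist r s < d \<longrightarrow> dist (z n r) (z n s) < e"
    proof (intro exI[of _ r0] conjI allI impI)
      show "r0 > 0" using d'(1) s by (simp add: r0_def)
      fix r assume "dist r s < r0"
      then have r: "\<bar>r - s\<bar> < d'" "\<bar>r - t0\<bar> < \<delta>"
        by (auto simp: r0_def dist_real_def abs_if split: if_splits)
      obtain x where x: "poly (P r) x = 0" "cmod (z n s - x) < \<eta>" using d'(2)[OF r(1)] by blast
      have "cmod (y n - x) \<le> cmod (y n - z n s) + cmod (z n s - x)"
        using norm_triangle_ineq[of "y n - z n s" "z n s - x"] by simp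
      then have "cmod (y n - x) < \<epsilon>" using x(2) by (simp add: \<eta>_def)
      then have "x = z n r" by (rule uniq[OF n r(2) x(1)])
      then show "dist (z n r) (z n s) < e" using x(2) by (simp add: \<eta>_def dist_norm norm_minus_commute)
    qed
  qed
  have "labelled a b" if "a \<le> t0 \<and> t0 \<le> b \<and> b - a < \<delta>" for a b
  proof -
    have ab: "\<bar>s - t0\<bar> < \<delta>" if "s \<in> {a..b}" for s
      using that \<open>a \<le> t0 \<and> t0 \<le> b \<and> b - a < \<delta>\<close> by auto
    show ?thesis
      unfolding labelled_def
      using ab cz inj Pz by (intro exI[of _ z] conjI ballI continuous_at_imp_continuous_on) auto
  qed
  then show ?thesis using \<delta>(1) by blast
qed

text \<open>At the common endpoint both labellings list the same zeros; the second one is renumbered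
  by the permutation that matches them there.\<close>

lemma labelled_trans:
  assumes "labelled a b" "labelled b c" "a \<le> b" "b \<le> c"
  shows "labelled a c"
proof -
  obtain z where z': "\<forall>n\<in>{1..N}. continuous_on {a..b} (z n)"
    "\<forall>t\<in>{a..b}. inj_on (\<lambda>n. z n t) {1..N} \<and> P t = node_poly {1..N} (\<lambda>n. z n t)"
    using assms(1) unfolding labelled_def by (elim exE conjE)
  obtain w where w': "\<forall>n\<in>{1..N}. continuous_on {b..c} (w n)"
    "\<forall>t\<in>{b..c}. inj_on (\<lambda>n. w n t) {1..N} \<and> P t = node_poly {1..N} (\<lambda>n. w n t)"
    using assms(2) unfolding labelled_def by (elim exE conjE)
  note z = z'[THEN bspec] and w = w'[THEN bspec]
  have b: "b \<in> {a..b}" "b \<in> {b..c}" using assms by auto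
  have rs: "u ` {1..N} = {x. poly (node_poly {1..N} u) x = 0}" for u
    by (simp add: node_poly_roots)
  have "(\<lambda>n. z n b) ` {1..N} = (\<lambda>n. w n b) ` {1..N}"
    unfolding rs z(2)[OF b(1), THEN conjunct2, symmetric] w(2)[OF b(2), THEN conjunct2, symmetric] ..
  then have "\<forall>n\<in>{1..N}. \<exists>m\<in>{1..N}. z n b = w m b" by blast
  then obtain \<sigma> where \<sigma>: "\<And>n. n \<in> {1..N} \<Longrightarrow> \<sigma> n \<in> {1..N}" "\<And>n. n \<in> {1..N} \<Longrightarrow> z n b = w (\<sigma> n) b" by metis
  have "inj_on \<sigma> {1..N}"
  proof (rule inj_onI)
    fix n m assume nm: "n \<in> {1..N}" "m \<in> {1..N}" "\<sigma> n = \<sigma> m"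
    then have "z n b = z m b" using \<sigma>(2) by simp
    from inj_onD[OF z(2)[OF b(1), THEN conjunct1] this nm(1,2)] show "n = m" .
  qed
  then have \<sigma>b: "bij_betw \<sigma> {1..N} {1..N}"
    using \<sigma>(1) by (simp add: bij_betw_def endo_inj_surj image_subset_iff)
  define x where "x n t = (if t \<le> b then z n t else w (\<sigma> n) t)" for n t
  show ?thesis
    unfolding labelled_def
  proof (intro exI[of _ x] conjI ballI)
    fix n assume n: "n \<in> {1..N}"
    have ac: "{a..c} = {a..b} \<union> {b..c}" using assms(3,4) by auto
    show "continuous_on {a..c} (x n)"
      unfolding ac x_def
      by (rule continuous_on_If) (use z(1)[OF n] w(1)[OF \<sigma>(1)[OF n]] \<sigma>(2)[OF n] in auto)
  next
    fix t assume t: "t \<in> {a..c}"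
    have "inj_on (\<lambda>n. x n t) {1..N} \<and> P t = node_poly {1..N} (\<lambda>n. x n t)"
    proof (cases "t \<le> b")
      case True
      then have "t \<in> {a..b}" using t by auto
      then show ?thesis
        using z(2)[of t] True by (simp add: x_def)
    next
      case False
      then have "t \<in> {b..c}" using t by auto
      then have w': "inj_on (\<lambda>n. w n t) {1..N}" "P t = node_poly {1..N} (\<lambda>n. w n t)" using w(2) by auto
      have "inj_on ((\<lambda>n. w n t) \<circ> \<sigma>) {1..N}"
        using \<sigma>b w'(1) by (intro comp_inj_on) (auto simp: bij_betw_def)
      moreover have "node_poly {1..N} (\<lambda>n. w (\<sigma> n) t) = node_poly {1..N} (\<lambda>n. w n t)"
        unfolding node_poly_def by (rule prod.reindex_bij_betw[OF \<sigma>b])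
      ultimately show ?thesis using False w'(2) by (simp add: x_def o_def)
    qed
    then show "inj_on (\<lambda>n. x n t) {1..N}" "P t = node_poly {1..N} (\<lambda>n. x n t)" by auto
  qed
qed

text \<open>Compactness through bisection (\<open>Bolzano\<close>): labelled intervals can be joined
  and exist around every point. \<open>Q\<close> demands nothing of intervals that leave
  \<open>{a..b}\<close>, where zeros need not be simple.\<close>

lemma labelled:
  assumes "a \<le> b" "\<And>t. t \<in> {a..b} \<Longrightarrow> \<exists>y. inj_on y {1..N} \<and> P t = node_poly {1..N} y"
  shows "labelled a b"
proof -
  define Q where "Q x y \<longleftrightarrow> (a \<le> x \<and> y \<le> b \<longrightarrow> labelled x y)" for x y
  have "Q a b"
  proof (rule Bolzano[OF assms(1)])
    fix x y z assume "Q x y" "Q y z" "x \<le> y" "y \<le> z"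
    then show "Q x z" unfolding Q_def using labelled_trans[of x y z] by auto
  next
    fix x assume "a \<le> x" "x \<le> b"
    then have "x \<in> {a..b}" by simp
    then obtain y where "inj_on y {1..N}" "P x = node_poly {1..N} y" using assms(2) by blast
    from labelled_local[OF this]
    show "\<exists>d>0. \<forall>a b. a \<le> x \<and> x \<le> b \<and> b - a < d \<longrightarrow> Q a b"
      unfolding Q_def by blast
  qed
  then have "labelled a b" by (simp add: Q_def)
  then show ?thesis by simp
qed

end

section \<open>Collision-free motions from entire solutions\<close>

lemma has_vector_derivative_iff_quotient:
  fixes f :: "real \<Rightarrow> complex"
  shows "(f has_vector_derivative D) (at t) \<longleftrightarrow> ((\<lambda>s. (f s - f t) / of_real (s - t)) \<longlongrightarrow> D) (at t)"
proof -
  have "(f has_vector_derivative D) (at t) \<longleftrightarrow>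
      ((\<lambda>s. norm ((f s - f t) - (s - t) *\<^sub>R D) / norm (s - t)) \<longlongrightarrow> 0) (at t)"
    unfolding has_vector_derivative_def has_derivative_iff_norm by (simp add: bounded_linear_scaleR_left)
  also have "\<dots> \<longleftrightarrow> ((\<lambda>s. norm ((f s - f t) / of_real (s - t) - D)) \<longlongrightarrow> 0) (at t)"
  proof (rule tendsto_cong)
    have "norm ((f s - f t) - (s - t) *\<^sub>R D) / norm (s - t) = norm ((f s - f t) / of_real (s - t) - D)"
      if "s \<noteq> t" for s
    proof -
      have "(f s - f t) / of_real (s - t) - D = ((f s - f t) - (s - t) *\<^sub>R D) / of_real (s - t)"
        using that by (simp add: scaleR_conv_of_real diff_divide_distrib)
      then show ?thesis by (simp add: norm_divide del: of_real_diff)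
    qed
    then show "\<forall>\<^sub>F s in at t. norm ((f s - f t) - (s - t) *\<^sub>R D) / norm (s - t) = norm ((f s - f t) / of_real (s - t) - D)"
      by (auto simp: eventually_at_filter)
  qed
  also have "\<dots> \<longleftrightarrow> ((\<lambda>s. (f s - f t) / of_real (s - t)) \<longlongrightarrow> D) (at t)"
    unfolding tendsto_norm_zero_iff LIM_zero_iff ..
  finally show ?thesis .
qed

text \<open>Since \<open>f\<close> vanishes at \<open>t\<close>, the difference quotient of the
  product is that of \<open>f\<close> times \<open>h\<close>, so continuity of \<open>h\<close>
  suffices. The zeros are known only to be continuous when this is applied.\<close>

lemma has_vector_derivative_mult_at_zero:
  fixes f h :: "real \<Rightarrow> complex"
  assumes "(f has_vector_derivative D) (at t)" "f t = 0" "isCont h t"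
  shows "((\<lambda>s. f s * h s) has_vector_derivative D * h t) (at t)"
proof -
  have "((\<lambda>s. (f s - f t) / of_real (s - t) * h s) \<longlongrightarrow> D * h t) (at t)"
    using assms unfolding has_vector_derivative_iff_quotient isCont_def by (intro tendsto_mult)
  then show ?thesis
    unfolding has_vector_derivative_iff_quotient using assms(2) by (simp add: mult.commute)
qed

lemma root_has_vector_derivative:
  assumes z: "\<And>l. l \<in> {1..N} \<Longrightarrow> continuous_on S (z l)" and S: "open S" "t \<in> S"
    and inj: "inj_on (\<lambda>l. z l t) {1..N}" and n: "n \<in> {1..N}"
    and P: "\<And>s. s \<in> S \<Longrightarrow> P s = node_poly {1..N} (\<lambda>l. z l s)"
    and deg: "\<And>s. degree (P s) = N"
    and P1: "\<And>k. ((\<lambda>s. coeff (P s) k) has_vector_derivative coeff P1 k) (at t)" and deg1: "degree P1 \<le> N"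
  shows "(z n has_vector_derivative - poly P1 (z n t) / poly (pderiv (P t)) (z n t)) (at t)"
proof -
  define w where "w = z n t"
  define g where "g s = (\<Prod>l\<in>{1..N} - {n}. w - z l s)" for s
  have zc: "isCont (z l) t" if "l \<in> {1..N}" for l
    using z[OF that] S by (simp add: continuous_on_eq_continuous_at)
  have g: "isCont g t" unfolding g_def by (intro continuous_intros zc) auto
  \<comment> \<open>Solving \<open>poly (P s) w = (w - z n s) * g s\<close> for \<open>z n s\<close> shows that continuity of the zeros suffices.\<close>
  have gt: "g t = poly (pderiv (P t)) w"
    unfolding g_def w_def P[OF S(2)] by (rule poly_pderiv_node_poly[symmetric]) (use n in auto)
  have g0: "g t \<noteq> 0"
    unfolding gt w_def
    by (rule simple_roots_no_common_root[of N])
      (use inj n P[OF S(2)] in \<open>auto simp: simple_roots_def node_poly_roots\<close>)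
  have "((\<lambda>s. \<Sum>k\<le>N. coeff (P s) k * w ^ k) has_vector_derivative (\<Sum>k\<le>N. coeff P1 k * w ^ k)) (at t)"
    by (intro has_vector_derivative_sum has_vector_derivative_mult_left P1)
  moreover have "(\<Sum>k\<le>N. coeff P1 k * w ^ k) = poly P1 w"
    unfolding poly_altdef using deg1 by (intro sum.mono_neutral_right) (auto intro: coeff_eq_0)
  ultimately have f: "((\<lambda>s. poly (P s) w) has_vector_derivative poly P1 w) (at t)"
    unfolding poly_altdef deg by simp
  have Pt: "poly (P t) w = 0"
    using n by (simp add: P[OF S(2)] node_poly_roots w_def)
  have fact: "poly (P s) w = (w - z n s) * g s" if "s \<in> S" for s
    unfolding P[OF that] g_def using n by (simp add: poly_node_poly prod.remove)
  have "isCont (\<lambda>s. - inverse (g s)) t" using g g0 by (intro continuous_intros)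
  from has_vector_derivative_add[OF has_vector_derivative_mult_at_zero[OF f Pt this] has_vector_derivative_const[of w]]
  have "((\<lambda>s. poly (P s) w * - inverse (g s) + w) has_vector_derivative poly P1 w * - inverse (g t)) (at t)"
    by simp
  moreover have "\<forall>\<^sub>F s in nhds t. poly (P s) w * - inverse (g s) + w = z n s"
  proof -
    have "\<forall>\<^sub>F s in at t. g s \<noteq> 0"
      using g g0 unfolding isCont_def by (rule tendsto_imp_eventually_ne)
    then have "\<forall>\<^sub>F s in nhds t. g s \<noteq> 0" using g0 by (simp add: eventually_nhds_conv_at)
    moreover have "\<forall>\<^sub>F s in nhds t. s \<in> S" using S by (rule eventually_nhds_in_open)
    ultimately show ?thesis
      by eventually_elim (simp add: fact field_simps)
  qed
  then obtain U where "open U" "t \<in> U" "\<And>s. s \<in> U \<Longrightarrow> poly (P s) w * - inverse (g s) + w = z n s"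
    unfolding eventually_nhds by blast
  ultimately have "(z n has_vector_derivative poly P1 w * - inverse (g t)) (at t)"
    by (rule has_vector_derivative_transform_within_open)
  then show ?thesis by (simp add: gt w_def divide_inverse)
qed

lemma differentiable_poly_coeffs:
  fixes Q :: "real \<Rightarrow> complex poly"
  assumes "\<And>s. degree (Q s) \<le> N" "\<And>k. (\<lambda>s. coeff (Q s) k) differentiable (at t)" "f differentiable (at t)"
  shows "(\<lambda>s. poly (Q s) (f s)) differentiable (at t)"
proof -
  have "poly (Q s) (f s) = (\<Sum>k\<le>N. coeff (Q s) k * f s ^ k)" for s
    unfolding poly_altdef using assms(1) by (intro sum.mono_neutral_left) (auto intro: coeff_eq_0)
  then show ?thesis
    using assms(2,3) by (simp add: differentiable_sum differentiable_mult differentiable_power)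
qed

text \<open>The zeros are at first merely continuous on \<open>{a..b}\<close>. Their velocities come
  from implicit differentiation, and \<open>nbody_iff_lin_eq\<close>, read backwards, identifies the
  accelerations; the open interval leaves room for two-sided derivatives.\<close>

lemma nbody_solution_from_coefficients:
  assumes N: "N \<ge> 1" and ab: "a < b"
    and degs: "\<And>t. degree (P t) = N" "\<And>t. lead_coeff (P t) = 1" "\<And>t. degree (P1 t) \<le> N"
    and P: "\<And>t k. ((\<lambda>s. coeff (P s) k) has_vector_derivative coeff (P1 t) k) (at t)"
    and P1: "\<And>t k. ((\<lambda>s. coeff (P1 s) k) has_vector_derivative coeff (P2 t) k) (at t)"
    and simple: "\<And>t. t \<in> {a..b} \<Longrightarrow> simple_roots N (P t)"
    and lin: "\<And>t k. k < N \<Longrightarrow> lin_eq N K (coeff (P t)) (coeff (P1 t)) (coeff (P2 t)) k"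
  shows "\<exists>z. nbody_solution_on N K {a<..<b} z \<and> (\<forall>t\<in>{a<..<b}. config_poly N z t = P t)"
proof -
  have cont: "continuous_on UNIV (\<lambda>t. coeff (P t) k)" for k
    by (intro continuous_at_imp_continuous_on ballI has_vector_derivative_continuous[OF P])
  interpret monic_family N P using degs(1,2) cont by unfold_locales
  have "labelled a b" using ab simple by (intro labelled) (auto simp: simple_roots_def)
  then obtain z where z': "\<forall>n\<in>{1..N}. continuous_on {a..b} (z n)"
    "\<forall>t\<in>{a..b}. inj_on (\<lambda>n. z n t) {1..N} \<and> P t = node_poly {1..N} (\<lambda>n. z n t)"
    unfolding labelled_def by (elim exE conjE)
  define S where "S = {a<..<b}"
  have S: "open S" "S \<subseteq> {a..b}" by (auto simp: S_def)
  have zc: "continuous_on S (z n)" if "n \<in> {1..N}" for n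
    using z'(1) that S(2) continuous_on_subset by blast
  note zS = bspec[OF z'(2) subsetD[OF S(2)]]
  note inj = conjunct1[OF zS] and Pz = conjunct2[OF zS]
  \<comment> \<open>Implicit differentiation at a simple zero. As a quotient of differentiable
    functions of time, \<open>v\<close> can be differentiated again.\<close>
  define v where "v n t = - poly (P1 t) (z n t) / poly (pderiv (P t)) (z n t)" for n t
  define acc where "acc n t = vector_derivative (v n) (at t)" for n t
  have z1: "(z n has_vector_derivative v n t) (at t)" if "n \<in> {1..N}" "t \<in> S" for n t
    unfolding v_def
    by (rule root_has_vector_derivative[OF zc S(1) that(2) inj[OF that(2)] that(1) Pz degs(1) P degs(3)])
  have v1: "(v n has_vector_derivative acc n t) (at t)" if nt: "n \<in> {1..N}" "t \<in> S" for n t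
  proof -
    have zd: "z n differentiable (at t)" using z1[OF that] by (rule differentiableI_vector)
    have "(\<lambda>s. poly (P1 s) (z n s)) differentiable (at t)"
      using P1 by (intro differentiable_poly_coeffs[of _ N] degs zd) (auto intro: differentiableI_vector)
    moreover have "(\<lambda>s. poly (pderiv (P s)) (z n s)) differentiable (at t)"
    proof (rule differentiable_poly_coeffs[of _ N, OF _ _ zd])
      show "degree (pderiv (P s)) \<le> N" for s by (simp add: degree_pderiv degs)
      show "(\<lambda>s. coeff (pderiv (P s)) k) differentiable (at t)" for k
        unfolding coeff_pderiv using P by (intro differentiable_mult differentiable_const) (rule differentiableI_vector)
    qed
    moreover have "poly (pderiv (P t)) (z n t) \<noteq> 0"
      using inj[OF nt(2)] Pz[OF nt(2)] nt(1)
      by (intro simple_roots_no_common_root[of N]) (auto simp: simple_roots_def node_poly_roots)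
    ultimately have "v n differentiable (at t)"
      unfolding v_def[abs_def] by (intro differentiable_divide differentiable_minus)
    then show ?thesis unfolding acc_def by (simp add: vector_derivative_works)
  qed
  have P1z: "P1 t = node_poly1 {1..N} (\<lambda>n. z n t) (\<lambda>n. v n t)" if t: "t \<in> S" for t
  proof (rule poly_eqI)
    fix k
    have "((\<lambda>s. coeff (P s) k) has_vector_derivative coeff (node_poly1 {1..N} (\<lambda>n. z n t) (\<lambda>n. v n t)) k) (at t)"
      by (rule has_vector_derivative_transform_within_open[OF node_poly_deriv S(1) t])
        (use z1 t Pz in auto)
    then show "coeff (P1 t) k = coeff (node_poly1 {1..N} (\<lambda>n. z n t) (\<lambda>n. v n t)) k"
      by (rule vector_derivative_unique_at[OF P])
  qed
  have P2z: "P2 t = node_poly2 {1..N} (\<lambda>n. z n t) (\<lambda>n. v n t) (\<lambda>n. acc n t)" if t: "t \<in> S" for t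
  proof (rule poly_eqI)
    fix k
    have "((\<lambda>s. coeff (P1 s) k) has_vector_derivative
        coeff (node_poly2 {1..N} (\<lambda>n. z n t) (\<lambda>n. v n t) (\<lambda>n. acc n t)) k) (at t)"
      by (rule has_vector_derivative_transform_within_open[OF node_poly1_deriv S(1) t])
        (use z1 v1 t P1z in auto)
    then show "coeff (P2 t) k = coeff (node_poly2 {1..N} (\<lambda>n. z n t) (\<lambda>n. v n t) (\<lambda>n. acc n t)) k"
      by (rule vector_derivative_unique_at[OF P1])
  qed
  have "acc n t = nbody_accel N K (\<lambda>l. z l t) (\<lambda>l. v l t) n" if "n \<in> {1..N}" "t \<in> S" for n t
    using nbody_iff_lin_eq[OF N inj[OF that(2)], of "\<lambda>n. acc n t" K "\<lambda>n. v n t"] lin that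
    unfolding Pz[OF that(2), symmetric] P1z[OF that(2), symmetric] P2z[OF that(2), symmetric] by blast
  then have "nbody_solution_on N K S z"
    unfolding nbody_solution_on_def using z1 v1 inj by (intro exI[of _ v]) auto
  then show ?thesis
    using Pz unfolding S_def config_poly_node_poly by force
qed

text \<open>Inverse of \<open>tri_u\<close>. The argument \<open>c\<close> is the coefficient of
  degree N: 1 for the polynomial itself, 0 for its time derivatives.\<close>

definition tri_poly :: "nat \<Rightarrow> couplings \<Rightarrow> complex \<Rightarrow> (nat \<Rightarrow> complex) \<Rightarrow> complex poly" where
  "tri_poly N K c u = monom c N + (\<Sum>k<N. monom (u (if case2 K then k + 1 else N - k)) k)"

lemma coeff_tri_poly:
  "coeff (tri_poly N K c u) k =
     (if k < N then u (if case2 K then k + 1 else N - k) else if k = N then c else 0)"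
proof -
  have "coeff (tri_poly N K c u) k = (if k = N then c else 0)
      + (\<Sum>j<N. if k = j then u (if case2 K then j + 1 else N - j) else 0)"
    by (simp add: tri_poly_def coeff_sum eq_commute)
  then show ?thesis by (simp add: sum.delta)
qed

lemma degree_tri_poly: "degree (tri_poly N K c u) \<le> N"
  by (rule degree_le) (simp add: coeff_tri_poly)

lemma monic_tri_poly: "degree (tri_poly N K 1 u) = N" "lead_coeff (tri_poly N K 1 u) = 1"
proof -
  show "degree (tri_poly N K 1 u) = N"
    by (rule antisym[OF degree_tri_poly le_degree]) (simp add: coeff_tri_poly)
  then show "lead_coeff (tri_poly N K 1 u) = 1" by (simp add: coeff_tri_poly)
qed

lemma tri_u_tri_poly:
  "i \<in> {1..N} \<Longrightarrow> tri_u N K (coeff (tri_poly N K c u)) i = u i"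
  "tri_u N K (coeff (tri_poly N K c u)) 0 = (if case2 K then 0 else c)"
  by (auto simp: tri_u_def coeff_tri_poly)

lemma tri_poly_tri_u:
  assumes "degree p = N" "lead_coeff p = 1"
  shows "tri_poly N K 1 (tri_u N K (coeff p)) = p"
  by (rule poly_eqI) (use assms in \<open>auto simp: coeff_tri_poly tri_u_def coeff_eq_0\<close>)

text \<open>The system being autonomous, an entire solution can be translated by an imaginary time to a
  line on which its zeros never collide, where it yields a motion of the particles.\<close>

lemma tri_sol_periodic:
  assumes N: "N \<ge> 1" and K: "case1 K \<or> case2 K" and iso: "isochronous N K T"
  defines "l \<equiv> \<lambda>s i. eigval N K s (tri_mode N K i)"
  assumes sol: "\<And>i. i \<in> {1..N} \<Longrightarrow> tri_sol (l 1) (l (-1)) (tri_A N K) (tri_B N K) u u1 u2 i"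
    and u0: "\<And>s. u 0 s = (if case2 K then 0 else 1)" "\<And>s. u1 0 s = 0"
    and discr: "discr N (tri_poly N K 1 (\<lambda>i. u i 0)) \<noteq> 0"
    and i: "i \<in> {1..N}"
  shows "u i (s + of_real T) = u i s"
proof -
  have T: "T > 0" using iso by (simp add: isochronous_def)
  have d: "(u i has_field_derivative u1 i s) (at s)" "(u1 i has_field_derivative u2 i s) (at s)"
    if "i \<in> {1..N}" for i s
    using sol[OF that] by (auto simp: tri_sol_def)
  have idx: "(if case2 K then k + 1 else N - k) \<in> {1..N}" if "k < N" for k
    using that by auto
  have hol: "(\<lambda>s. coeff (tri_poly N K 1 (\<lambda>i. u i s)) k) holomorphic_on UNIV" for k
  proof (cases "k < N")
    case True
    then show ?thesis
      using tri_sol_holomorphic(1)[OF sol[OF idx[OF True]]] by (simp add: coeff_tri_poly)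
  qed (simp add: coeff_tri_poly holomorphic_on_const)
  obtain \<tau> where \<tau>: "\<And>x::real. simple_roots N (tri_poly N K 1 (\<lambda>i. u i (of_real x + \<i> * of_real \<tau>)))"
    using exists_line_simple_roots[of "\<lambda>s. tri_poly N K 1 (\<lambda>i. u i s)" N, OF monic_tri_poly N hol discr] by blast
  define \<theta> where "\<theta> t = of_real t + \<i> * of_real \<tau>" for t
  define P P1 P2 where "P t = tri_poly N K 1 (\<lambda>i. u i (\<theta> t))" and "P1 t = tri_poly N K 0 (\<lambda>i. u1 i (\<theta> t))"
    and "P2 t = tri_poly N K 0 (\<lambda>i. u2 i (\<theta> t))" for t
  have comp: "((\<lambda>t. f (\<theta> t)) has_vector_derivative f') (at t)" if "(f has_field_derivative f') (at (\<theta> t))" for f f' t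
  proof -
    have "((\<lambda>s. f (s + \<i> * of_real \<tau>)) has_field_derivative f') (at (of_real t))"
      using that unfolding \<theta>_def by (simp add: DERIV_shift)
    then show ?thesis unfolding \<theta>_def by (rule has_vector_derivative_real_field)
  qed
  have P': "((\<lambda>s. coeff (P s) k) has_vector_derivative coeff (P1 t) k) (at t)"
    "((\<lambda>s. coeff (P1 s) k) has_vector_derivative coeff (P2 t) k) (at t)" for t k
  proof -
    have "((\<lambda>s. coeff (tri_poly N K c (\<lambda>i. f i (\<theta> s))) k) has_vector_derivative
        coeff (tri_poly N K 0 (\<lambda>i. f' i (\<theta> t))) k) (at t)"
      if "\<And>i. i \<in> {1..N} \<Longrightarrow> (f i has_field_derivative f' i (\<theta> t)) (at (\<theta> t))" for c and f f' :: "nat \<Rightarrow> complex \<Rightarrow> complex"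
    proof (cases "k < N")
      case True
      then show ?thesis using comp[OF that[OF idx[OF True]]] by (simp add: coeff_tri_poly)
    qed (simp add: coeff_tri_poly)
    then show "((\<lambda>s. coeff (P s) k) has_vector_derivative coeff (P1 t) k) (at t)"
      "((\<lambda>s. coeff (P1 s) k) has_vector_derivative coeff (P2 t) k) (at t)"
      unfolding P_def P1_def P2_def using d by blast+
  qed
  have lin: "\<forall>k<N. lin_eq N K (coeff (P t)) (coeff (P1 t)) (coeff (P2 t)) k" for t
  proof (subst lin_eq_all_iff_tri_eq_all[OF K])
    show "coeff (P t) j = 0" if "j > N" for j using that by (simp add: P_def coeff_tri_poly)
    show "coeff (P1 t) j = 0" if "j \<ge> N" for j using that by (simp add: P1_def coeff_tri_poly)
    show "\<forall>i\<in>{1..N}. tri_eq (\<lambda>i. eigval N K 1 (tri_mode N K i)) (\<lambda>i. eigval N K (-1) (tri_mode N K i))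
        (tri_A N K) (tri_B N K) (tri_u N K (coeff (P t))) (tri_u N K (coeff (P1 t))) (tri_u N K (coeff (P2 t))) i"
    proof
      fix i assume i: "i \<in> {1..N}"
      have low: "tri_u N K (coeff (P t)) j = u j (\<theta> t)" "tri_u N K (coeff (P1 t)) j = u1 j (\<theta> t)"
        if "j \<le> i" for j
        using that i u0 tri_u_tri_poly(1)[of j N K] tri_u_tri_poly(2)[of N K]
        unfolding P_def P1_def by (cases "j = 0"; simp)+
      have top: "tri_u N K (coeff (P2 t)) i = u2 i (\<theta> t)"
        using tri_u_tri_poly(1)[OF i] by (simp add: P2_def)
      have "(\<Sum>j<i. tri_A N K i j * tri_u N K (coeff (P t)) j + tri_B N K i j * tri_u N K (coeff (P1 t)) j)
          = (\<Sum>j<i. tri_A N K i j * u j (\<theta> t) + tri_B N K i j * u1 j (\<theta> t))"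
        by (intro sum.cong) (auto simp: low)
      then show "tri_eq (\<lambda>i. eigval N K 1 (tri_mode N K i)) (\<lambda>i. eigval N K (-1) (tri_mode N K i))
        (tri_A N K) (tri_B N K) (tri_u N K (coeff (P t))) (tri_u N K (coeff (P1 t))) (tri_u N K (coeff (P2 t))) i"
        using sol[OF i] unfolding tri_sol_def tri_eq_def l_def by (simp add: low top)
    qed
  qed
  \<comment> \<open>The margin of 1 on both sides admits \<open>t\<close> and \<open>t + T\<close>
    for all \<open>t\<close> between -1 and 1, enough points for the identity theorem.\<close>
  have "\<exists>z. nbody_solution_on N K {-1<..<T+1} z \<and> (\<forall>t\<in>{-1<..<T+1}. config_poly N z t = P t)"
  proof (rule nbody_solution_from_coefficients[OF N, where P = P and ?P1.0 = P1 and ?P2.0 = P2])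
    show "degree (P t) = N" "lead_coeff (P t) = 1" for t
      unfolding P_def by (rule monic_tri_poly)+
    show "degree (P1 t) \<le> N" for t unfolding P1_def by (rule degree_tri_poly)
    show "simple_roots N (P t)" for t unfolding P_def \<theta>_def by (rule \<tau>)
  qed (use T P' lin in auto)
  then obtain z where z: "nbody_solution_on N K {-1<..<T+1} z" "\<And>t. t \<in> {-1<..<T+1} \<Longrightarrow> config_poly N z t = P t"
    by blast
  have PT: "P (t + T) = P t" if "t \<in> {-1<..<1}" for t
  proof -
    have "t \<in> {-1<..<T+1}" "t + T \<in> {-1<..<T+1}" using that T by auto
    moreover have "config_poly N z (t + T) = config_poly N z t"
      using iso z(1) calculation unfolding isochronous_def
      by (metis is_interval_oo open_greaterThanLessThan)
    ultimately show ?thesis using z(2) by simp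
  qed
  define f where "f s = u i (s + of_real T) - u i s" for s
  have "f s = 0"
  proof (rule analytic_continuation[where f = f and S = UNIV and U = "\<theta> ` {-1<..<1}" and \<xi> = "\<theta> 0"])
    show "f holomorphic_on UNIV"
      unfolding f_def
      by (intro holomorphic_on_diff tri_sol_holomorphic(1)[OF sol[OF i]]
          holomorphic_on_compose_gen[of "\<lambda>s. s + of_real T" UNIV "u i" UNIV, unfolded o_def] holomorphic_intros) auto
    show "\<theta> 0 islimpt \<theta> ` {-1<..<1}"
      unfolding islimpt_approachable
    proof (intro allI impI)
      fix e :: real assume e: "e > 0"
      define t where "t = min (e / 2) (1 / 2)"
      have t: "t \<in> {-1<..<1}" "0 < t" "t < e" using e by (auto simp: t_def)
      then show "\<exists>x'\<in>\<theta> ` {-1<..<1}. x' \<noteq> \<theta> 0 \<and> dist x' (\<theta> 0) < e"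
        by (intro bexI[of _ "\<theta> t"]) (auto simp: \<theta>_def dist_norm)
    qed
    show "f x = 0" if "x \<in> \<theta> ` {-1<..<1}" for x
    proof -
      from that obtain t where t: "x = \<theta> t" "t \<in> {-1<..<1}" by (rule imageE)
      have "tri_u N K (coeff (P (t + T))) i = tri_u N K (coeff (P t)) i" using PT[OF t(2)] by simp
      then have "u i (\<theta> (t + T)) = u i (\<theta> t)" using tri_u_tri_poly(1)[OF i] by (simp add: P_def)
      moreover have "\<theta> (t + T) = x + of_real T" by (simp add: t(1) \<theta>_def)
      ultimately show ?thesis by (simp add: f_def t(1))
    qed
  qed auto
  then show ?thesis by (simp add: f_def)
qed

lemma isochronous_imp_exp_eigval:
  assumes N: "N \<ge> 1" and K: "case1 K \<or> case2 K" and iso: "isochronous N K T"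
    and m: "m \<in> {1..N}" and s: "s \<in> {1, -1}"
  shows "exp (eigval N K s m * of_real T) = 1"
proof -
  define l where "l s i = eigval N K s (tri_mode N K i)" for s i
  define A B where "A = tri_A N K" and "B = tri_B N K"
  \<comment> \<open>\<open>tri_mode\<close> is an involution on the labels, so unknown
    \<open>i\<close> carries the eigenvalues of mode \<open>m\<close>.\<close>
  define i where "i = tri_mode N K m"
  have i: "i \<in> {1..N}" "tri_mode N K i = m" using m by (auto simp: i_def tri_mode_def)
  define p :: "complex poly" where "p = monom 1 N - 1"
  have p: "degree p = N" "lead_coeff p = 1" "discr N p \<noteq> 0"
  proof -
    show "discr N p \<noteq> 0" unfolding p_def by (rule discr_unity[OF N])
    have c: "coeff p i = (if i = N then 1 else 0) - (if i = 0 then 1 else 0)" for i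
      by (auto simp: p_def)
    show "degree p = N"
      by (rule antisym[OF degree_le le_degree]) (use N in \<open>auto simp: c\<close>)
    then show "lead_coeff p = 1" using N by (simp add: c)
  qed
  define \<kappa> :: complex where "\<kappa> = (if case2 K then 0 else 1)"
  define c where "c = tri_u N K (coeff p)"
  have "\<exists>w w1 w2. (\<forall>j<1. w j = (\<lambda>_. \<kappa>) \<and> w1 j = (\<lambda>_. 0) \<and> w2 j = (\<lambda>_. 0)) \<and>
    (\<forall>j\<in>{1..<1+N}. w j 0 = c j \<and> w1 j 0 = 0 \<and> tri_sol (l 1) (l (-1)) A B w w1 w2 j)"
    by (rule tri_sol_extend) auto
  then obtain w w1 w2 where w': "\<forall>j<1. w j = (\<lambda>_. \<kappa>) \<and> w1 j = (\<lambda>_. 0) \<and> w2 j = (\<lambda>_. 0)"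
    "\<forall>j\<in>{1..<1+N}. w j 0 = c j \<and> w1 j 0 = 0 \<and> tri_sol (l 1) (l (-1)) A B w w1 w2 j"
    by (elim exE conjE)
  have w0: "w 0 = (\<lambda>_. \<kappa>)" "w1 0 = (\<lambda>_. 0)" using w'(1) by auto
  have w: "w j 0 = c j \<and> w1 j 0 = 0 \<and> tri_sol (l 1) (l (-1)) A B w w1 w2 j" if "j \<in> {1..N}" for j
    by (rule bspec[OF w'(2)]) (use that in auto)
  have hol: "w j holomorphic_on UNIV" "w1 j holomorphic_on UNIV" if "j < i" for j
    using w0 tri_sol_holomorphic[of "l 1" "l (-1)" A B w w1 w2 j] w[of j] that i(1)
    by (cases "j = 0"; auto)+
  \<comment> \<open>The second solution keeps the unknowns below \<open>i\<close> and all initial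
    values, and raises the initial velocity of unknown \<open>i\<close> alone by 1; later unknowns
    react to this but keep their initial data.\<close>
  have "\<exists>x x1 x2. (\<forall>j<i. x j = w j \<and> x1 j = w1 j \<and> x2 j = w2 j) \<and>
    (\<forall>j\<in>{i..<i+(N+1-i)}. x j 0 = c j \<and> x1 j 0 = (if j = i then 1 else 0) \<and> tri_sol (l 1) (l (-1)) A B x x1 x2 j)"
    by (rule tri_sol_extend) (use hol in auto)
  then obtain x x1 x2 where x': "\<forall>j<i. x j = w j \<and> x1 j = w1 j \<and> x2 j = w2 j"
    "\<forall>j\<in>{i..<i+(N+1-i)}. x j 0 = c j \<and> x1 j 0 = (if j = i then 1 else 0) \<and> tri_sol (l 1) (l (-1)) A B x x1 x2 j"
    by (elim exE conjE)
  have x0: "x j = w j" "x1 j = w1 j" "x2 j = w2 j" if "j < i" for j using x'(1) that by auto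
  have x: "x j 0 = c j \<and> x1 j 0 = (if j = i then 1 else 0) \<and> tri_sol (l 1) (l (-1)) A B x x1 x2 j"
    if "j \<in> {i..N}" for j
    by (rule bspec[OF x'(2)]) (use that i(1) in auto)
  have xsol: "tri_sol (l 1) (l (-1)) A B x x1 x2 j \<and> x j 0 = c j" if "j \<in> {1..N}" for j
  proof (cases "j < i")
    case True
    then have "tri_sol (l 1) (l (-1)) A B x x1 x2 j \<longleftrightarrow> tri_sol (l 1) (l (-1)) A B w w1 w2 j"
      by (intro tri_sol_cong) (auto simp: x0)
    then show ?thesis using w[OF that] x0 True by simp
  qed (use x that in auto)
  have discr: "discr N (tri_poly N K 1 (\<lambda>i. f i 0)) \<noteq> 0" if "\<And>j. j \<in> {1..N} \<Longrightarrow> f j 0 = c j" for f :: "nat \<Rightarrow> complex \<Rightarrow> complex"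
  proof -
    have "tri_poly N K 1 (\<lambda>i. f i 0) = tri_poly N K 1 c"
      by (rule poly_eqI) (use that in \<open>auto simp: coeff_tri_poly\<close>)
    also have "\<dots> = p" unfolding c_def by (rule tri_poly_tri_u[OF p(1,2)])
    finally show ?thesis using p(3) by simp
  qed
  have 0: "0 < i" using i(1) by simp
  have per: "f i (s + of_real T) = f i s"
    if f: "\<And>j. j \<in> {1..N} \<Longrightarrow> tri_sol (l 1) (l (-1)) A B f f1 f2 j \<and> f j 0 = c j"
      and f0: "f 0 = (\<lambda>_. \<kappa>)" "f1 0 = (\<lambda>_. 0)" for f f1 f2 s
  proof (rule tri_sol_periodic[OF N K iso, where u = f and ?u1.0 = f1 and ?u2.0 = f2])
    show "tri_sol (\<lambda>i. eigval N K 1 (tri_mode N K i)) (\<lambda>i. eigval N K (-1) (tri_mode N K i))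
        (tri_A N K) (tri_B N K) f f1 f2 j" if "j \<in> {1..N}" for j
      using f[OF that] unfolding l_def[abs_def] A_def B_def by simp
    show "discr N (tri_poly N K 1 (\<lambda>i. f i 0)) \<noteq> 0" by (rule discr) (use f in simp)
  qed (use f0 i(1) in \<open>auto simp: \<kappa>_def\<close>)
  have pw: "w i (s + of_real T) = w i s" for s
    by (rule per[of w w1 w2]) (use w w0 in simp_all)
  have px: "x i (s + of_real T) = x i s" for s
    by (rule per[of x x1 x2]) (use xsol x0(1,2)[OF 0] w0 in simp_all)
  have "exp (l 1 i * of_real T) = 1 \<and> exp (l (-1) i * of_real T) = 1"
    using exp_eq_1_if_tri_sols_periodic[of i "l 1" "l (-1)" A B w w1 w2 x x1 x2 "of_real T"]
      w[OF i(1)] xsol[OF i(1)] x[of i] x0 pw px i(1) by auto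
  then show ?thesis using s by (auto simp: l_def i(2))
qed

section \<open>From periodic solutions to rational frequencies\<close>

lemma isochronous_imp_rational_eigval:
  assumes N: "N \<ge> 1" and K: "case1 K \<or> case2 K" and \<omega>: "\<omega> > 0" and q: "q > 0"
    and iso: "isochronous N K (2 * pi * real q / \<omega>)" and m: "m \<in> {1..N}"
  shows "rational_eigval N K \<omega> m"
  unfolding rational_eigval_def
proof
  fix s :: int assume s: "s \<in> {1, -1}"
  let ?T = "2 * pi * real q / \<omega>"
  have "exp (eigval N K s m * of_real ?T) = 1"
    by (rule isochronous_imp_exp_eigval[OF N K iso m s])
  then obtain n :: int where n: "Re (eigval N K s m * of_real ?T) = 0" "Im (eigval N K s m * of_real ?T) = of_int (2 * n) * pi"
    unfolding exp_eq_1 by blast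
  have T: "?T \<noteq> 0" using \<omega> q by simp
  have "Re (eigval N K s m) * ?T = 0" using n(1) by simp
  then have re: "Re (eigval N K s m) = 0" using T by simp
  have "Im (eigval N K s m) * ?T = of_int (2 * n) * pi" using n(2) by simp
  then have "Im (eigval N K s m) = of_int n / of_nat q * \<omega>"
    using \<omega> q by (simp add: field_simps)
  also have "of_int n / of_nat q = (of_rat (of_int n / of_nat q) :: real)"
    by (simp add: of_rat_divide)
  finally have "eigval N K s m = \<i> * of_rat (of_int n / of_nat q) * of_real \<omega>"
    using re by (simp add: complex_eq_iff of_rat_divide)
  then show "\<exists>r::rat. eigval N K s m = \<i> * of_rat r * of_real \<omega>" by blast
qed

section \<open>Quartics whose values are rational squares\<close>

text \<open>By the mean value theorem, applied to the first difference and then to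
  \<open>h'\<close>, a second difference is a value of \<open>h''\<close> further out.\<close>

lemma second_difference_tendsto_0:
  fixes h h' h'' :: "real \<Rightarrow> real"
  assumes h: "\<forall>\<^sub>F x in at_top. (h has_real_derivative h' x) (at x)"
    and h': "\<forall>\<^sub>F x in at_top. (h' has_real_derivative h'' x) (at x)"
    and lim: "(h'' \<longlongrightarrow> 0) at_top"
  shows "(\<lambda>n. h (real (n + 2)) - 2 * h (real (n + 1)) + h (real n)) \<longlonglongrightarrow> 0"
proof (rule LIMSEQ_I)
  fix e :: real assume "e > 0"
  then have "\<forall>\<^sub>F x in at_top. \<bar>h'' x\<bar> < e"
    using lim by (auto simp: tendsto_iff dist_real_def)
  with h h' have "\<forall>\<^sub>F x in at_top. (h has_real_derivative h' x) (at x) \<and>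
    (h' has_real_derivative h'' x) (at x) \<and> \<bar>h'' x\<bar> < e"
    by eventually_elim auto
  then obtain X where X: "\<And>x. x \<ge> X \<Longrightarrow> (h has_real_derivative h' x) (at x)"
    "\<And>x. x \<ge> X \<Longrightarrow> (h' has_real_derivative h'' x) (at x)" "\<And>x. x \<ge> X \<Longrightarrow> \<bar>h'' x\<bar> < e"
    by (auto simp: eventually_at_top_linorder)
  have bound: "\<bar>h (x + 2) - 2 * h (x + 1) + h x\<bar> < e" if x: "x \<ge> X" for x
  proof -
    have "((\<lambda>y. h (y + 1) - h y) has_real_derivative h' (y + 1) - h' y) (at y)" if "y \<ge> x" for y
      using X(1)[of "y + 1"] X(1)[of y] that x by (intro DERIV_diff) (auto simp: DERIV_shift)
    then obtain y where y: "y > x" "(h (x + 1 + 1) - h (x + 1)) - (h (x + 1) - h x) = (x + 1 - x) * (h' (y + 1) - h' y)"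
      using MVT2[of x "x + 1" "\<lambda>y. h (y + 1) - h y" "\<lambda>y. h' (y + 1) - h' y"] by auto
    obtain z where z: "z > y" "h' (y + 1) - h' y = (y + 1 - y) * h'' z"
      using MVT2[of y "y + 1" h' h''] X(2) y(1) x by force
    have "h (x + 2) - 2 * h (x + 1) + h x = h'' z"
      using y(2) z(2) by (simp add: algebra_simps)
    then show ?thesis using X(3)[of z] x y(1) z(1) by simp
  qed
  show "\<exists>n0. \<forall>n\<ge>n0. norm (h (real (n + 2)) - 2 * h (real (n + 1)) + h (real n) - 0) < e"
  proof (intro exI[of _ "nat \<lceil>X\<rceil>"] allI impI)
    fix n assume "n \<ge> nat \<lceil>X\<rceil>"
    then have "real n \<ge> X" by linarith
    then show "norm (h (real (n + 2)) - 2 * h (real (n + 1)) + h (real n) - 0) < e"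
      using bound[of "real n"] by (simp add: algebra_simps)
  qed
qed

lemma second_difference_sqrt_tendsto_0:
  fixes p p' p'' :: "real \<Rightarrow> real"
  assumes "filterlim p at_top at_top"
    and p: "\<And>x. (p has_real_derivative p' x) (at x)" "\<And>x. (p' has_real_derivative p'' x) (at x)"
    and lim: "((\<lambda>x. p'' x / (2 * sqrt (p x))) \<longlongrightarrow> 0) at_top"
      "((\<lambda>x. p' x ^ 2 / (4 * (p x * sqrt (p x)))) \<longlongrightarrow> 0) at_top"
  shows "(\<lambda>n. sqrt (p (real (n + 2))) - 2 * sqrt (p (real (n + 1))) + sqrt (p (real n))) \<longlonglongrightarrow> 0"
proof (rule second_difference_tendsto_0[where h = "\<lambda>x. sqrt (p x)",
      OF _ _ tendsto_diff[OF lim, unfolded diff_0_right]])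
  have pos: "\<forall>\<^sub>F x in at_top. p x > 0"
    using assms(1) by (simp add: filterlim_at_top_dense)
  have sq: "((\<lambda>x. sqrt (p x)) has_real_derivative p' x / (2 * sqrt (p x))) (at x)" if "p x > 0" for x
  proof (rule DERIV_cong[OF DERIV_chain2[OF DERIV_real_sqrt[OF that] p(1)]])
    show "inverse (sqrt (p x)) / 2 * p' x = p' x / (2 * sqrt (p x))"
      by (simp add: inverse_eq_divide)
  qed
  show "\<forall>\<^sub>F x in at_top. ((\<lambda>x. sqrt (p x)) has_real_derivative p' x / (2 * sqrt (p x))) (at x)"
    using pos by eventually_elim (rule sq)
  show "\<forall>\<^sub>F x in at_top. ((\<lambda>x. p' x / (2 * sqrt (p x))) has_real_derivative
      p'' x / (2 * sqrt (p x)) - p' x ^ 2 / (4 * (p x * sqrt (p x)))) (at x)"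
    using pos
  proof eventually_elim
    case (elim x)
    define r where "r = sqrt (p x)"
    have r: "r > 0" "p x = r * r" using elim by (auto simp: r_def)
    have "((\<lambda>x. p' x / (2 * sqrt (p x))) has_real_derivative
        (p'' x * (2 * r) - p' x * (2 * (p' x / (2 * r)))) / ((2 * r) * (2 * r))) (at x)"
      unfolding r_def
      by (rule DERIV_divide[OF p(2) DERIV_cmult[OF sq[OF elim], of 2]]) (use elim in simp)
    also have "(p'' x * (2 * r) - p' x * (2 * (p' x / (2 * r)))) / ((2 * r) * (2 * r))
        = p'' x / (2 * r) - p' x ^ 2 / (4 * (p x * r))"
      unfolding r(2) using r(1) by (simp add: field_simps power2_eq_square)
    finally show ?case unfolding r_def .
  qed
qed

text \<open>The second difference of an integer-valued square root of a quartic converges, hence is eventually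
  constant, so that the root is eventually a quadratic polynomial.\<close>

lemma second_difference_sqrt_quartic_converges:
  fixes g c3 c2 c1 c0 :: real
  assumes pos: "\<And>n. (f n)^2 = g^2 * real n ^ 4 + c3 * real n ^ 3 + c2 * real n ^ 2 + c1 * real n + c0"
    and nn: "\<And>n. f n \<ge> 0"
  shows "\<exists>L. (\<lambda>n. f (n + 2) - 2 * f (n + 1) + f n) \<longlonglongrightarrow> L"
proof -
  define h where "h x = sqrt (g^2 * x ^ 4 + c3 * x ^ 3 + c2 * x ^ 2 + c1 * x + c0)" for x :: real
  have f: "f n = h (real n)" for n
    unfolding h_def pos[symmetric] using nn by simp
  have sq: "g^2 * real n ^ 4 + c3 * real n ^ 3 + c2 * real n ^ 2 + c1 * real n + c0 \<ge> 0" for n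
    unfolding pos[symmetric] by simp
  have neg: False if "filterlim (\<lambda>n. g^2 * real n ^ 4 + c3 * real n ^ 3 + c2 * real n ^ 2 + c1 * real n + c0) at_bot sequentially"
  proof -
    have "\<forall>\<^sub>F n in sequentially. g^2 * real n ^ 4 + c3 * real n ^ 3 + c2 * real n ^ 2 + c1 * real n + c0 \<le> -1"
      using that by (simp add: filterlim_at_bot)
    then obtain n where "g^2 * real n ^ 4 + c3 * real n ^ 3 + c2 * real n ^ 2 + c1 * real n + c0 \<le> -1"
      by (auto simp: eventually_sequentially)
    then show False using sq[of n] by simp
  qed
  \<comment> \<open>Without quartic term the root grows at most like x to the power 3/2 and its
    second differences tend to 0; a negative leading coefficient contradicts nonnegativity.\<close>
  consider "g \<noteq> 0" | "g = 0" "c3 > 0" | "g = 0" "c3 < 0" | "g = 0" "c3 = 0" "c2 > 0" | "g = 0" "c3 = 0" "c2 < 0"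
    | "g = 0" "c3 = 0" "c2 = 0" "c1 > 0" | "g = 0" "c3 = 0" "c2 = 0" "c1 < 0" | "g = 0" "c3 = 0" "c2 = 0" "c1 = 0"
    by linarith
  then show ?thesis
  proof cases
    case 1
    \<comment> \<open>Completing the square: \<open>q\<close> is the polynomial part of the root at
      infinity, and the remainder \<open>d\<close> has degree at most 1, so \<open>h - q\<close> is
      bounded by \<open>d / q\<close> and tends to 0.\<close>
    define G \<beta> \<alpha> where "G = \<bar>g\<bar>" and "\<beta> = c3 / (2 * G)" and "\<alpha> = (c2 - \<beta>^2) / (2 * G)"
    have G: "G > 0" "g^2 = G^2" using 1 by (auto simp: G_def)
    define q where "q x = G * x ^ 2 + \<beta> * x + \<alpha>" for x
    define d where "d x = (c1 - 2 * \<alpha> * \<beta>) * x + (c0 - \<alpha>^2)" for x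
    have hq: "h x = sqrt (q x ^ 2 + d x)" for x
    proof -
      have "c3 = 2 * G * \<beta>" "c2 = \<beta>^2 + 2 * G * \<alpha>" using G(1) by (auto simp: \<beta>_def \<alpha>_def)
      then show ?thesis
        unfolding h_def G(2) q_def d_def
        by (simp add: algebra_simps power2_eq_square power3_eq_cube power4_eq_xxxx)
    qed
    have pos': "q (real n) ^ 2 + d (real n) \<ge> 0" for n
      using sq[of n] hq[of "real n"] unfolding h_def by (simp add: real_sqrt_eq_iff)
    have bound: "\<bar>h (real n) - q (real n)\<bar> \<le> \<bar>d (real n) / q (real n)\<bar>" if "q (real n) > 0" for n
    proof -
      have h0: "h (real n) \<ge> 0" unfolding f[symmetric] by (rule nn)
      have "(h (real n) - q (real n)) * (h (real n) + q (real n)) = d (real n)"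
        using pos'[of n] by (simp add: hq algebra_simps power2_eq_square[symmetric])
      then have "\<bar>h (real n) - q (real n)\<bar> * (h (real n) + q (real n)) = \<bar>d (real n)\<bar>"
        using h0 that by (metis abs_mult abs_of_pos add_nonneg_pos)
      moreover have "\<bar>h (real n) - q (real n)\<bar> * q (real n) \<le> \<bar>h (real n) - q (real n)\<bar> * (h (real n) + q (real n))"
        using h0 by (intro mult_left_mono) auto
      ultimately show ?thesis using that by (simp add: abs_divide pos_le_divide_eq)
    qed
    have "filterlim (\<lambda>n. q (real n)) at_top sequentially"
      unfolding q_def using G(1) by real_asymp
    then have "\<forall>\<^sub>F n in sequentially. q (real n) > 0" by (simp add: filterlim_at_top_dense)
    then have "\<forall>\<^sub>F n in sequentially. norm (h (real n) - q (real n)) \<le> \<bar>d (real n) / q (real n)\<bar>"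
      by eventually_elim (use bound in simp)
    moreover have "(\<lambda>n. \<bar>d (real n) / q (real n)\<bar>) \<longlonglongrightarrow> 0"
    proof (rule tendsto_rabs_zero)
      show "(\<lambda>n. d (real n) / q (real n)) \<longlonglongrightarrow> 0"
        unfolding d_def q_def using G(1) by real_asymp
    qed
    ultimately have e: "(\<lambda>n. h (real n) - q (real n)) \<longlonglongrightarrow> 0"
      by (rule Lim_null_comparison)
    have "(\<lambda>n. (h (real (n + 2)) - q (real (n + 2))) - 2 * (h (real (n + 1)) - q (real (n + 1)))
        + (h (real n) - q (real n)) + 2 * G) \<longlonglongrightarrow> 0 - 2 * 0 + 0 + 2 * G"
      by (intro tendsto_intros LIMSEQ_ignore_initial_segment[OF e] e)
    then have "(\<lambda>n. h (real (n + 2)) - 2 * h (real (n + 1)) + h (real n)) \<longlonglongrightarrow> 2 * G"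
      by (simp add: q_def algebra_simps power2_eq_square)
    then show ?thesis unfolding f by blast
  next
    case 2
    have "(\<lambda>n. h (real (n + 2)) - 2 * h (real (n + 1)) + h (real n)) \<longlonglongrightarrow> 0"
      unfolding h_def 2(1) power_zero_numeral mult_zero_left add_0_left
      by (rule second_difference_sqrt_tendsto_0[where p = "\<lambda>x. c3 * x ^ 3 + c2 * x ^ 2 + c1 * x + c0"
            and p' = "\<lambda>x. 3 * c3 * x ^ 2 + 2 * c2 * x + c1" and p'' = "\<lambda>x. 6 * c3 * x + 2 * c2"])
        (use 2(2) in \<open>real_asymp | auto intro!: derivative_eq_intros\<close>)+
    then show ?thesis unfolding f by blast
  next
    case 3
    have "filterlim (\<lambda>n. g^2 * real n ^ 4 + c3 * real n ^ 3 + c2 * real n ^ 2 + c1 * real n + c0) at_bot sequentially"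
      unfolding 3(1) using 3(2) by real_asymp
    then show ?thesis using neg by blast
  next
    case 4
    have "(\<lambda>n. h (real (n + 2)) - 2 * h (real (n + 1)) + h (real n)) \<longlonglongrightarrow> 0"
      unfolding h_def 4(1,2) power_zero_numeral mult_zero_left add_0_left
      by (rule second_difference_sqrt_tendsto_0[where p = "\<lambda>x. c2 * x ^ 2 + c1 * x + c0"
            and p' = "\<lambda>x. 2 * c2 * x + c1" and p'' = "\<lambda>x. 2 * c2"])
        (use 4(3) in \<open>real_asymp | auto intro!: derivative_eq_intros\<close>)+
    then show ?thesis unfolding f by blast
  next
    case 5
    have "filterlim (\<lambda>n. g^2 * real n ^ 4 + c3 * real n ^ 3 + c2 * real n ^ 2 + c1 * real n + c0) at_bot sequentially"
      unfolding 5(1,2) using 5(3) by real_asymp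
    then show ?thesis using neg by blast
  next
    case 6
    have "(\<lambda>n. h (real (n + 2)) - 2 * h (real (n + 1)) + h (real n)) \<longlonglongrightarrow> 0"
      unfolding h_def 6(1-3) power_zero_numeral mult_zero_left add_0_left
      by (rule second_difference_sqrt_tendsto_0[where p = "\<lambda>x. c1 * x + c0"
            and p' = "\<lambda>x. c1" and p'' = "\<lambda>x. 0"])
        (use 6(4) in \<open>real_asymp | auto intro!: derivative_eq_intros\<close>)+
    then show ?thesis unfolding f by blast
  next
    case 7
    have "filterlim (\<lambda>n. g^2 * real n ^ 4 + c3 * real n ^ 3 + c2 * real n ^ 2 + c1 * real n + c0) at_bot sequentially"
      unfolding 7(1-3) using 7(4) by real_asymp
    then show ?thesis using neg by blast
  next
    case 8
    then have "(\<lambda>n. h (real (n + 2)) - 2 * h (real (n + 1)) + h (real n)) \<longlonglongrightarrow> 0"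
      unfolding h_def 8 by simp
    then show ?thesis unfolding f by blast
  qed
qed

lemma convergent_integer_sequence_eventually_constant:
  fixes f :: "nat \<Rightarrow> real"
  assumes "f \<longlonglongrightarrow> L" "\<And>n. f n \<in> \<int>"
  shows "\<exists>c n0. \<forall>n\<ge>n0. f n = c"
proof -
  have "\<forall>\<^sub>F n in sequentially. dist (f n) L < 1 / 2"
    using assms(1) by (rule tendstoD) simp
  then obtain n0 where n0: "\<And>n. n \<ge> n0 \<Longrightarrow> dist (f n) L < 1 / 2"
    by (auto simp: eventually_sequentially)
  have "f n = f n0" if "n \<ge> n0" for n
  proof -
    obtain a b where ab: "f n = of_int a" "f n0 = of_int b" using assms(2) by (metis Ints_cases)
    have "\<bar>f n - f n0\<bar> < 1"
      using n0[OF that] n0[of n0] unfolding dist_real_def by linarith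
    then have "\<bar>real_of_int (a - b)\<bar> < 1" by (simp add: ab)
    then show ?thesis by (simp add: ab)
  qed
  then show ?thesis by blast
qed

lemma eventually_constant_second_difference:
  fixes f :: "nat \<Rightarrow> real"
  assumes "\<And>n. n \<ge> n0 \<Longrightarrow> f (n + 2) - 2 * f (n + 1) + f n = 2 * c"
  shows "\<exists>a b. \<forall>n\<ge>n0. f n = c * real n ^ 2 + b * real n + a"
proof -
  define d where "d = f (n0 + 1) - f n0"
  have "f (n0 + k) = f n0 + real k * d + c * (real k * (real k - 1)) \<and>
      f (n0 + k + 1) - f (n0 + k) = d + 2 * c * real k" for k
  proof (induction k)
    case 0
    then show ?case by (simp add: d_def)
  next
    case (Suc k)
    have e: "f (n0 + Suc k) = f (n0 + k) + (d + 2 * c * real k)"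
      "f (n0 + Suc k + 1) - f (n0 + Suc k) = 2 * c + (d + 2 * c * real k)"
      using Suc assms[of "n0 + k"] by (auto simp: algebra_simps eval_nat_numeral)
    then show ?case using Suc by (simp add: algebra_simps)
  qed
  then have k: "f (n0 + k) = f n0 + real k * d + c * (real k * (real k - 1))" for k by blast
  have "f n = c * real n ^ 2 + (d - c * (2 * real n0 + 1)) * real n
      + (f n0 - real n0 * d + c * (real n0 * (real n0 + 1)))" if "n \<ge> n0" for n
  proof -
    have "real (n - n0) = real n - real n0" using that by (simp add: of_nat_diff)
    then show ?thesis
      using k[of "n - n0"] that by (simp add: power2_eq_square algebra_simps)
  qed
  then show ?thesis by blast
qed

lemma quartic_eq_0_if_infinitely_many_roots:
  fixes a :: "nat \<Rightarrow> real"
  assumes "\<And>n. n \<ge> n0 \<Longrightarrow> a 4 * real n ^ 4 + a 3 * real n ^ 3 + a 2 * real n ^ 2 + a 1 * real n + a 0 = 0"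
  shows "a 4 = 0 \<and> a 3 = 0 \<and> a 2 = 0 \<and> a 1 = 0 \<and> a 0 = 0"
proof -
  define p where "p = [:a 0, a 1, a 2, a 3, a 4:]"
  have "p = 0"
  proof (rule ccontr)
    assume "p \<noteq> 0"
    then have "finite {x. poly p x = 0}" by (rule poly_roots_finite)
    moreover have "real ` {n0..} \<subseteq> {x. poly p x = 0}"
      using assms by (auto simp: p_def algebra_simps power2_eq_square power3_eq_cube power4_eq_xxxx)
    ultimately have "finite (real ` {n0..})" by (rule rev_finite_subset)
    then show False by (simp add: finite_image_iff infinite_Ici)
  qed
  then show ?thesis by (simp add: p_def)
qed

lemma integer_square_quartic:
  fixes g c3 c2 c1 c0 :: real
  assumes "\<And>n. n \<ge> 1 \<Longrightarrow> \<exists>k::int. (of_int k)^2 = g^2 * real n ^ 4 + c3 * real n ^ 3 + c2 * real n ^ 2 + c1 * real n + c0"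
  shows "\<exists>a b c. c^2 = g^2 \<and> 2 * b * c = c3 \<and> 2 * a * c + b^2 = c2 \<and> 2 * a * b = c1 \<and> a^2 = c0"
proof -
  have "\<forall>n. \<exists>k::int. n \<ge> 1 \<longrightarrow> (of_int k)^2 = g^2 * real n ^ 4 + c3 * real n ^ 3 + c2 * real n ^ 2 + c1 * real n + c0"
    using assms by blast
  then obtain k :: "nat \<Rightarrow> int" where k: "\<And>n. n \<ge> 1 \<Longrightarrow>
      (of_int (k n))^2 = g^2 * real n ^ 4 + c3 * real n ^ 3 + c2 * real n ^ 2 + c1 * real n + c0" by metis
  \<comment> \<open>Shifted by one because nothing is assumed at \<open>n = 0\<close>; the absolute
    value selects the nonnegative root.\<close>
  define f where "f n = \<bar>real_of_int (k (n + 1))\<bar>" for n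
  have f2: "f n ^ 2 = g^2 * real (n+1) ^ 4 + c3 * real (n+1) ^ 3 + c2 * real (n+1) ^ 2 + c1 * real (n+1) + c0" for n
    using k[of "n + 1"] by (simp add: f_def)
  have "\<exists>L. (\<lambda>n. f (n + 2) - 2 * f (n + 1) + f n) \<longlonglongrightarrow> L"
  proof (rule second_difference_sqrt_quartic_converges)
    show "(f n)^2 = g^2 * real n ^ 4 + (4 * g^2 + c3) * real n ^ 3 + (6 * g^2 + 3 * c3 + c2) * real n ^ 2
        + (4 * g^2 + 3 * c3 + 2 * c2 + c1) * real n + (g^2 + c3 + c2 + c1 + c0)" for n
      unfolding f2 by (simp add: algebra_simps power2_eq_square power3_eq_cube power4_eq_xxxx)
  qed (simp add: f_def)
  moreover have "f (n + 2) - 2 * f (n + 1) + f n \<in> \<int>" for n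
    unfolding f_def by (intro Ints_add Ints_diff Ints_mult) auto
  ultimately obtain c n0 where "\<And>n. n \<ge> n0 \<Longrightarrow> f (n + 2) - 2 * f (n + 1) + f n = c"
    using convergent_integer_sequence_eventually_constant by blast
  then have "\<exists>a b. \<forall>n\<ge>n0. f n = (c / 2) * real n ^ 2 + b * real n + a"
    by (intro eventually_constant_second_difference) auto
  then obtain a b where ab: "\<And>n. n \<ge> n0 \<Longrightarrow> f n = (c / 2) * real n ^ 2 + b * real n + a" by blast
  \<comment> \<open>The quadratic with coefficients \<open>c / 2\<close>, \<open>b\<close>,
    \<open>a\<close>, rewritten from \<open>n - 1\<close> to \<open>n\<close> to undo the
    shift.\<close>
  define C B A where "C = c / 2" and "B = b - c" and "A = a - b + c / 2"
  have F: "(C * real n ^ 2 + B * real n + A)^2 = g^2 * real n ^ 4 + c3 * real n ^ 3 + c2 * real n ^ 2 + c1 * real n + c0"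
    if "n \<ge> n0 + 1" for n
  proof -
    define m where "m = n - 1"
    have m: "n = m + 1" "m \<ge> n0" using that by (auto simp: m_def)
    have "f m = C * real n ^ 2 + B * real n + A"
      unfolding ab[OF m(2)] m(1) C_def B_def A_def by (simp add: power2_eq_square field_simps)
    then show ?thesis using f2[of m] m(1) by simp
  qed
  define e :: "nat \<Rightarrow> real" where "e = (\<lambda>_. 0)(4 := C^2 - g^2, 3 := 2 * B * C - c3, 2 := 2 * A * C + B^2 - c2, 1 := 2 * A * B - c1, 0 := A^2 - c0)"
  have "e 4 = 0 \<and> e 3 = 0 \<and> e 2 = 0 \<and> e 1 = 0 \<and> e 0 = 0"
  proof (rule quartic_eq_0_if_infinitely_many_roots)
    fix n assume "n \<ge> n0 + 1"
    from F[OF this] show "e 4 * real n ^ 4 + e 3 * real n ^ 3 + e 2 * real n ^ 2 + e 1 * real n + e 0 = 0"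
      by (simp add: e_def algebra_simps power2_eq_square power3_eq_cube power4_eq_xxxx)
  qed
  then show ?thesis
    by (intro exI[of _ A] exI[of _ B] exI[of _ C]) (simp add: e_def)
qed

lemma rat_square_in_Ints:
  fixes x :: rat
  assumes "x ^ 2 \<in> \<int>"
  shows "x \<in> \<int>"
proof -
  obtain a b where ab: "quotient_of x = (a, b)" by force
  have b: "b > 0" "coprime a b" and x: "x = of_int a / of_int b"
    using quotient_of_denom_pos[OF ab] quotient_of_coprime[OF ab] quotient_of_div[OF ab] by auto
  obtain k where "x ^ 2 = of_int k" using assms by (auto elim: Ints_cases)
  then have "rat_of_int (a ^ 2) = of_int (k * b ^ 2)"
    using b(1) by (simp add: x power_divide field_simps)
  then have "a ^ 2 = k * b ^ 2" by (simp only: of_int_eq_iff)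
  then have "b ^ 2 dvd a ^ 2" by simp
  then have "b ^ 2 dvd 1"
    using b(2) by (metis coprime_power_left_iff coprime_power_right_iff coprime_absorb_right is_unit_mult_iff one_dvd)
  then have "b = 1" using b(1) by (auto simp: power2_eq_square zmult_eq_1_iff)
  then show ?thesis by (simp add: x)
qed

lemma exists_common_denominator:
  fixes S :: "rat set"
  assumes "finite S"
  obtains M :: int where "M > 0" "\<And>x. x \<in> S \<Longrightarrow> of_int M * x \<in> \<int>"
proof -
  have "\<exists>M::int. M > 0 \<and> (\<forall>x\<in>S. of_int M * x \<in> \<int>)"
    using assms
  proof (induction S)
    case empty
    show ?case by (intro exI[of _ 1]) auto
  next
    case (insert y S)
    then obtain M :: int where M: "M > 0" "\<forall>x\<in>S. of_int M * x \<in> \<int>" by blast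
    obtain a b where ab: "quotient_of y = (a, b)" by force
    have b: "b > 0" and y: "of_int b * y = of_int a"
      using quotient_of_denom_pos[OF ab] quotient_of_div[OF ab] by auto
    have "of_int (M * b) * x \<in> \<int>" if "x \<in> S" for x
    proof -
      have "of_int (M * b) * x = of_int b * (of_int M * x)" by simp
      also have "\<dots> \<in> \<int>" by (rule Ints_mult[OF Ints_of_int bspec[OF M(2) that]])
      finally show ?thesis .
    qed
    moreover have "of_int (M * b) * y \<in> \<int>"
      using y by (simp add: mult.assoc)
    ultimately show ?case
      using M(1) b by (intro exI[of _ "M * b"]) auto
  qed
  then show ?thesis using that by blast
qed

text \<open>The root is a quadratic polynomial in n whose extreme coefficients have the squares
  \<open>g^2\<close> and \<open>h^2\<close>: this is the origin of the signs \<open>s2\<close> and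
  \<open>s1\<close>, while \<open>r4\<close> is minus its linear coefficient.\<close>

lemma rational_square_quartic:
  fixes g c3 c2 c1 h :: rat
  assumes sq: "\<And>n::nat. n \<ge> 1 \<Longrightarrow>
    \<exists>\<rho>. \<rho>^2 = g^2 * of_nat n ^ 4 + c3 * of_nat n ^ 3 + c2 * of_nat n ^ 2 + c1 * of_nat n + h^2"
  shows "\<exists>s1\<in>{1, -1::int}. \<exists>s2\<in>{1, -1::int}. \<exists>r4::rat. c3 = - 2 * of_int s2 * g * r4 \<and>
    c2 = 2 * of_int s1 * of_int s2 * h * g + r4^2 \<and> c1 = - 2 * of_int s1 * h * r4"
proof -
  obtain M :: int where M: "M > 0" "\<And>x. x \<in> {g, c3, c2, c1, h} \<Longrightarrow> of_int M * x \<in> \<int>"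
    by (rule exists_common_denominator[of "{g, c3, c2, c1, h}"]) auto
  \<comment> \<open>Scaling by the common denominator makes the coefficients of the quartic
    integers; then \<open>\<mu> * \<rho>\<close> is rational with integer square, hence an
    integer.\<close>
  define \<mu> :: rat where "\<mu> = of_int M"
  have \<mu>: "\<mu> \<noteq> 0" "\<mu> \<in> \<int>" using M(1) by (auto simp: \<mu>_def)
  have int: "\<mu> * g \<in> \<int>" "\<mu> * c3 \<in> \<int>" "\<mu> * c2 \<in> \<int>" "\<mu> * c1 \<in> \<int>" "\<mu> * h \<in> \<int>"
    using M(2) by (auto simp: \<mu>_def)
  have k: "\<exists>k::int. (of_int k)^2 = (\<mu> * g)^2 * of_nat n ^ 4 + (\<mu>^2 * c3) * of_nat n ^ 3
      + (\<mu>^2 * c2) * of_nat n ^ 2 + (\<mu>^2 * c1) * of_nat n + (\<mu> * h)^2" if n: "n \<ge> 1" for n :: nat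
  proof -
    obtain \<rho> where \<rho>: "\<rho>^2 = g^2 * of_nat n ^ 4 + c3 * of_nat n ^ 3 + c2 * of_nat n ^ 2 + c1 * of_nat n + h^2"
      using sq[OF n] by blast
    have e: "(\<mu> * \<rho>)^2 = (\<mu> * g)^2 * of_nat n ^ 4 + (\<mu>^2 * c3) * of_nat n ^ 3
      + (\<mu>^2 * c2) * of_nat n ^ 2 + (\<mu>^2 * c1) * of_nat n + (\<mu> * h)^2"
      unfolding power_mult_distrib \<rho> by (simp add: algebra_simps)
    also have "\<dots> = (\<mu> * g)^2 * of_nat n ^ 4 + \<mu> * (\<mu> * c3) * of_nat n ^ 3
      + \<mu> * (\<mu> * c2) * of_nat n ^ 2 + \<mu> * (\<mu> * c1) * of_nat n + (\<mu> * h)^2"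
      by (simp add: power2_eq_square mult.assoc)
    also have "\<dots> \<in> \<int>" by (intro Ints_add Ints_mult Ints_power int \<mu>(2) Ints_of_nat)
    finally have "\<mu> * \<rho> \<in> \<int>" by (rule rat_square_in_Ints)
    then show ?thesis using e by (metis Ints_cases)
  qed
  define toR :: "rat \<Rightarrow> real" where "toR = of_rat"
  note toR = of_rat_add of_rat_mult of_rat_power of_rat_diff of_rat_minus
  have "\<exists>a b c. c^2 = (toR (\<mu> * g))^2 \<and> 2 * b * c = toR (\<mu>^2 * c3) \<and> 2 * a * c + b^2 = toR (\<mu>^2 * c2)
    \<and> 2 * a * b = toR (\<mu>^2 * c1) \<and> a^2 = toR ((\<mu> * h)^2)"
  proof (rule integer_square_quartic)
    fix n :: nat assume "n \<ge> 1"
    from k[OF this] obtain k :: int where "(of_int k)^2 = (\<mu> * g)^2 * of_nat n ^ 4 + (\<mu>^2 * c3) * of_nat n ^ 3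
      + (\<mu>^2 * c2) * of_nat n ^ 2 + (\<mu>^2 * c1) * of_nat n + (\<mu> * h)^2" by blast
    then have "toR ((of_int k)^2) = toR ((\<mu> * g)^2 * of_nat n ^ 4 + (\<mu>^2 * c3) * of_nat n ^ 3
      + (\<mu>^2 * c2) * of_nat n ^ 2 + (\<mu>^2 * c1) * of_nat n + (\<mu> * h)^2)" by simp
    then show "\<exists>k::int. (of_int k)^2 = (toR (\<mu> * g))^2 * real n ^ 4 + toR (\<mu>^2 * c3) * real n ^ 3
      + toR (\<mu>^2 * c2) * real n ^ 2 + toR (\<mu>^2 * c1) * real n + toR ((\<mu> * h)^2)"
      unfolding toR_def by (intro exI[of _ k]) (simp add: toR)
  qed
  then obtain a b c where abc: "c^2 = (toR (\<mu> * g))^2" "2 * b * c = toR (\<mu>^2 * c3)"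
    "2 * a * c + b^2 = toR (\<mu>^2 * c2)" "2 * a * b = toR (\<mu>^2 * c1)" "a^2 = toR ((\<mu> * h)^2)" by blast
  have "a^2 = (toR (\<mu> * h))^2" using abc(5) by (simp add: toR_def of_rat_power)
  then obtain s1 :: int where s1: "s1 \<in> {1, -1}" "a = of_int s1 * toR (\<mu> * h)"
    by (metis insertCI mult_1 mult_minus1 of_int_1 of_int_minus power2_eq_iff)
  obtain s2 :: int where s2: "s2 \<in> {1, -1}" "c = of_int s2 * toR (\<mu> * g)"
    using abc(1) by (metis insertCI mult_1 mult_minus1 of_int_1 of_int_minus power2_eq_iff)
  \<comment> \<open>The value at \<open>1\<close> shows that \<open>b\<close> is rational even if \<open>a = c = 0\<close>.\<close>
  obtain \<rho> where \<rho>: "\<rho>^2 = g^2 + c3 + c2 + c1 + h^2" using sq[of 1] by auto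
  have "(a + b + c)^2 = c^2 + 2 * b * c + (2 * a * c + b^2) + 2 * a * b + a^2"
    by (simp add: power2_eq_square algebra_simps)
  also have "\<dots> = (toR (\<mu> * \<rho>))^2"
    unfolding abc toR_def of_rat_power[symmetric] power_mult_distrib \<rho> by (simp add: toR algebra_simps)
  finally have "a + b + c = toR (\<mu> * \<rho>) \<or> a + b + c = - toR (\<mu> * \<rho>)" by (simp add: power2_eq_iff)
  then obtain s :: int where "a + b + c = of_int s * toR (\<mu> * \<rho>)"
    by (metis mult_1 mult_minus1 of_int_1 of_int_minus)
  then have "b = of_int s * toR (\<mu> * \<rho>) - of_int s1 * toR (\<mu> * h) - of_int s2 * toR (\<mu> * g)"
    using s1(2) s2(2) by simp
  also have "\<dots> = toR (- \<mu> * (of_int s1 * h + of_int s2 * g - of_int s * \<rho>))"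
    unfolding toR_def by (simp add: toR algebra_simps)
  finally obtain r4 where b: "b = toR (- \<mu> * r4)" by blast
  have c: "c = toR (\<mu> * (of_int s2 * g))" and a: "a = toR (\<mu> * (of_int s1 * h))"
    unfolding s2(2) s1(2) toR_def by (simp_all add: toR)
  have "toR (\<mu>^2 * (- 2 * of_int s2 * g * r4)) = toR (\<mu>^2 * c3)"
    unfolding abc(2)[symmetric] unfolding b c toR_def by (simp add: toR power2_eq_square)
  moreover have "toR (\<mu>^2 * (2 * of_int s1 * of_int s2 * h * g + r4^2)) = toR (\<mu>^2 * c2)"
    unfolding abc(3)[symmetric] unfolding a b c toR_def by (simp add: toR power2_eq_square algebra_simps)
  moreover have "toR (\<mu>^2 * (- 2 * of_int s1 * h * r4)) = toR (\<mu>^2 * c1)"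
    unfolding abc(4)[symmetric] unfolding a b toR_def by (simp add: toR power2_eq_square)
  moreover have "x = y" if "toR (\<mu>^2 * x) = toR (\<mu>^2 * y)" for x y
    using that \<mu>(1) unfolding toR_def of_rat_eq_iff by simp
  ultimately have "c3 = - 2 * of_int s2 * g * r4 \<and>
    c2 = 2 * of_int s1 * of_int s2 * h * g + r4^2 \<and> c1 = - 2 * of_int s1 * h * r4"
    by metis
  then show ?thesis using s1(1) s2(1) by blast
qed

text \<open>Interpolation at 1, 2, 3: finite differences with rational weights recover the three
  coefficients.\<close>

lemma rational_multiple_quadratic:
  fixes w \<alpha> \<beta> \<gamma> :: complex
  assumes "\<And>m::nat. m \<ge> 1 \<Longrightarrow> \<exists>r::rat. \<alpha> + \<beta> * of_nat m + \<gamma> * of_nat m ^ 2 = of_rat r * w"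
  shows "(\<exists>r::rat. \<gamma> = of_rat r * w) \<and> (\<exists>r::rat. \<beta> = of_rat r * w) \<and> (\<exists>r::rat. \<alpha> = of_rat r * w)"
proof -
  obtain p1 p2 p3 :: rat where p: "\<alpha> + \<beta> + \<gamma> = of_rat p1 * w"
    "\<alpha> + \<beta> * 2 + \<gamma> * 4 = of_rat p2 * w" "\<alpha> + \<beta> * 3 + \<gamma> * 9 = of_rat p3 * w"
    using assms[of 1] assms[of 2] assms[of 3] by auto
  define r s where "r = (p3 - 2 * p2 + p1) / 2" and "s = p2 - p1 - 3 * r"
  have "\<gamma> = ((\<alpha> + \<beta> * 3 + \<gamma> * 9) - 2 * (\<alpha> + \<beta> * 2 + \<gamma> * 4) + (\<alpha> + \<beta> + \<gamma>)) / 2" by simp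
  also have "\<dots> = of_rat r * w"
    unfolding p by (simp add: r_def of_rat_divide of_rat_add of_rat_diff of_rat_mult algebra_simps)
  finally have g: "\<gamma> = of_rat r * w" .
  have "\<beta> = (\<alpha> + \<beta> * 2 + \<gamma> * 4) - (\<alpha> + \<beta> + \<gamma>) - 3 * \<gamma>" by simp
  also have "\<dots> = of_rat s * w"
    unfolding p unfolding g by (simp add: s_def of_rat_diff of_rat_mult of_rat_add algebra_simps)
  finally have b: "\<beta> = of_rat s * w" .
  have "\<alpha> = (\<alpha> + \<beta> + \<gamma>) - \<beta> - \<gamma>" by simp
  also have "\<dots> = of_rat (p1 - s - r) * w"
    unfolding p unfolding b g by (simp add: of_rat_diff of_rat_add algebra_simps)
  finally show ?thesis using g b by blast
qed

section \<open>The parametrisation of the coupling constants\<close>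

lemma of_rat_R1:
  "(of_rat (R1 N r1 r2 r3) :: complex) = of_rat r1 + of_nat N * (of_rat r2 + (of_nat N - 1) * of_rat r3)"
  by (simp add: R1_def of_rat_add of_rat_mult of_rat_diff)

lemma of_rat_R2:
  "(of_rat (R2 N r2 r3) :: complex) = of_rat r2 + (2 * of_nat N - 1) * of_rat r3"
  by (simp add: R2_def of_rat_add of_rat_mult of_rat_diff)

lemma damping_of_rat:
  assumes "cE K = - 2 * \<i> * of_rat r1 * of_real \<omega>" "cD K 1 = - 2 * \<i> * of_rat r2 * of_real \<omega>"
    "cG K 2 = - 2 * \<i> * of_rat r3 * of_real \<omega>"
  shows "damping N K m = - 2 * \<i> * of_real \<omega> *
    of_rat (R1 N r1 r2 r3 - R2 N r2 r3 * of_nat m + r3 * of_nat m ^ 2)"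
  unfolding damping_def assms of_rat_add of_rat_diff of_rat_mult of_rat_power of_rat_R1 of_rat_R2
  by (simp add: algebra_simps power2_eq_square)

lemma Delta_sq_of_rat:
  assumes E: "cE K = - 2 * \<i> * of_rat r1 * of_real \<omega>" "cD K 1 = - 2 * \<i> * of_rat r2 * of_real \<omega>"
    "cG K 2 = - 2 * \<i> * of_rat r3 * of_real \<omega>"
    and A: "cA K 2 = of_rat a * of_real \<omega> ^ 2" "cB K 1 = of_rat b * of_real \<omega> ^ 2" "cF K 3 = of_rat f * of_real \<omega> ^ 2"
  shows "Delta_sq N K m = - 4 * of_real \<omega> ^ 2 *
    of_rat ((R1 N r1 r2 r3 - R2 N r2 r3 * of_nat m + r3 * of_nat m ^ 2) ^ 2
      - of_nat m * ((2 * of_nat N - 1 - of_nat m) * a + b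
         + (3 * of_nat N ^ 2 - 6 * of_nat N + 2 - 3 * (of_nat N - 1) * of_nat m + of_nat m ^ 2) * f))"
proof -
  define R where "R = R1 N r1 r2 r3 - R2 N r2 r3 * of_nat m + r3 * of_nat m ^ 2"
  define X where "X = (2 * of_nat N - 1 - of_nat m) * a + b
         + (3 * of_nat N ^ 2 - 6 * of_nat N + 2 - 3 * (of_nat N - 1) * of_nat m + of_nat m ^ 2) * f"
  have X: "(2 * of_nat N - 1 - of_nat m) * cA K 2 + cB K 1
         + (3 * of_nat N ^ 2 - 6 * of_nat N + 2 - 3 * (of_nat N - 1) * of_nat m + of_nat m ^ 2) * cF K 3
     = of_rat X * of_real \<omega> ^ 2"
    unfolding A X_def by (simp add: of_rat_add of_rat_mult of_rat_diff of_rat_power algebra_simps)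
  have i: "(\<i> * c)^2 = - (c^2)" for c by (simp add: power_mult_distrib)
  have "Delta_sq N K m = (- 2 * \<i> * of_real \<omega> * of_rat R) ^ 2 + 4 * of_nat m * (of_rat X * of_real \<omega> ^ 2)"
    unfolding Delta_sq_def X damping_of_rat[OF E] R_def ..
  also have "\<dots> = - 4 * of_real \<omega> ^ 2 * of_rat (R ^ 2 - of_nat m * X)"
    by (simp add: power_mult_distrib of_rat_diff of_rat_mult of_rat_power algebra_simps)
  finally show ?thesis unfolding R_def X_def .
qed

text \<open>Source of the formulas for \<open>f3\<close>, \<open>a2\<close> and \<open>b1\<close>:
  the bracket is what turns the square of the damping quadratic into the square of a second
  quadratic with the same extreme coefficients up to sign.\<close>

lemma quartic_complete_square:
  fixes h g R r4 m :: rat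
  assumes s: "s1 \<in> {1, -1::int}" "s2 \<in> {1, -1::int}"
  shows "(h - R * m + g * m ^ 2) ^ 2 - m * (2 * h * (of_int s1 * r4 - R)
      + (R ^ 2 - r4 ^ 2 - 2 * (of_int s1 * of_int s2 - 1) * h * g) * m + 2 * g * (of_int s2 * r4 - R) * m ^ 2)
    = (of_int s1 * h - r4 * m + of_int s2 * g * m ^ 2) ^ 2"
  using s by (auto simp: power2_eq_square algebra_simps)

lemma eigval_set_of_restrictions:
  assumes r: "restrictions N \<omega> K r1 r2 r3 r4 s1 s2" and s: "s1 \<in> {1, -1}" "s2 \<in> {1, -1}"
  shows "{eigval N K 1 m, eigval N K (-1) m} =
             {\<i> * of_rat (freq N r1 r2 r3 r4 s1 s2 1 m) * of_real \<omega>,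
              \<i> * of_rat (freq N r1 r2 r3 r4 s1 s2 (-1) m) * of_real \<omega>}"
proof -
  define h R where "h = R1 N r1 r2 r3" and "R = R2 N r2 r3"
  define Y where "Y = h - R * of_nat m + r3 * of_nat m ^ 2"
  define Q where "Q = of_int s1 * h - r4 * of_nat m + of_int s2 * r3 * of_nat m ^ 2"
  note r' = r[unfolded restrictions_def]
  have d: "damping N K m = - 2 * \<i> * of_real \<omega> * of_rat Y"
    unfolding Y_def h_def R_def by (rule damping_of_rat) (use r' in auto)
  have X: "(2 * of_nat N - 1 - of_nat m) * a2 N r1 r2 r3 r4 s1 s2 + b1 N r1 r2 r3 r4 s1 s2
      + (3 * of_nat N ^ 2 - 6 * of_nat N + 2 - 3 * (of_nat N - 1) * of_nat m + of_nat m ^ 2) * f3 N r2 r3 r4 s2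
     = 2 * h * (of_int s1 * r4 - R) + (R ^ 2 - r4 ^ 2 - 2 * (of_int s1 * of_int s2 - 1) * h * r3) * of_nat m
       + 2 * r3 * (of_int s2 * r4 - R) * of_nat m ^ 2"
    unfolding b1_def a2_def f3_def h_def[symmetric] R_def[symmetric] by (simp add: algebra_simps power2_eq_square)
  have "Delta_sq N K m = - 4 * of_real \<omega> ^ 2 * of_rat (Q ^ 2)"
    using Delta_sq_of_rat[where a = "a2 N r1 r2 r3 r4 s1 s2" and b = "b1 N r1 r2 r3 r4 s1 s2"
        and f = "f3 N r2 r3 r4 s2" and N = N and K = K and m = m and ?r1.0 = r1 and ?r2.0 = r2 and ?r3.0 = r3 and \<omega> = \<omega>] r'
    unfolding X h_def[symmetric] R_def[symmetric] quartic_complete_square[OF s] Q_def by blast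
  also have "\<dots> = (2 * \<i> * of_real \<omega> * of_rat Q) ^ 2"
    by (simp add: power_mult_distrib of_rat_power)
  finally have "csqrt (Delta_sq N K m) ^ 2 = (2 * \<i> * of_real \<omega> * of_rat Q) ^ 2"
    unfolding power2_csqrt .
  then have c: "csqrt (Delta_sq N K m) = 2 * \<i> * of_real \<omega> * of_rat Q \<or> csqrt (Delta_sq N K m) = - (2 * \<i> * of_real \<omega> * of_rat Q)"
    unfolding power2_eq_iff .
  have f: "freq N r1 r2 r3 r4 s1 s2 1 m = Y + Q" "freq N r1 r2 r3 r4 s1 s2 (-1) m = Y - Q"
    unfolding freq_def Y_def Q_def h_def[symmetric] R_def[symmetric] by (simp_all add: algebra_simps)
  from c show ?thesis
  proof
    assume "csqrt (Delta_sq N K m) = 2 * \<i> * of_real \<omega> * of_rat Q"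
    then have "eigval N K 1 m = \<i> * of_rat (Y - Q) * of_real \<omega>" "eigval N K (-1) m = \<i> * of_rat (Y + Q) * of_real \<omega>"
      by (simp_all add: eigval_def d of_rat_add of_rat_diff field_simps)
    then show ?thesis unfolding f by auto
  next
    assume "csqrt (Delta_sq N K m) = - (2 * \<i> * of_real \<omega> * of_rat Q)"
    then have "eigval N K 1 m = \<i> * of_rat (Y + Q) * of_real \<omega>" "eigval N K (-1) m = \<i> * of_rat (Y - Q) * of_real \<omega>"
      by (simp_all add: eigval_def d of_rat_add of_rat_diff field_simps)
    then show ?thesis unfolding f by auto
  qed
qed

lemma restrictions_if_all_rational:
  assumes \<omega>: "\<omega> > 0" and rat: "\<And>m. m \<ge> 1 \<Longrightarrow> rational_eigval N K \<omega> m"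
  shows "\<exists>(r1::rat) (r2::rat) (r3::rat) (r4::rat). \<exists>s1\<in>{1, -1}. \<exists>s2\<in>{1, -1}.
           restrictions N \<omega> K r1 r2 r3 r4 s1 s2"
proof -
  let ?w = "\<i> * of_real \<omega>" and ?w2 = "of_real \<omega> ^ 2 :: complex"
  have w: "?w \<noteq> 0" "?w2 \<noteq> 0" using \<omega> by auto
  have "\<exists>p n. eigval N K 1 m = of_rat p * ?w \<and> eigval N K (-1) m = of_rat n * ?w" if "m \<ge> 1" for m
    using rat[OF that] unfolding rational_eigval_def by (auto simp: algebra_simps)
  then obtain p n where pn: "\<And>m. m \<ge> 1 \<Longrightarrow> eigval N K 1 m = of_rat (p m) * ?w \<and> eigval N K (-1) m = of_rat (n m) * ?w"
    by metis
  have damp: "damping N K m = of_rat (- p m - n m) * ?w" if "m \<ge> 1" for m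
    using eigval_sum[of N K m] pn[OF that]
    by (simp add: of_rat_diff of_rat_minus algebra_simps eq_neg_iff_add_eq_0)
  have Delta: "Delta_sq N K m = - ?w2 * of_rat ((p m - n m) ^ 2)" if "m \<ge> 1" for m
  proof -
    have "csqrt (Delta_sq N K m) = eigval N K (-1) m - eigval N K 1 m"
      by (simp add: eigval_def field_simps)
    also have "\<dots> = of_rat (n m - p m) * ?w" using pn[OF that] by (simp add: of_rat_diff algebra_simps)
    finally have "Delta_sq N K m = (of_rat (n m - p m) * ?w) ^ 2" by (metis power2_csqrt)
    then show ?thesis by (simp add: power_mult_distrib of_rat_power of_rat_diff power2_commute)
  qed
  \<comment> \<open>These are the three coefficients of the damping as a quadratic polynomial in
    \<open>m\<close>.\<close>
  have "(\<exists>r::rat. cG K 2 = of_rat r * ?w) \<and> (\<exists>r::rat. - cD K 1 - (2 * of_nat N - 1) * cG K 2 = of_rat r * ?w)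
    \<and> (\<exists>r::rat. cE K + of_nat N * (cD K 1 + (of_nat N - 1) * cG K 2) = of_rat r * ?w)"
  proof (rule rational_multiple_quadratic)
    fix m :: nat assume m: "m \<ge> 1"
    have "cE K + of_nat N * (cD K 1 + (of_nat N - 1) * cG K 2) + (- cD K 1 - (2 * of_nat N - 1) * cG K 2) * of_nat m
        + cG K 2 * of_nat m ^ 2 = damping N K m"
      by (simp add: damping_def algebra_simps power2_eq_square)
    then show "\<exists>r::rat. cE K + of_nat N * (cD K 1 + (of_nat N - 1) * cG K 2) + (- cD K 1 - (2 * of_nat N - 1) * cG K 2) * of_nat m
        + cG K 2 * of_nat m ^ 2 = of_rat r * ?w"
      using damp[OF m] by metis
  qed
  then obtain g d e :: rat where gde: "cG K 2 = of_rat g * ?w" "- cD K 1 - (2 * of_nat N - 1) * cG K 2 = of_rat d * ?w"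
    "cE K + of_nat N * (cD K 1 + (of_nat N - 1) * cG K 2) = of_rat e * ?w" by blast
  \<comment> \<open>Solved from the top coefficient downwards; the halves undo the normalisation
    \<open>- 2 * \<i>\<close> in \<open>restrictions\<close>.\<close>
  define r3 r2 r1 where "r3 = - g / 2" and "r2 = (d + (2 * of_nat N - 1) * g) / 2"
    and "r1 = - e / 2 - of_nat N * (r2 + (of_nat N - 1) * r3)"
  have 3: "cG K 2 = - 2 * \<i> * of_rat r3 * of_real \<omega>"
    unfolding gde(1) by (simp add: r3_def of_rat_divide of_rat_minus)
  have "cD K 1 = - (of_rat d * ?w) - (2 * of_nat N - 1) * cG K 2" unfolding gde(2)[symmetric] by simp
  also have "\<dots> = - 2 * \<i> * of_rat r2 * of_real \<omega>"
    unfolding gde(1) by (simp add: r2_def of_rat_divide of_rat_add of_rat_mult of_rat_diff algebra_simps)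
  finally have 2: "cD K 1 = - 2 * \<i> * of_rat r2 * of_real \<omega>" .
  have "cE K = of_rat e * ?w - of_nat N * (cD K 1 + (of_nat N - 1) * cG K 2)" unfolding gde(3)[symmetric] by simp
  also have "\<dots> = - 2 * \<i> * of_rat r1 * of_real \<omega>"
    unfolding 2 3 by (simp add: r1_def of_rat_divide of_rat_minus of_rat_add of_rat_mult of_rat_diff algebra_simps)
  finally have 1: "cE K = - 2 * \<i> * of_rat r1 * of_real \<omega>" .
  have "(\<exists>r::rat. cF K 3 = of_rat r * ?w2) \<and> (\<exists>r::rat. - cA K 2 - 3 * (of_nat N - 1) * cF K 3 = of_rat r * ?w2)
    \<and> (\<exists>r::rat. (2 * of_nat N - 1) * cA K 2 + cB K 1 + (3 * of_nat N ^ 2 - 6 * of_nat N + 2) * cF K 3 = of_rat r * ?w2)"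
  proof (rule rational_multiple_quadratic)
    fix m :: nat assume m: "m \<ge> 1"
    let ?X = "(2 * of_nat N - 1) * cA K 2 + cB K 1 + (3 * of_nat N ^ 2 - 6 * of_nat N + 2) * cF K 3
        + (- cA K 2 - 3 * (of_nat N - 1) * cF K 3) * of_nat m + cF K 3 * of_nat m ^ 2"
    \<comment> \<open>\<open>Delta_sq\<close> contains the full square of the damping, so the
      difference has a factor \<open>m\<close>; dividing by it leaves a quadratic in
      \<open>m\<close>, to which interpolation applies.\<close>
    have "4 * of_nat m * ?X = Delta_sq N K m - damping N K m ^ 2"
      by (simp add: Delta_sq_def algebra_simps)
    also have "\<dots> = of_rat ((p m + n m) ^ 2 - (p m - n m) ^ 2) * ?w2"
      unfolding Delta[OF m] damp[OF m]
      by (simp add: power_mult_distrib of_rat_power of_rat_diff of_rat_minus of_rat_add of_rat_mult power2_eq_square algebra_simps)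
    finally have "?X = of_rat (((p m + n m) ^ 2 - (p m - n m) ^ 2) / (4 * of_nat m)) * ?w2"
      using m by (simp add: of_rat_divide of_rat_mult field_simps)
    then show "\<exists>r::rat. ?X = of_rat r * ?w2" by blast
  qed
  then obtain f a' b' :: rat where fab: "cF K 3 = of_rat f * ?w2" "- cA K 2 - 3 * (of_nat N - 1) * cF K 3 = of_rat a' * ?w2"
    "(2 * of_nat N - 1) * cA K 2 + cB K 1 + (3 * of_nat N ^ 2 - 6 * of_nat N + 2) * cF K 3 = of_rat b' * ?w2" by blast
  define a b where "a = - a' - 3 * (of_nat N - 1) * f" and "b = b' - (2 * of_nat N - 1) * a - (3 * of_nat N ^ 2 - 6 * of_nat N + 2) * f"
  have "cA K 2 = - (of_rat a' * ?w2) - 3 * (of_nat N - 1) * cF K 3" unfolding fab(2)[symmetric] by simp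
  also have "\<dots> = of_rat a * ?w2"
    unfolding fab(1) by (simp add: a_def of_rat_mult of_rat_diff of_rat_minus of_rat_add algebra_simps)
  finally have A: "cA K 2 = of_rat a * ?w2" .
  have "cB K 1 = of_rat b' * ?w2 - (2 * of_nat N - 1) * cA K 2 - (3 * of_nat N ^ 2 - 6 * of_nat N + 2) * cF K 3"
    unfolding fab(3)[symmetric] by simp
  also have "\<dots> = of_rat b * ?w2"
    unfolding fab(1) A by (simp add: b_def of_rat_mult of_rat_diff of_rat_add of_rat_power algebra_simps)
  finally have B: "cB K 1 = of_rat b * ?w2" .
  define h R where "h = R1 N r1 r2 r3" and "R = R2 N r2 r3"
  define t where "t = (2 * of_nat N - 1) * a + b + (3 * of_nat N ^ 2 - 6 * of_nat N + 2) * f"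
  have "\<exists>\<rho>. \<rho>^2 = r3^2 * of_nat m ^ 4 + (- 2 * R * r3 - f) * of_nat m ^ 3
      + (2 * h * r3 + R^2 + a + 3 * (of_nat N - 1) * f) * of_nat m ^ 2 + (- 2 * h * R - t) * of_nat m + h^2"
    if m: "m \<ge> 1" for m :: nat
  proof
    define Z where "Z = (h - R * of_nat m + r3 * of_nat m ^ 2) ^ 2
      - of_nat m * ((2 * of_nat N - 1 - of_nat m) * a + b
         + (3 * of_nat N ^ 2 - 6 * of_nat N + 2 - 3 * (of_nat N - 1) * of_nat m + of_nat m ^ 2) * f)"
    have "- ?w2 * of_rat ((p m - n m) ^ 2) = - 4 * ?w2 * of_rat Z"
      using Delta_sq_of_rat[OF 1 2 3 A B fab(1), of N m] Delta[OF m]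
      unfolding Z_def h_def R_def by simp
    then have "of_rat ((p m - n m) ^ 2) = (of_rat (4 * Z) :: complex)"
      using w(2) by (simp add: of_rat_mult)
    then have "(p m - n m) ^ 2 = 4 * Z" by (simp only: of_rat_eq_iff)
    \<comment> \<open>The witness is half the difference of the two frequencies, because
      \<open>csqrt (Delta_sq N K m)\<close> is the difference of the two eigenvalues.\<close>
    then have "((p m - n m) / 2) ^ 2 = Z" by (simp add: power_divide)
    also have "Z = r3^2 * of_nat m ^ 4 + (- 2 * R * r3 - f) * of_nat m ^ 3
      + (2 * h * r3 + R^2 + a + 3 * (of_nat N - 1) * f) * of_nat m ^ 2 + (- 2 * h * R - t) * of_nat m + h^2"
      unfolding Z_def t_def by (simp add: algebra_simps power2_eq_square power3_eq_cube power4_eq_xxxx)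
    finally show "((p m - n m) / 2) ^ 2 = \<dots>" .
  qed
  from rational_square_quartic[OF this] obtain s1 s2 r4 where s: "s1 \<in> {1, -1::int}" "s2 \<in> {1, -1::int}"
    and c: "- 2 * R * r3 - f = - 2 * of_int s2 * r3 * r4"
      "2 * h * r3 + R^2 + a + 3 * (of_nat N - 1) * f = 2 * of_int s1 * of_int s2 * h * r3 + r4^2"
      "- 2 * h * R - t = - 2 * of_int s1 * h * r4" by blast
  have f: "f = f3 N r2 r3 r4 s2"
    using c(1) unfolding f3_def R_def[symmetric] by (simp add: algebra_simps)
  have a: "a = a2 N r1 r2 r3 r4 s1 s2"
    using c(2) unfolding a2_def f[symmetric] R_def[symmetric] h_def[symmetric] by (simp add: algebra_simps)
  have b: "b = b1 N r1 r2 r3 r4 s1 s2"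
    using c(3) unfolding b1_def f[symmetric] a[symmetric] R_def[symmetric] h_def[symmetric] t_def by (simp add: algebra_simps)
  have "restrictions N \<omega> K r1 r2 r3 r4 s1 s2"
    unfolding restrictions_def f[symmetric] a[symmetric] b[symmetric] using 1 2 3 A B fab(1) by blast
  then show ?thesis using s by blast
qed

theorem mainTheorem5:
  fixes N :: nat and \<omega> :: real and K :: couplings
  assumes "N \<ge> 1" and "\<omega> > 0" and "case1 K \<or> case2 K"
  shows
    "((\<exists>q::nat. q > 0 \<and> isochronous N K (2 * pi * real q / \<omega>)) \<longrightarrow>
        (\<forall>m\<in>{1..N}. rational_eigval N K \<omega> m)) \<and>
     ((\<exists>q::nat. q > 0 \<and> isochronous N K (2 * pi * real q / \<omega>)) \<and>
        (\<forall>m>N. rational_eigval N K \<omega> m) \<longrightarrow>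
        (\<exists>(r1::rat) (r2::rat) (r3::rat) (r4::rat). \<exists>s1\<in>{1, -1}. \<exists>s2\<in>{1, -1}.
           restrictions N \<omega> K r1 r2 r3 r4 s1 s2)) \<and>
     (\<forall>(r1::rat) (r2::rat) (r3::rat) (r4::rat). \<forall>s1\<in>{1, -1}. \<forall>s2\<in>{1, -1}.
        restrictions N \<omega> K r1 r2 r3 r4 s1 s2 \<longrightarrow>
          (\<forall>m\<ge>1. {eigval N K 1 m, eigval N K (-1) m} =
             {\<i> * of_rat (freq N r1 r2 r3 r4 s1 s2 1 m) * of_real \<omega>,
              \<i> * of_rat (freq N r1 r2 r3 r4 s1 s2 (-1) m) * of_real \<omega>}) \<and>
          (no_coincidence N K \<longrightarrow> isochronous N K (period N \<omega> r1 r2 r3 r4 s1 s2)))"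
proof (intro conjI impI allI ballI)
  note K = assms(3) and \<omega> = assms(2)
  {
    fix m assume "\<exists>q::nat. q > 0 \<and> isochronous N K (2 * pi * real q / \<omega>)" "m \<in> {1..N}"
    then show "rational_eigval N K \<omega> m"
      using isochronous_imp_rational_eigval[OF assms(1) K \<omega>] by blast
  } note necessary = this
  assume iso: "(\<exists>q::nat. q > 0 \<and> isochronous N K (2 * pi * real q / \<omega>)) \<and> (\<forall>m>N. rational_eigval N K \<omega> m)"
  show "\<exists>(r1::rat) (r2::rat) (r3::rat) (r4::rat). \<exists>s1\<in>{1, -1}. \<exists>s2\<in>{1, -1}.
           restrictions N \<omega> K r1 r2 r3 r4 s1 s2"
  proof (rule restrictions_if_all_rational[OF \<omega>])
    fix m :: nat assume "m \<ge> 1"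
    then show "rational_eigval N K \<omega> m"
      using iso necessary[of m] by (cases "m \<le> N") auto
  qed
next
  fix r1 r2 r3 r4 :: rat and s1 s2 :: int and m :: nat
  assume s: "s1 \<in> {1, -1}" "s2 \<in> {1, -1}" and r: "restrictions N \<omega> K r1 r2 r3 r4 s1 s2"
  show "{eigval N K 1 m, eigval N K (-1) m} =
             {\<i> * of_rat (freq N r1 r2 r3 r4 s1 s2 1 m) * of_real \<omega>,
              \<i> * of_rat (freq N r1 r2 r3 r4 s1 s2 (-1) m) * of_real \<omega>}"
    by (rule eigval_set_of_restrictions[OF r s])
next
  fix r1 r2 r3 r4 :: rat and s1 s2 :: int
  assume s: "s1 \<in> {1, -1}" "s2 \<in> {1, -1}" and r: "restrictions N \<omega> K r1 r2 r3 r4 s1 s2"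
    and nc: "no_coincidence N K"
  show "isochronous N K (period N \<omega> r1 r2 r3 r4 s1 s2)"
    using exp_eigval_period[OF assms(2) s eigval_set_of_restrictions[OF r s]] period_pos[OF assms(2)]
    by (intro isochronous_sufficient[OF assms(1,3) nc]) auto
qed

end
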